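(* Let $m,n,k,L$ be positive integers with $m<n$, and let $\sigma_w>0$. Suppose that $g_{\boldsymbol{\theta}}(\mathbf{u})\in\mathbb{R}^n$, as a function of $\boldsymbol{\theta}\in[-1,1]^k$, is Lipschitz with Lipschitz constant $1$, and let $\mathcal{C}=\{g_{\boldsymbol{\theta}}(\mathbf{u}):\boldsymbol{\theta}\in[-1,1]^k\}$. Let $\mathbf{x}_o\in\mathcal{C}$ satisfy $0<x_{\min}\le x_{o,i}\le x_{\max}$ for all $i=1,\dots,n$, and let $X_o=\mathrm{diag}(\mathbf{x}_o)$. Let the entries of $A\in\mathbb{R}^{m\times n}$ be i.i.d. $\mathcal{N}(0,1)$, let $\mathbf{w}_1,\dots,\mathbf{w}_L$ be i.i.d. $\mathcal{N}(0,\sigma_w^2I_n)$, independent of $A$, and let $\mathbf{y}_\ell=AX_o\mathbf{w}_\ell$ for $\ell=1,\dots,L$ (no additive noise). Let $\hat{\mathbf{x}}$ be a minimizer over $\mathbf{x}\in\mathcal{C}$ of $$f(\mathbf{x})=\log\det\left(\sigma_w^2AX^2A^T\right)+\frac1L\sum_{\ell=1}^L\mathbf{y}_\ell^T\left(\sigma_w^2AX^2A^T\right)^{-1}\mathbf{y}_\ell,\qquad X=\mathrm{diag}(\mathbf{x}).$$ Then $$\frac1n\|\hat{\mathbf{x}}-\mathbf{x}_o\|_2^2=O\left(\frac{\sqrt{k\log n}}{m}+\frac{n\sqrt{k\log n}}{m\sqrt{Lm}}\right)$$ with probability $1-O\left(e^{-\frac m2}+e^{-\frac{Ln}{8}}+e^{-k\log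 n}+e^{k\log n-\frac n2}\right)$.
   Context: The model is real-valued multilook imaging with speckle (multiplicative) noise and no additive noise: the unknown signal $\mathbf{x}_o\in\mathbb{R}^n$ is to be recovered from $\mathbf{y}_1,\dots,\mathbf{y}_L$ and $A$, where $L$ is the number of looks and $A$ is the same for all looks. The function $g_{\boldsymbol{\theta}}(\mathbf{u})$ is a neural network (deep image prior) with $k$ parameters $\boldsymbol{\theta}$ and input $\mathbf{u}$, whose entries are generated i.i.d. from $\mathcal{N}(0,1)$. The function $f$ is, up to constants, the negative log-likelihood, so $\hat{\mathbf{x}}$ is the maximum likelihood estimator over the range of the network. The bounds $x_{\min},x_{\max}$ are regarded as fixed in the $O(\cdot)$ notation.
   Formalization: The bounds x_min ≤ x_i ≤ x_max are assumed for every x in C, not only for x_o; with bounds on x_o alone the claim fails, since f depends only on X² and sign-flipped minimizers in C can have error of order k/n. *)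

theory Defs
  imports
    "HOL-Probability.Probability"
    "Jordan_Normal_Form.Determinant"
    "Jordan_Normal_Form.Gauss_Jordan_Elimination"
begin

text \<open>
  The constants hidden in the Landau symbols must not depend on the dimensions, so the
  dimensions have to be quantified inside the statement. Matrices and vectors are therefore
  those of Jordan_Normal_Form, whose dimensions are values, not types; looks and
  coordinates are numbered from 0.
\<close>

hide_const (open) Determinants.det Finite_Cartesian_Product.vec Finite_Cartesian_Product.mat

no_notation
  vec_nth (infixl "$" 90) and
  inner (infix "\<bullet>" 70)

definition l2_norm :: "real vec \<Rightarrow> real" where
  "l2_norm v = sqrt (v \<bullet> v)"

definition param_cube :: "nat \<Rightarrow> real vec set" where
  "param_cube k = {\<theta> \<in> carrier_vec k. \<forall>i<k. \<theta> $ i \<in> {-1..1}}"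

definition signal_class :: "nat \<Rightarrow> (real vec \<Rightarrow> real vec \<Rightarrow> real vec) \<Rightarrow> real vec \<Rightarrow> real vec set" where
  "signal_class k g u = (\<lambda>\<theta>. g \<theta> u) ` param_cube k"

definition lipschitz_on_cube :: "real \<Rightarrow> nat \<Rightarrow> (real vec \<Rightarrow> real vec) \<Rightarrow> bool" where
  "lipschitz_on_cube c k h \<longleftrightarrow>
     (\<forall>\<theta>\<in>param_cube k. \<forall>\<theta>'\<in>param_cube k. l2_norm (h \<theta> - h \<theta>') \<le> c * l2_norm (\<theta> - \<theta>'))"

definition diag_of :: "real vec \<Rightarrow> real mat" where
  "diag_of x = mat_diag (dim_vec x) (\<lambda>i. x $ i)"

text \<open>
  The joint law of the sensing matrix and the speckle. An outcome is a pair of arrays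
  \<open>(a, w)\<close>; all entries are independent, those of \<open>a\<close> are N(0,1) and those of \<open>w\<close>,
  indexed by (look, coordinate), are N(0,\<open>\<sigma>\<^sup>2\<close>). (The second argument of
  \<open>normal_density\<close> is the standard deviation.) The arrays are \<open>undefined\<close> outside
  their index sets, as always for \<open>PiM\<close>. The assertion concerns only this law; fixing the
  space keeps the constants from depending on the type of some sample space.
\<close>

type_synonym outcome = "(nat \<times> nat \<Rightarrow> real) \<times> (nat \<times> nat \<Rightarrow> real)"

definition speckle_space :: "nat \<Rightarrow> nat \<Rightarrow> nat \<Rightarrow> real \<Rightarrow> outcome measure" where
  "speckle_space m n L \<sigma> =
     PiM ({..<m} \<times> {..<n}) (\<lambda>_. density lborel (\<lambda>t. ennreal (normal_density 0 1 t)))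
     \<Otimes>\<^sub>M PiM ({..<L} \<times> {..<n}) (\<lambda>_. density lborel (\<lambda>t. ennreal (normal_density 0 \<sigma> t)))"

definition sensing_mat :: "nat \<Rightarrow> nat \<Rightarrow> outcome \<Rightarrow> real mat" where
  "sensing_mat m n \<omega> = Matrix.mat m n (fst \<omega>)"

definition speckle :: "nat \<Rightarrow> outcome \<Rightarrow> nat \<Rightarrow> real vec" where
  "speckle n \<omega> l = Matrix.vec n (\<lambda>i. snd \<omega> (l, i))"

definition observation :: "nat \<Rightarrow> nat \<Rightarrow> real vec \<Rightarrow> outcome \<Rightarrow> nat \<Rightarrow> real vec" where
  "observation m n xo \<omega> l = (sensing_mat m n \<omega> * diag_of xo) *\<^sub>v speckle n \<omega> l"

definition cov_mat :: "real \<Rightarrow> real mat \<Rightarrow> real vec \<Rightarrow> real mat" where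
  "cov_mat \<sigma> A x = \<sigma>\<^sup>2 \<cdot>\<^sub>m (A * (diag_of x * diag_of x) * transpose_mat A)"

text \<open>
  \<open>mat_inverse\<close> returns \<open>None\<close> on a singular matrix. If no coordinate of \<open>x\<close> vanishes,
  \<open>cov_mat \<sigma> A x\<close> is singular only when \<open>A\<close> has rank less than \<open>m\<close>, which for
  Gaussian \<open>A\<close> is a null event that does not depend on \<open>x\<close>.
\<close>

definition neg_log_lik :: "real \<Rightarrow> nat \<Rightarrow> real mat \<Rightarrow> (nat \<Rightarrow> real vec) \<Rightarrow> real vec \<Rightarrow> real" where
  "neg_log_lik \<sigma> L A y x =
     ln (det (cov_mat \<sigma> A x))
     + (1 / real L) * (\<Sum>l<L. y l \<bullet> (the (mat_inverse (cov_mat \<sigma> A x)) *\<^sub>v y l))"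

end

theory Submission
  imports Defs
begin

text \<open>
  Write \<open>S(x) = A X\<^sup>2 A\<^sup>T\<close>; the noise level cancels. Up to fluctuations, the likelihood gap
  \<open>f(x) - f(xo)\<close> is \<open>ln det S(x) - ln det S(xo) + tr (S(x)\<^sup>-\<^sup>1 S(xo)) - m\<close>, a Kullback-Leibler
  divergence, which is at least a constant times the squared Frobenius norm of \<open>S(x) - S(xo)\<close>
  divided by the fourth power of the operator norm of \<open>A\<close>. The latter is \<open>O(n\<^sup>2)\<close>, and the squared
  Frobenius norm is at least of order \<open>m\<^sup>2\<close> times the squared distance \<open>D\<close> of the squared signals,
  as soon as \<open>D\<close> exceeds \<open>n sqrt (k ln n) / m\<close>. The fluctuations are quadratic forms of rank at
  most \<open>2 m\<close> in the speckle, hence of size \<open>sqrt (m k ln n / L)\<close> uniformly over a net of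
  \<open>exp (O(k ln n))\<close> parameters. Passing from the minimiser to the nearest net point costs
  \<open>O(n\<^sup>-\<^sup>2)\<close>, because \<open>S(x)\<close> changes by a factor \<open>1 + O(n\<^sup>-\<^sup>3)\<close> in the Loewner order. If
  the claimed rate is not small, the bound is trivial, since signals are bounded.

  All Gaussian tail bounds and the divergence bound come from one elimination argument: a Schur
  complement inherits two-sided bounds on the quadratic form.
\<close>

section \<open>Quadratic forms and Schur complements\<close>

text \<open>The two sources of randomness are kept apart. \<open>A\<close> enters only through
  events that are one-sided or null: operator norm bounded above, Frobenius distance bounded below,
  nonsingularity. No log determinant has to concentrate: for fixed \<open>A\<close> the divergence
  bound is deterministic, and the only centred quantity is quadratic in the speckle. Write \<rho>
  for sqrt (k ln n). The net has at most exp (6 \<rho>^2) points, so each tail is pushed to exp (- 7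
  \<rho>^2). This budget fixes both terms of the rate. The Frobenius tail has an exponent of order
  m^2 D / n, which suffices once D / n is of order \<rho> / m. Comparing m^2 D / n^2 with the
  fluctuation \<rho> sqrt (m / L) gives the other term. A rate below 1/2 forces \<rho> < m / 2 and
  \<rho> \<le> sqrt (L m), as the two tails require. Forms are functions restricted to a finite
  index set: removing one index by \<open>insert\<close> then matches finite-set induction, Schur
  complements and the splitting of one factor off \<open>PiM\<close>. Matrices appear only with
  determinants and inverses.\<close>

definition bform :: "'i set \<Rightarrow> ('i \<Rightarrow> 'i \<Rightarrow> real) \<Rightarrow> ('i \<Rightarrow> real) \<Rightarrow> ('i \<Rightarrow> real) \<Rightarrow> real" where
  "bform I M u v = (\<Sum>i\<in>I. \<Sum>j\<in>I. M i j * u i * v j)"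

abbreviation qform :: "'i set \<Rightarrow> ('i \<Rightarrow> 'i \<Rightarrow> real) \<Rightarrow> ('i \<Rightarrow> real) \<Rightarrow> real" where
  "qform I M v \<equiv> bform I M v v"

definition symm_on :: "'i set \<Rightarrow> ('i \<Rightarrow> 'i \<Rightarrow> real) \<Rightarrow> bool" where
  "symm_on I M \<longleftrightarrow> (\<forall>i\<in>I. \<forall>j\<in>I. M i j = M j i)"

definition kron :: "'i \<Rightarrow> 'i \<Rightarrow> real" where
  "kron i j = (if i = j then 1 else 0)"

lemma symm_onD: "symm_on I M \<Longrightarrow> i \<in> I \<Longrightarrow> j \<in> I \<Longrightarrow> M i j = M j i"
  unfolding symm_on_def by blast

lemma symm_onI: "(\<And>i j. i \<in> I \<Longrightarrow> j \<in> I \<Longrightarrow> M i j = M j i) \<Longrightarrow> symm_on I M"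
  unfolding symm_on_def by blast

lemma kron_commute: "kron i j = kron j i"
  by (auto simp: kron_def)

text \<open>The Schur complement of the entry \<open>M a a\<close>: for a positive pivot, what
  remains of the form after minimising over the coordinate \<open>a\<close>. It is used only at
  indices other than \<open>a\<close>.\<close>

definition schur :: "('i \<Rightarrow> 'i \<Rightarrow> real) \<Rightarrow> 'i \<Rightarrow> 'i \<Rightarrow> 'i \<Rightarrow> real" where
  "schur M a i j = M i j - M a i * M a j / M a a"

lemma bform_insert:
  assumes "finite J" "a \<notin> J" and sym: "\<And>i. i \<in> J \<Longrightarrow> M i a = M a i"
  shows "bform (insert a J) M u v = M a a * u a * v a + u a * (\<Sum>j\<in>J. M a j * v j)
           + v a * (\<Sum>j\<in>J. M a j * u j) + bform J M u v"
  using assms by (simp add: bform_def sum.distrib sum_distrib_left algebra_simps)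

lemma bform_rank_one:
  "bform J (\<lambda>i j. b i * c j) u v = (\<Sum>j\<in>J. b j * u j) * (\<Sum>j\<in>J. c j * v j)"
  by (simp add: bform_def sum_product algebra_simps)

lemma bform_diff: "bform J (\<lambda>i j. M i j - N i j) u v = bform J M u v - bform J N u v"
  by (simp add: bform_def sum_subtractf algebra_simps)

lemma bform_scale: "bform J (\<lambda>i j. c * M i j) u v = c * bform J M u v"
  by (simp add: bform_def sum_distrib_left algebra_simps)

lemma bform_cong:
  assumes "\<And>i j. i \<in> J \<Longrightarrow> j \<in> J \<Longrightarrow> M i j = N i j" "\<And>i. i \<in> J \<Longrightarrow> u i = u' i" "\<And>i. i \<in> J \<Longrightarrow> v i = v' i"
  shows "bform J M u v = bform J N u' v'"
  using assms by (simp add: bform_def)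

lemma bform_kron: "finite J \<Longrightarrow> bform J kron u v = (\<Sum>i\<in>J. u i * v i)"
  by (simp add: bform_def kron_def if_distrib[of "\<lambda>x. x * _"] cong: if_cong)

text \<open>Completing the square in the coordinate \<open>a\<close>. The version with two vectors
  is needed for whitening, where vectors must be orthogonal and not merely normalised.\<close>

lemma bform_schur:
  assumes "finite J" "a \<notin> J" "M a a \<noteq> 0" and sym: "symm_on (insert a J) M"
  shows "bform (insert a J) M u v = M a a * (u a + (\<Sum>j\<in>J. M a j * u j) / M a a)
           * (v a + (\<Sum>j\<in>J. M a j * v j) / M a a) + bform J (schur M a) u v"
proof -
  have *: "bform J (schur M a) u v
      = bform J M u v - (\<Sum>j\<in>J. M a j * u j) * (\<Sum>j\<in>J. M a j * v j) / M a a"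
  proof -
    have "bform J (schur M a) u v = bform J M u v - bform J (\<lambda>i j. (M a i / M a a) * M a j) u v"
      unfolding bform_diff[symmetric] by (rule bform_cong) (auto simp: schur_def)
    also have "bform J (\<lambda>i j. (M a i / M a a) * M a j) u v
        = (\<Sum>j\<in>J. M a j * u j) / M a a * (\<Sum>j\<in>J. M a j * v j)"
      by (subst bform_rank_one) (simp add: sum_divide_distrib)
    finally show ?thesis by simp
  qed
  have sq: "s * (p + A / s) * (q + B / s) = s * p * q + p * B + q * A + A * B / s"
    if "s \<noteq> 0" for s p q A B :: real
    using that by (simp add: field_simps)
  have ins: "bform (insert a J) M u v = M a a * u a * v a + u a * (\<Sum>j\<in>J. M a j * v j)
           + v a * (\<Sum>j\<in>J. M a j * u j) + bform J M u v"
    using sym unfolding symm_on_def by (intro bform_insert[OF assms(1,2), of M u v]) blast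
  show ?thesis
    unfolding ins * sq[OF assms(3)] by linarith
qed

lemma symm_on_schur: "symm_on (insert a J) M \<Longrightarrow> symm_on J (schur M a)"
  unfolding symm_on_def schur_def by (metis insertCI mult.commute)

text \<open>The Schur complement is the minimum of the form over the value at \<open>a\<close>. The
  lower bound evaluates the form at the minimiser, whose additional square only helps because
  \<open>l \<ge> 0\<close>; the upper bound evaluates it at the value 0.\<close>

lemma schur_bounds:
  assumes "finite J" "a \<notin> J" and sym: "symm_on (insert a J) M"
    and pos: "M a a > 0"
    and lo: "\<And>v. qform (insert a J) M v \<ge> l * (\<Sum>i\<in>insert a J. (v i)\<^sup>2)"
    and hi: "\<And>v. qform (insert a J) M v \<le> h * (\<Sum>i\<in>insert a J. (v i)\<^sup>2)"
    and l0: "l \<ge> 0"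
  shows "qform J (schur M a) v \<ge> l * (\<Sum>i\<in>J. (v i)\<^sup>2)"
    and "qform J (schur M a) v \<le> h * (\<Sum>i\<in>J. (v i)\<^sup>2)"
proof -
  let ?b = "\<Sum>j\<in>J. M a j * v j"
  have b: "(\<Sum>j\<in>J. M a j * (v(a := t)) j) = ?b" for t
    using assms(2) by (intro sum.cong) auto
  have sq: "(\<Sum>i\<in>J. ((v(a := t)) i)\<^sup>2) = (\<Sum>i\<in>J. (v i)\<^sup>2)" for t
    using assms(2) by (intro sum.cong) auto
  have q: "qform J (schur M a) (v(a := t)) = qform J (schur M a) v" for t
    using assms(2) by (intro bform_cong) auto
  have eq: "qform (insert a J) M (v(a := t)) = M a a * (t + ?b / M a a)\<^sup>2 + qform J (schur M a) v" for t
    using bform_schur[OF assms(1,2) _ sym, of "v(a := t)" "v(a := t)"] pos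
    unfolding b q by (simp add: power2_eq_square)
  have sq': "(\<Sum>i\<in>insert a J. ((v(a := t)) i)\<^sup>2) = t\<^sup>2 + (\<Sum>i\<in>J. (v i)\<^sup>2)" for t
    using assms(1,2) sq by simp
  have "l * ((- ?b / M a a)\<^sup>2 + (\<Sum>i\<in>J. (v i)\<^sup>2)) \<le> qform J (schur M a) v"
    using lo[of "v(a := - ?b / M a a)"] unfolding eq sq' by simp
  moreover have "l * (\<Sum>i\<in>J. (v i)\<^sup>2) \<le> l * ((- ?b / M a a)\<^sup>2 + (\<Sum>i\<in>J. (v i)\<^sup>2))"
    using l0 by (intro mult_left_mono) auto
  ultimately show "qform J (schur M a) v \<ge> l * (\<Sum>i\<in>J. (v i)\<^sup>2)" by linarith
  have "M a a * (0 + ?b / M a a)\<^sup>2 + qform J (schur M a) v \<le> h * (\<Sum>i\<in>J. (v i)\<^sup>2)"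
    using hi[of "v(a := 0)"] unfolding eq sq' by simp
  moreover have "M a a * (0 + ?b / M a a)\<^sup>2 \<ge> 0" using pos by simp
  ultimately show "qform J (schur M a) v \<le> h * (\<Sum>i\<in>J. (v i)\<^sup>2)" by linarith
qed

lemma qform_single: "finite I \<Longrightarrow> a \<in> I \<Longrightarrow> qform I M (kron a) = M a a"
  by (simp add: bform_def kron_def sum.remove[of I a] if_distrib[of "\<lambda>x. _ * x"] cong: if_cong)

lemma sum_kron_sq: "finite I \<Longrightarrow> a \<in> I \<Longrightarrow> (\<Sum>i\<in>I. (kron a i)\<^sup>2) = 1"
  by (simp add: kron_def if_distrib[of "\<lambda>x. x\<^sup>2"] cong: if_cong)

lemma frobenius_insert:
  assumes "finite J" "a \<notin> J" and sym: "symm_on (insert a J) M"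
  shows "(\<Sum>i\<in>insert a J. \<Sum>j\<in>insert a J. (M i j)\<^sup>2)
           = (M a a)\<^sup>2 + 2 * (\<Sum>j\<in>J. (M a j)\<^sup>2) + (\<Sum>i\<in>J. \<Sum>j\<in>J. (M i j)\<^sup>2)"
proof -
  have "\<And>i. i \<in> J \<Longrightarrow> M i a = M a i" using sym unfolding symm_on_def by blast
  then show ?thesis using assms(1,2) by (simp add: sum.distrib)
qed

text \<open>Elimination subtracts a rank-one matrix; the cross term of the expanded square is the
  form of \<open>M - kron\<close> at the row \<open>M a\<close>. Together with
  \<open>trace_schur\<close> this is the bookkeeping for the two inductions by elimination, on
  Gaussian integrals and on determinants.\<close>

lemma frobenius_schur:
  assumes "M a a \<noteq> 0"
  shows "(\<Sum>i\<in>J. \<Sum>j\<in>J. (schur M a i j - kron i j)\<^sup>2)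
     = (\<Sum>i\<in>J. \<Sum>j\<in>J. (M i j - kron i j)\<^sup>2)
       - 2 / M a a * qform J (\<lambda>i j. M i j - kron i j) (M a)
       + ((\<Sum>j\<in>J. (M a j)\<^sup>2) / M a a)\<^sup>2"
proof -
  have "(\<Sum>i\<in>J. \<Sum>j\<in>J. (schur M a i j - kron i j)\<^sup>2)
     = (\<Sum>i\<in>J. \<Sum>j\<in>J. (M i j - kron i j)\<^sup>2 - 2 / M a a * ((M i j - kron i j) * M a i * M a j)
         + ((M a i)\<^sup>2 / M a a) * ((M a j)\<^sup>2 / M a a))"
    by (intro sum.cong refl) (simp add: schur_def power2_eq_square divide_inverse algebra_simps)
  also have "\<dots> = (\<Sum>i\<in>J. \<Sum>j\<in>J. (M i j - kron i j)\<^sup>2)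
       - 2 / M a a * qform J (\<lambda>i j. M i j - kron i j) (M a)
       + (\<Sum>i\<in>J. (M a i)\<^sup>2 / M a a) * (\<Sum>j\<in>J. (M a j)\<^sup>2 / M a a)"
    by (simp only: bform_def sum_distrib_left[of "2 / M a a"] sum.distrib sum_subtractf sum_product)
  finally show ?thesis by (simp add: sum_divide_distrib power2_eq_square)
qed

lemma trace_schur:
  "(\<Sum>i\<in>J. schur M a i i) = (\<Sum>i\<in>J. M i i) - (\<Sum>j\<in>J. (M a j)\<^sup>2) / M a a"
  by (simp add: schur_def sum_subtractf sum_divide_distrib power2_eq_square)

section \<open>Gaussian quadratic forms\<close>

abbreviation gauss :: "real \<Rightarrow> real measure" where
  "gauss \<sigma> \<equiv> density lborel (\<lambda>t. ennreal (normal_density 0 \<sigma> t))"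

text \<open>Completing the square turns the integrand times the density into a constant times the
  normal density of mean \<open>- b / (1 + \<alpha>)\<close> and variance
  \<open>\<sigma>\<^sup>2 / (1 + \<alpha>)\<close>, which has mass 1. The constant carries the Schur
  correction \<open>b\<^sup>2 / (1 + \<alpha>)\<close> and half the logarithm of the pivot.\<close>

lemma nn_integral_gaussian_quadratic:
  fixes \<alpha> b c \<sigma> :: real
  assumes "\<sigma> > 0" "\<alpha> > -1"
  shows "(\<integral>\<^sup>+ y. ennreal (exp (-(\<alpha> * y\<^sup>2 + 2 * b * y + c) / (2 * \<sigma>\<^sup>2)))
           \<partial>gauss \<sigma>)
         = ennreal (exp (-(c - b\<^sup>2 / (1 + \<alpha>)) / (2 * \<sigma>\<^sup>2) - ln (1 + \<alpha>) / 2))"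
proof -
  define r where "r = 1 + \<alpha>"
  have r: "r > 0" using assms by (simp add: r_def)
  define s where "s = \<sigma> / sqrt r"
  have s: "s > 0" using assms r by (simp add: s_def)
  define \<mu> where "\<mu> = - b / r"
  define K where "K = exp (-(c - b\<^sup>2 / r) / (2 * \<sigma>\<^sup>2) - ln r / 2)"
  have pt: "normal_density 0 \<sigma> y * exp (-(\<alpha> * y\<^sup>2 + 2 * b * y + c) / (2 * \<sigma>\<^sup>2))
      = K * normal_density \<mu> s y" for y
  proof -
    have e1: "exp (- ln r / 2) = 1 / sqrt r"
      using r by (simp add: exp_minus ln_sqrt[symmetric] inverse_eq_divide)
    have e2: "s\<^sup>2 = \<sigma>\<^sup>2 / r" using r by (simp add: power_divide s_def)
    have sq: "1 / sqrt (2 * pi * \<sigma>\<^sup>2) = 1 / sqrt r * (1 / sqrt (2 * pi * s\<^sup>2))"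
      unfolding e2 using r by (simp add: real_sqrt_divide real_sqrt_mult)
    have "(y - \<mu>)\<^sup>2 = y\<^sup>2 + 2 * b * y / r + b\<^sup>2 / r\<^sup>2"
      by (simp add: \<mu>_def power2_eq_square algebra_simps)
    then have "r * (y - \<mu>)\<^sup>2 = r * y\<^sup>2 + 2 * b * y + b\<^sup>2 / r"
      using r by (simp add: power2_eq_square algebra_simps)
    then have num: "- (y - 0)\<^sup>2 + -(\<alpha> * y\<^sup>2 + 2 * b * y + c) = -(c - b\<^sup>2 / r) + - (r * (y - \<mu>)\<^sup>2)"
      by (simp add: r_def algebra_simps)
    have last: "- (r * (y - \<mu>)\<^sup>2) / (2 * \<sigma>\<^sup>2) = - (y - \<mu>)\<^sup>2 / (2 * s\<^sup>2)"
      using r by (simp add: e2 mult.commute)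
    have ex: "- (y - 0)\<^sup>2 / (2 * \<sigma>\<^sup>2) + -(\<alpha> * y\<^sup>2 + 2 * b * y + c) / (2 * \<sigma>\<^sup>2)
       = -(c - b\<^sup>2 / r) / (2 * \<sigma>\<^sup>2) + - (y - \<mu>)\<^sup>2 / (2 * s\<^sup>2)"
      unfolding last[symmetric] by (simp only: num add_divide_distrib[symmetric])
    have K: "K = exp (-(c - b\<^sup>2 / r) / (2 * \<sigma>\<^sup>2)) * (1 / sqrt r)"
      unfolding K_def e1[symmetric] exp_add[symmetric] by simp
    have "normal_density 0 \<sigma> y * exp (-(\<alpha> * y\<^sup>2 + 2 * b * y + c) / (2 * \<sigma>\<^sup>2))
      = 1 / sqrt (2 * pi * \<sigma>\<^sup>2)
        * exp (- (y - 0)\<^sup>2 / (2 * \<sigma>\<^sup>2) + -(\<alpha> * y\<^sup>2 + 2 * b * y + c) / (2 * \<sigma>\<^sup>2))"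
      unfolding normal_density_def exp_add by (simp only: mult.assoc)
    also have "\<dots> = K * normal_density \<mu> s y"
      unfolding ex exp_add normal_density_def sq K by (simp only: mult_ac)
    finally show ?thesis .
  qed
  have K0: "K \<ge> 0" by (simp add: K_def)
  have "(\<integral>\<^sup>+ y. ennreal (exp (-(\<alpha> * y\<^sup>2 + 2 * b * y + c) / (2 * \<sigma>\<^sup>2)))
           \<partial>gauss \<sigma>)
      = (\<integral>\<^sup>+ y. ennreal (normal_density 0 \<sigma> y)
            * ennreal (exp (-(\<alpha> * y\<^sup>2 + 2 * b * y + c) / (2 * \<sigma>\<^sup>2))) \<partial>lborel)"
    by (rule nn_integral_density) auto
  also have "\<dots> = (\<integral>\<^sup>+ y. ennreal K * ennreal (normal_density \<mu> s y) \<partial>lborel)"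
    using K0 by (intro nn_integral_cong) (simp only: ennreal_mult[symmetric] pt normal_density_nonneg exp_ge_zero)
  also have "\<dots> = ennreal K * (\<integral>\<^sup>+ y. ennreal (normal_density \<mu> s y) \<partial>lborel)"
    by (rule nn_integral_cmult) simp
  also have "(\<integral>\<^sup>+ y. ennreal (normal_density \<mu> s y) \<partial>lborel) = 1"
    using prob_space.emeasure_space_1[OF prob_space_normal_density[OF s, of \<mu>]]
    by (simp add: emeasure_density)
  finally show ?thesis by (simp add: K_def r_def)
qed

text \<open>The induction step of the Gaussian bound, in scalars: \<open>s\<close> is the pivot,
  \<open>B\<close> the squared length of the rest of its row, \<open>G\<close> the form of
  \<open>S - kron\<close> at that row. The left side collects the Gaussian factor and the changes of
  trace and Frobenius norm under elimination; the right side is what the removed row and column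
  contribute. A negative \<open>G\<close> costs at most \<open>B / s / 4\<close>.\<close>

lemma gaussian_mgf_step:
  fixes s B G :: real
  assumes "7/8 \<le> s" "s \<le> 9/8" "0 \<le> B" "B \<le> 1/12" "G \<ge> - B / 8"
  shows "- ln s / 2 + (B / s / 2 + (- 2 / s * G + (B / s)\<^sup>2)) \<le> - (s - 1) / 2 + ((s - 1)\<^sup>2 + 2 * B)"
proof -
  have "\<bar>ln (1 + (s - 1)) - (s - 1)\<bar> \<le> 2 * (s - 1)\<^sup>2"
    using assms by (intro abs_ln_one_plus_x_minus_x_bound) linarith
  then have "(s - 1) - ln s \<le> 2 * (s - 1)\<^sup>2" by (simp add: abs_le_iff)
  moreover define q where "q = (s - 1)\<^sup>2"
  ultimately have 1: "- ln s / 2 \<le> - (s - 1) / 2 + q" by (simp add: field_simps)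
  have s: "1 / s \<le> 8 / 7" using assms by (simp add: field_simps)
  have bs: "B / s \<le> 8 / 7 * B" using mult_left_mono[OF s, of B] assms by simp
  have bs0: "0 \<le> B / s" using assms by simp
  have 2: "- 2 / s * G \<le> B / s / 4"
  proof -
    have "- 2 * G / s \<le> (B / 4) / s" using assms by (intro divide_right_mono) auto
    then show ?thesis by simp
  qed
  have "B / s \<le> 8 / 7 * (1 / 12)" using bs assms by linarith
  then have "(B / s)\<^sup>2 \<le> B / s * (8 / 7 * (1 / 12))"
    unfolding power2_eq_square using bs0 by (intro mult_left_mono)
  moreover define X where "X = B / s"
  ultimately have "B / s / 2 + (- 2 / s * G + (B / s)\<^sup>2) \<le> 2 * B"
    using 2 bs bs0 unfolding X_def[symmetric] by linarith
  with 1 show ?thesis unfolding q_def by linarith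
qed

text \<open>
  The Gaussian integral over one coordinate replaces the form \<open>S\<close> by its Schur complement.
  The two-sided bound on \<open>S\<close> is inherited, and the potential on the right-hand side absorbs
  the factor \<open>(S a a)\<close> to the power \<open>-1/2\<close>. No diagonalisation of \<open>S\<close> is needed.
\<close>

lemma gaussian_qform_mgf_aux:
  fixes \<sigma> :: real
  assumes "finite I" "\<sigma> > 0" "symm_on I S"
    and "\<And>v. qform I S v \<ge> 7/8 * (\<Sum>i\<in>I. (v i)\<^sup>2)"
    and "\<And>v. qform I S v \<le> 9/8 * (\<Sum>i\<in>I. (v i)\<^sup>2)"
  shows "(\<integral>\<^sup>+ x. ennreal (exp (- qform I (\<lambda>i j. S i j - kron i j) x / (2 * \<sigma>\<^sup>2)))
           \<partial>PiM I (\<lambda>_. gauss \<sigma>))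
         \<le> ennreal (exp (- (\<Sum>i\<in>I. S i i - 1) / 2 + (\<Sum>i\<in>I. \<Sum>j\<in>I. (S i j - kron i j)\<^sup>2)))"
  using assms
proof (induction I arbitrary: S rule: finite_induct)
  case empty
  interpret P: prob_space "PiM {} (\<lambda>_::'a. gauss \<sigma>)"
    using prob_space_normal_density[OF \<open>\<sigma> > 0\<close>] by (intro prob_space_PiM)
  show ?case using P.emeasure_space_1 by (simp only: bform_def sum.empty) simp
next
  case (insert a J)
  let ?D = "gauss \<sigma>"
  interpret product_sigma_finite "\<lambda>_::'a. ?D"
    by (rule product_sigma_finite.intro) (rule prob_space_imp_sigma_finite, rule prob_space_normal_density[OF \<open>\<sigma> > 0\<close>])
  let ?I = "insert a J"
  let ?s = "S a a"
  have fin: "finite ?I" "a \<in> ?I" using insert.hyps by auto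
  have s: "7/8 \<le> ?s" "?s \<le> 9/8"
    using insert.prems(3)[of "kron a"] insert.prems(4)[of "kron a"]
    unfolding qform_single[OF fin] sum_kron_sq[OF fin] by auto
  define N where "N = (\<lambda>i j. S i j - kron i j)"
  define b where "b x = (\<Sum>j\<in>J. S a j * x j)" for x
  have symNI: "symm_on ?I N"
  proof (rule symm_onI)
    fix i j assume "i \<in> ?I" "j \<in> ?I"
    from symm_onD[OF insert.prems(2) this] show "N i j = N j i"
      by (simp only: N_def kron_commute[of i j])
  qed
  have symN: "\<And>i. i \<in> J \<Longrightarrow> N i a = N a i"
    by (rule symm_onD[OF symNI]) auto
  have Naj: "N a j = S a j" if "j \<in> J" for j using that insert.hyps by (auto simp: N_def kron_def)
  have Naa: "N a a = ?s - 1" by (simp add: N_def kron_def)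
  have q_upd: "qform ?I N (x(a := y)) = (?s - 1) * y\<^sup>2 + 2 * b x * y + qform J N x" for x y
  proof -
    have "qform J N (x(a := y)) = qform J N x" using insert.hyps by (intro bform_cong) auto
    moreover have "(\<Sum>j\<in>J. N a j * (x(a := y)) j) = b x"
      unfolding b_def using insert.hyps Naj by (intro sum.cong) auto
    ultimately show ?thesis
      using bform_insert[of J a N "x(a := y)" "x(a := y)", OF insert.hyps symN] Naa
      by (simp add: power2_eq_square algebra_simps)
  qed
  have q_schur: "qform J N x - (b x)\<^sup>2 / ?s = qform J (\<lambda>i j. schur S a i j - kron i j) x" for x
  proof -
    have "qform J (\<lambda>i j. schur S a i j - kron i j) x
       = qform J (\<lambda>i j. N i j - (S a i / S a a) * S a j) x"
      by (intro bform_cong) (auto simp: N_def schur_def)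
    also have "\<dots> = qform J N x - (\<Sum>j\<in>J. S a j / S a a * x j) * b x"
      unfolding bform_diff bform_rank_one b_def ..
    also have "(\<Sum>j\<in>J. S a j / S a a * x j) = b x / S a a"
      by (simp add: b_def sum_divide_distrib)
    finally show ?thesis by (simp add: power2_eq_square)
  qed
  have meas: "(\<lambda>x. ennreal (exp (- qform K P x / (2 * \<sigma>\<^sup>2)))) \<in> borel_measurable (PiM K (\<lambda>_. ?D))" for K P
    unfolding bform_def by measurable
  have bounds: "7/8 * (\<Sum>i\<in>J. (v i)\<^sup>2) \<le> qform J (schur S a) v"
    "qform J (schur S a) v \<le> 9/8 * (\<Sum>i\<in>J. (v i)\<^sup>2)" for v
    using schur_bounds[OF insert.hyps insert.prems(2) _ insert.prems(3,4)] s by auto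
  define B where "B = (\<Sum>j\<in>J. (S a j)\<^sup>2)"
  define G where "G = qform J N (S a)"
  have B0: "B \<ge> 0" by (simp add: B_def sum_nonneg)
  have N_bounds: "- (\<Sum>i\<in>?I. (v i)\<^sup>2) / 8 \<le> qform ?I N v" "qform ?I N v \<le> (\<Sum>i\<in>?I. (v i)\<^sup>2) / 8" for v
  proof -
    have "qform ?I N v = qform ?I S v - (\<Sum>i\<in>?I. (v i)\<^sup>2)"
      unfolding N_def bform_diff bform_kron[OF fin(1)] by (simp add: power2_eq_square)
    then show "- (\<Sum>i\<in>?I. (v i)\<^sup>2) / 8 \<le> qform ?I N v" "qform ?I N v \<le> (\<Sum>i\<in>?I. (v i)\<^sup>2) / 8"
      using insert.prems(3,4)[of v] by auto
  qed
  have sq_upd: "(\<Sum>i\<in>?I. (((S a)(a := t)) i)\<^sup>2) = t\<^sup>2 + B" for t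
  proof -
    have "(\<Sum>i\<in>J. (((S a)(a := t)) i)\<^sup>2) = B" unfolding B_def using insert.hyps by (intro sum.cong) auto
    then show ?thesis using insert.hyps by simp
  qed
  have bB: "b (S a) = B" by (simp add: b_def B_def power2_eq_square)
  have G: "G \<ge> - B / 8"
    using N_bounds(1)[of "(S a)(a := 0)"] unfolding sq_upd q_upd G_def by simp
  \<comment> \<open>The test vector is the row \<open>S a\<close> with its entry at \<open>a\<close>
    replaced by 1/2, so that the linear term contributes exactly \<open>B\<close>; the lower bounds
    on \<open>G\<close> and on the pivot then leave \<open>24 * B \<le> 2\<close>.\<close>
  have B: "B \<le> 1/12"
  proof -
    have "(?s - 1) * (1/2)\<^sup>2 + 2 * B * (1/2) + G \<le> ((1/2)\<^sup>2 + B) / 8"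
      using N_bounds(2)[of "(S a)(a := 1/2)"] unfolding sq_upd q_upd bB G_def[symmetric] .
    then have "8 * ?s + 28 * B + 32 * G \<le> 9" by (simp add: power2_eq_square field_simps)
    then show ?thesis using G s by (simp add: field_simps)
  qed
  have "(\<integral>\<^sup>+ x. ennreal (exp (- qform ?I N x / (2 * \<sigma>\<^sup>2))) \<partial>PiM ?I (\<lambda>_. ?D))
      = (\<integral>\<^sup>+ x. (\<integral>\<^sup>+ y. ennreal (exp (- qform ?I N (x(a := y)) / (2 * \<sigma>\<^sup>2))) \<partial>?D) \<partial>PiM J (\<lambda>_. ?D))"
    by (rule product_nn_integral_insert[OF insert.hyps meas])
  also have "\<dots> = (\<integral>\<^sup>+ x. ennreal (exp (- ln ?s / 2))
        * ennreal (exp (- qform J (\<lambda>i j. schur S a i j - kron i j) x / (2 * \<sigma>\<^sup>2))) \<partial>PiM J (\<lambda>_. ?D))"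
  proof (intro nn_integral_cong)
    fix x
    have "(\<integral>\<^sup>+ y. ennreal (exp (- qform ?I N (x(a := y)) / (2 * \<sigma>\<^sup>2))) \<partial>?D)
       = ennreal (exp (- (qform J N x - (b x)\<^sup>2 / (1 + (?s - 1))) / (2 * \<sigma>\<^sup>2) - ln (1 + (?s - 1)) / 2))"
      unfolding q_upd by (rule nn_integral_gaussian_quadratic) (use s \<open>\<sigma> > 0\<close> in auto)
    also have "\<dots> = ennreal (exp (- ln ?s / 2))
        * ennreal (exp (- qform J (\<lambda>i j. schur S a i j - kron i j) x / (2 * \<sigma>\<^sup>2)))"
      unfolding q_schur[symmetric] by (simp add: ennreal_mult[symmetric] exp_add[symmetric])
    finally show "(\<integral>\<^sup>+ y. ennreal (exp (- qform ?I N (x(a := y)) / (2 * \<sigma>\<^sup>2))) \<partial>?D) = \<dots>" .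
  qed
  also have "\<dots> = ennreal (exp (- ln ?s / 2))
        * (\<integral>\<^sup>+ x. ennreal (exp (- qform J (\<lambda>i j. schur S a i j - kron i j) x / (2 * \<sigma>\<^sup>2))) \<partial>PiM J (\<lambda>_. ?D))"
    by (rule nn_integral_cmult[OF meas])
  also have "\<dots> \<le> ennreal (exp (- ln ?s / 2)) * ennreal (exp (- (\<Sum>i\<in>J. schur S a i i - 1) / 2
         + (\<Sum>i\<in>J. \<Sum>j\<in>J. (schur S a i j - kron i j)\<^sup>2)))"
    using insert.IH[OF \<open>\<sigma> > 0\<close> symm_on_schur[OF insert.prems(2)] bounds] by (intro mult_left_mono) auto
  also have "\<dots> = ennreal (exp (- ln ?s / 2 + (- (\<Sum>i\<in>J. schur S a i i - 1) / 2
         + (\<Sum>i\<in>J. \<Sum>j\<in>J. (schur S a i j - kron i j)\<^sup>2))))"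
    by (simp only: exp_add[of "- ln ?s / 2"] ennreal_mult exp_ge_zero)
  also have "\<dots> \<le> ennreal (exp (- (\<Sum>i\<in>?I. S i i - 1) / 2 + (\<Sum>i\<in>?I. \<Sum>j\<in>?I. (S i j - kron i j)\<^sup>2)))"
  proof -
    have F: "(\<Sum>i\<in>J. \<Sum>j\<in>J. (schur S a i j - kron i j)\<^sup>2)
        = (\<Sum>i\<in>J. \<Sum>j\<in>J. (N i j)\<^sup>2) + (- 2 / ?s * G + (B / ?s)\<^sup>2)"
      using s by (subst frobenius_schur) (auto simp: G_def B_def N_def)
    have F': "(\<Sum>i\<in>?I. \<Sum>j\<in>?I. (S i j - kron i j)\<^sup>2)
        = (?s - 1)\<^sup>2 + 2 * B + (\<Sum>i\<in>J. \<Sum>j\<in>J. (N i j)\<^sup>2)"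
    proof -
      from frobenius_insert[OF insert.hyps symNI]
      show ?thesis by (simp add: N_def kron_def B_def) (use Naj in \<open>simp add: N_def kron_def\<close>)
    qed
    have T: "(\<Sum>i\<in>J. schur S a i i - 1) = (\<Sum>i\<in>J. S i i - 1) - B / ?s"
      using trace_schur[of S a J] by (simp add: sum_subtractf B_def)
    have T': "(\<Sum>i\<in>?I. S i i - 1) = (?s - 1) + (\<Sum>i\<in>J. S i i - 1)" using insert.hyps by simp
    show ?thesis
      unfolding F F' T T' using gaussian_mgf_step[OF s B0 B G]
      by (intro ennreal_leI) (simp add: diff_divide_distrib add_divide_distrib)
  qed
  finally show ?case unfolding N_def .
qed

text \<open>The preceding bound for a perturbation \<open>M\<close> of the identity. All Gaussian
  tails below come from it: a suitable \<open>M\<close>, then an exponential Markov inequality. The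
  trace is the mean and the squared Frobenius norm the variance term.\<close>

lemma gaussian_qform_mgf:
  fixes \<sigma> :: real
  assumes "finite I" "\<sigma> > 0" "symm_on I M"
    and "\<And>v. \<bar>qform I M v\<bar> \<le> (\<Sum>i\<in>I. (v i)\<^sup>2) / 8"
  shows "(\<integral>\<^sup>+ x. ennreal (exp (- qform I M x / (2 * \<sigma>\<^sup>2)))
           \<partial>PiM I (\<lambda>_. gauss \<sigma>))
         \<le> ennreal (exp (- (\<Sum>i\<in>I. M i i) / 2 + (\<Sum>i\<in>I. \<Sum>j\<in>I. (M i j)\<^sup>2)))"
proof -
  define S where "S = (\<lambda>i j. M i j + kron i j)"
  have "qform I S v = qform I M v + (\<Sum>i\<in>I. (v i)\<^sup>2)" for v
    using bform_kron[OF assms(1), of v v] unfolding bform_def S_def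
    by (simp add: sum.distrib algebra_simps power2_eq_square)
  then have "7/8 * (\<Sum>i\<in>I. (v i)\<^sup>2) \<le> qform I S v" "qform I S v \<le> 9/8 * (\<Sum>i\<in>I. (v i)\<^sup>2)" for v
    using assms(4)[of v] by (auto simp: abs_le_iff)
  moreover have "symm_on I S"
  proof (rule symm_onI)
    fix i j assume "i \<in> I" "j \<in> I"
    from symm_onD[OF assms(3) this] show "S i j = S j i"
      by (simp only: S_def kron_commute[of i j])
  qed
  ultimately show ?thesis
    using gaussian_qform_mgf_aux[OF assms(1,2), of S] unfolding S_def kron_def by simp
qed

section \<open>Determinants of positive definite forms\<close>

definition pos_def_on :: "'i set \<Rightarrow> ('i \<Rightarrow> 'i \<Rightarrow> real) \<Rightarrow> bool" where
  "pos_def_on I M \<longleftrightarrow> symm_on I M \<and> (\<forall>v. (\<exists>i\<in>I. v i \<noteq> 0) \<longrightarrow> qform I M v > 0)"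

lemma pos_def_on_diag: "finite I \<Longrightarrow> pos_def_on I M \<Longrightarrow> a \<in> I \<Longrightarrow> M a a > 0"
  using qform_single[of I a M] unfolding pos_def_on_def by (metis kron_def zero_neq_one)

lemma pos_def_on_schur:
  assumes "finite J" "a \<notin> J" "pos_def_on (insert a J) M"
  shows "pos_def_on J (schur M a)"
  unfolding pos_def_on_def
proof (intro conjI allI impI)
  have sym: "symm_on (insert a J) M" using assms by (simp add: pos_def_on_def)
  then show "symm_on J (schur M a)" by (rule symm_on_schur)
  have pos: "M a a > 0" using assms by (intro pos_def_on_diag) auto
  fix v assume v: "\<exists>i\<in>J. v i \<noteq> (0::real)"
  define w where "w = v(a := - (\<Sum>j\<in>J. M a j * v j) / M a a)"
  have wJ: "w j = v j" if "j \<in> J" for j using that assms(2) by (auto simp: w_def)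
  have "qform (insert a J) M w > 0"
    using assms(3) v wJ unfolding pos_def_on_def by (metis insertCI)
  moreover have "(\<Sum>j\<in>J. M a j * w j) = (\<Sum>j\<in>J. M a j * v j)"
    by (intro sum.cong) (auto simp: wJ)
  then have "qform (insert a J) M w = qform J (schur M a) w"
    using pos bform_schur[OF assms(1,2) _ sym, of w w] by (simp add: w_def)
  moreover have "qform J (schur M a) w = qform J (schur M a) v"
    by (intro bform_cong) (auto simp: wJ)
  ultimately show "qform J (schur M a) v > 0" by simp
qed

definition mat_of :: "nat \<Rightarrow> (nat \<Rightarrow> nat \<Rightarrow> real) \<Rightarrow> real mat" where
  "mat_of n S = Matrix.mat n n (\<lambda>(i, j). S i j)"

lemma mat_of_carrier [simp]: "mat_of n S \<in> carrier_mat n n"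
  by (simp add: mat_of_def)

lemma mat_of_cong: "(\<And>i j. i < n \<Longrightarrow> j < n \<Longrightarrow> S i j = S' i j) \<Longrightarrow> mat_of n S = mat_of n S'"
  by (auto simp: mat_of_def)

lemma mat_of_kron: "mat_of n kron = 1\<^sub>m n"
  by (auto simp: mat_of_def kron_def one_mat_def)

lemma mat_of_bform:
  "mat_of n (\<lambda>i j. bform {..<n} S (t i) (t j)) = mat_of n t * mat_of n S * transpose_mat (mat_of n t)"
proof (rule eq_matI)
  fix i j assume ij: "i < dim_row (mat_of n t * mat_of n S * transpose_mat (mat_of n t))"
    "j < dim_col (mat_of n t * mat_of n S * transpose_mat (mat_of n t))"
  then have ij: "i < n" "j < n" by (auto simp: mat_of_def)
  have "(mat_of n t * mat_of n S * transpose_mat (mat_of n t)) $$ (i, j)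
      = (\<Sum>b<n. (\<Sum>a<n. t i a * S a b) * t j b)"
    using ij by (auto simp: mat_of_def scalar_prod_def lessThan_atLeast0 intro!: sum.cong)
  also have "\<dots> = bform {..<n} S (t i) (t j)"
    unfolding bform_def sum_distrib_right by (subst sum.swap) (simp add: mult_ac)
  finally show "mat_of n (\<lambda>i j. bform {..<n} S (t i) (t j)) $$ (i, j)
     = (mat_of n t * mat_of n S * transpose_mat (mat_of n t)) $$ (i, j)"
    using ij by (simp add: mat_of_def)
qed (auto simp: mat_of_def)

text \<open>\<open>U\<close> is unipotent and records the elimination of the last index,
  \<open>V\<close> is block lower triangular. Their product is the original matrix because
  \<open>schur\<close> subtracts exactly the product of the last column and the last row over the
  pivot.\<close>

lemma det_mat_of_schur:
  assumes "symm_on {..<Suc n} S" "S n n \<noteq> 0"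
  shows "det (mat_of (Suc n) S) = S n n * det (mat_of n (schur S n))"
proof -
  define U where "U = four_block_mat (1\<^sub>m n) (Matrix.mat n 1 (\<lambda>(i, j). S n i / S n n)) (0\<^sub>m 1 n) (1\<^sub>m 1)"
  define V where "V = four_block_mat (mat_of n (schur S n)) (0\<^sub>m n 1)
      (Matrix.mat 1 n (\<lambda>(i, j). S n j)) (Matrix.mat 1 1 (\<lambda>_. S n n))"
  have "mat_of (Suc n) S = U * V"
  proof (rule eq_matI)
    fix i j assume "i < dim_row (U * V)" "j < dim_col (U * V)"
    then have ij: "i < Suc n" "j < Suc n" by (auto simp: U_def V_def mat_of_def)
    have V0: "V $$ (k, j) = (if k < n then (if j < n then schur S n k j else 0) else S n j)"
      if "k < Suc n" for k
      using that ij unfolding V_def by (auto simp: mat_of_def less_Suc_eq)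
    have U0: "U $$ (i, k) = (if k < n then kron i k else if i < n then S n i / S n n else 1)"
      if "k < Suc n" for k
      using that ij unfolding U_def by (auto simp: kron_def less_Suc_eq)
    have "(U * V) $$ (i, j) = (\<Sum>k<Suc n. U $$ (i, k) * V $$ (k, j))"
      using ij by (simp add: U_def V_def mat_of_def scalar_prod_def lessThan_atLeast0)
    also have "\<dots> = (\<Sum>k<n. U $$ (i, k) * V $$ (k, j)) + U $$ (i, n) * V $$ (n, j)" by simp
    also have "(\<Sum>k<n. U $$ (i, k) * V $$ (k, j))
       = (\<Sum>k<n. kron i k * (if j < n then schur S n k j else 0))"
      by (intro sum.cong) (auto simp: U0 V0)
    also have "\<dots> = (if i < n \<and> j < n then schur S n i j else 0)"
      by (simp add: kron_def if_distrib[of "\<lambda>x. x * _"] cong: if_cong)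
    also have "\<dots> + U $$ (i, n) * V $$ (n, j) = S i j"
    proof -
      have "S i n = S n i" by (rule symm_onD[OF assms(1)]) (use ij in auto)
      then show ?thesis using ij assms(2) by (auto simp: U0 V0 schur_def less_Suc_eq)
    qed
    finally show "mat_of (Suc n) S $$ (i, j) = (U * V) $$ (i, j)" using ij by (simp add: mat_of_def)
  qed (auto simp: U_def V_def mat_of_def)
  moreover have "det U = 1"
    unfolding U_def by (subst det_four_block_mat_lower_left_zero[where n = n and m = 1]) auto
  moreover have "det V = det (mat_of n (schur S n)) * S n n"
    unfolding V_def
    by (subst det_four_block_mat_upper_right_zero[where n = n and m = 1]) (auto simp: det_single)
  moreover have "det (U * V) = det U * det V"
    by (rule det_mult[where n = "Suc n"]) (auto simp: U_def V_def mat_of_def)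
  ultimately show ?thesis by simp
qed

text \<open>The derivative of the difference of the two sides factors as
  \<open>(s - 1) * (1 / s - 1 / (2 * K))\<close>, whose second factor is nonnegative on the range
  considered, so the difference is smallest at 1. The quadratic gain is what later becomes the
  Frobenius norm.\<close>

lemma ln_le_linear_minus_square:
  fixes s K :: real
  assumes "0 < s" "s \<le> K" "1 \<le> K"
  shows "ln s \<le> s - 1 - (s - 1)\<^sup>2 / (4 * K)"
proof -
  define h where "h = (\<lambda>s::real. s - 1 - ln s - (s - 1)\<^sup>2 / (4 * K))"
  define h' where "h' = (\<lambda>s::real. 1 - 1 / s - (s - 1) / (2 * K))"
  have deriv: "(h has_real_derivative h' x) (at x)" if "x > 0" for x
    unfolding h_def h'_def using that assms
    by (auto intro!: derivative_eq_intros simp: field_simps)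
  have h': "h' x = (x - 1) * (1 / x - 1 / (2 * K))" if "x > 0" for x
    unfolding h'_def using that assms by (simp add: field_simps)
  have f: "1 / x - 1 / (2 * K) \<ge> 0" if "0 < x" "x \<le> K" for x
    using that assms by (simp add: field_simps)
  have "h 1 \<le> h s"
  proof (cases "s \<le> 1")
    case True
    show ?thesis
    proof (rule DERIV_nonpos_imp_nonincreasing[OF True])
      fix x assume x: "s \<le> x" "x \<le> 1"
      then have "(x - 1) * (1 / x - 1 / (2 * K)) \<le> 0"
        using assms by (intro mult_nonpos_nonneg f) auto
      then show "\<exists>y. (h has_real_derivative y) (at x) \<and> y \<le> 0"
        using deriv[of x] h'[of x] x assms by (intro exI[of _ "h' x"]) auto
    qed
  next
    case False
    then have "1 \<le> s" by simp
    then show ?thesis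
    proof (rule DERIV_nonneg_imp_nondecreasing)
      fix x assume x: "1 \<le> x" "x \<le> s"
      then have "(x - 1) * (1 / x - 1 / (2 * K)) \<ge> 0"
        using assms by (intro mult_nonneg_nonneg f) auto
      then show "\<exists>y. (h has_real_derivative y) (at x) \<and> 0 \<le> y"
        using deriv[of x] h'[of x] x assms by (intro exI[of _ "h' x"]) auto
    qed
  qed
  then show ?thesis by (simp add: h_def)
qed

text \<open>In terms of eigenvalues this is the scalar inequality summed over the spectrum.
  Elimination replaces the spectrum by pivots: each pivot obeys the scalar inequality, and the trace
  lost in elimination pays for the change of the Frobenius norm.\<close>

lemma det_pos_def:
  assumes "pos_def_on {..<n} S"
    and "\<And>v. qform {..<n} S v \<le> K * (\<Sum>i<n. (v i)\<^sup>2)" and "1 \<le> K"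
  shows "det (mat_of n S) > 0 \<and>
    ln (det (mat_of n S)) \<le> (\<Sum>i<n. S i i - 1) - (\<Sum>i<n. \<Sum>j<n. (S i j - kron i j)\<^sup>2) / (4 * K)"
  using assms
proof (induction n arbitrary: S)
  case 0
  then show ?case by (simp add: mat_of_def)
next
  case (Suc n)
  note ins = lessThan_Suc[of n]
  have hyps: "finite {..<n}" "n \<notin> {..<n}" by auto
  have pd: "pos_def_on (insert n {..<n}) S" using Suc.prems(1) by (simp add: ins)
  then have sym: "symm_on (insert n {..<n}) S" by (simp add: pos_def_on_def)
  let ?s = "S n n"
  have s: "?s > 0" by (rule pos_def_on_diag[OF _ pd]) auto
  have hi: "qform (insert n {..<n}) S v \<le> K * (\<Sum>i\<in>insert n {..<n}. (v i)\<^sup>2)" for v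
    using Suc.prems(2)[of v] unfolding ins .
  have "?s \<le> K" using hi[of "kron n"] qform_single[of "insert n {..<n}" n S] sum_kron_sq[of "insert n {..<n}" n] by simp
  note ln_s = ln_le_linear_minus_square[OF s this Suc.prems(3)]
  have lo: "0 * (\<Sum>i\<in>insert n {..<n}. (v i)\<^sup>2) \<le> qform (insert n {..<n}) S v" for v
  proof (cases "\<exists>i\<in>insert n {..<n}. v i \<noteq> 0")
    case True
    then show ?thesis using pd unfolding pos_def_on_def by (auto intro: less_imp_le)
  next
    case False
    then show ?thesis by (simp add: bform_def)
  qed
  have IH: "det (mat_of n (schur S n)) > 0"
    "ln (det (mat_of n (schur S n))) \<le> (\<Sum>i<n. schur S n i i - 1)
       - (\<Sum>i<n. \<Sum>j<n. (schur S n i j - kron i j)\<^sup>2) / (4 * K)"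
    using Suc.IH[OF pos_def_on_schur[OF hyps pd] _ Suc.prems(3)] schur_bounds(2)[OF hyps sym s lo hi]
    by auto
  have det: "det (mat_of (Suc n) S) = ?s * det (mat_of n (schur S n))"
    using sym s by (intro det_mat_of_schur) (auto simp: ins)
  define B where "B = (\<Sum>j<n. (S n j)\<^sup>2)"
  define N where "N = (\<lambda>i j. S i j - kron i j)"
  define G where "G = qform {..<n} N (S n)"
  define F where "F = (\<Sum>i<n. \<Sum>j<n. (N i j)\<^sup>2)"
  define T where "T = (\<Sum>i<n. S i i - 1)"
  have B0: "B \<ge> 0" by (simp add: B_def sum_nonneg)
  have G: "G \<le> (K - 1) * B"
  proof -
    let ?w = "(S n)(n := 0)"
    have "qform (insert n {..<n}) S ?w \<le> K * (\<Sum>i\<in>insert n {..<n}. (?w i)\<^sup>2)" by (rule hi)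
    also have "(\<Sum>i\<in>insert n {..<n}. (?w i)\<^sup>2) = B" by (simp add: B_def)
    also have "qform (insert n {..<n}) S ?w = qform {..<n} S ?w"
      using bform_insert[OF hyps, of S ?w ?w] symm_onD[OF sym] by simp
    also have "\<dots> = qform {..<n} S (S n)" by (intro bform_cong) auto
    finally have "qform {..<n} S (S n) \<le> K * B" .
    then show ?thesis
      unfolding G_def N_def bform_diff by (simp add: bform_kron B_def power2_eq_square algebra_simps)
  qed
  have Fs: "(\<Sum>i<n. \<Sum>j<n. (schur S n i j - kron i j)\<^sup>2) = F - 2 / ?s * G + (B / ?s)\<^sup>2"
    using s by (subst frobenius_schur) (auto simp: F_def G_def B_def N_def)
  have symN: "symm_on (insert n {..<n}) N"
  proof (rule symm_onI)
    fix i j assume "i \<in> insert n {..<n}" "j \<in> insert n {..<n}"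
    from symm_onD[OF sym this] show "N i j = N j i"
      by (simp only: N_def kron_commute[of i j])
  qed
  have F': "(\<Sum>i<Suc n. \<Sum>j<Suc n. (S i j - kron i j)\<^sup>2) = (?s - 1)\<^sup>2 + 2 * B + F"
  proof -
    have "(\<Sum>j<n. (N n j)\<^sup>2) = B" unfolding B_def by (intro sum.cong) (auto simp: N_def kron_def)
    then show ?thesis
      using frobenius_insert[OF hyps symN] unfolding ins F_def by (simp add: N_def kron_def)
  qed
  have Ts: "(\<Sum>i<n. schur S n i i - 1) = T - B / ?s"
    using trace_schur[of S n "{..<n}"] by (simp add: T_def B_def sum_subtractf)
  have T': "(\<Sum>i<Suc n. S i i - 1) = T + (?s - 1)" by (simp add: T_def)
  \<comment> \<open>The trace drops by \<open>B / ?s\<close>. This covers the Frobenius contribution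
    of the removed row and column, as well as the cross term, because both the pivot and the form
    are at most \<open>K\<close>.\<close>
  have key: "2 * B + 2 / ?s * G \<le> 4 * K * (B / ?s)"
  proof -
    have "2 * B * ?s + 2 * G \<le> 2 * B * K + 2 * ((K - 1) * B)"
      using G \<open>?s \<le> K\<close> B0 by (intro add_mono mult_left_mono) auto
    also have "\<dots> \<le> 4 * K * B" using B0 by (simp add: algebra_simps)
    finally have "(2 * B * ?s + 2 * G) / ?s \<le> 4 * K * B / ?s" using s by (intro divide_right_mono) auto
    then show ?thesis using s by (simp add: add_divide_distrib)
  qed
  have "ln (det (mat_of (Suc n) S)) = ln ?s + ln (det (mat_of n (schur S n)))"
    unfolding det using s IH(1) by (simp add: ln_mult)
  also have "\<dots> \<le> (?s - 1 - (?s - 1)\<^sup>2 / (4 * K))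
      + ((T - B / ?s) - (F - 2 / ?s * G + (B / ?s)\<^sup>2) / (4 * K))"
    using ln_s IH(2) unfolding Fs Ts by (rule add_mono)
  also have "\<dots> \<le> T + (?s - 1) - ((?s - 1)\<^sup>2 + 2 * B + F) / (4 * K)"
  proof -
    have "(2 * B + 2 / ?s * G - (B / ?s)\<^sup>2) / (4 * K) \<le> B / ?s"
    proof -
      have "2 * B + 2 / ?s * G - (B / ?s)\<^sup>2 \<le> (B / ?s) * (4 * K)" using key
        by (smt (verit) mult.commute zero_le_power2)
      then show ?thesis using Suc.prems(3) by (simp add: pos_divide_le_eq)
    qed
    then show ?thesis by (simp add: add_divide_distrib diff_divide_distrib)
  qed
  finally show ?case unfolding F' T' using det s IH(1) by simp
qed

section \<open>Bilinearity and symmetry of forms\<close>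

lemma bform_sum_left: "bform J M (\<lambda>a. \<Sum>i\<in>K. z i * u i a) v = (\<Sum>i\<in>K. z i * bform J M (u i) v)"
proof -
  have "bform J M (\<lambda>a. \<Sum>i\<in>K. z i * u i a) v = (\<Sum>i\<in>J. \<Sum>j\<in>J. \<Sum>k\<in>K. z k * (M i j * u k i * v j))"
    unfolding bform_def by (simp add: sum_distrib_left sum_distrib_right mult_ac)
  also have "\<dots> = (\<Sum>k\<in>K. \<Sum>i\<in>J. \<Sum>j\<in>J. z k * (M i j * u k i * v j))"
    by (simp only: sum.swap[of _ K])
  finally show ?thesis by (simp add: bform_def sum_distrib_left)
qed

lemma bform_commute: "symm_on J M \<Longrightarrow> bform J M u v = bform J M v u"
proof -
  assume "symm_on J M"
  then have "bform J M u v = (\<Sum>i\<in>J. \<Sum>j\<in>J. M j i * u i * v j)"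
    unfolding bform_def by (intro sum.cong refl) (auto dest: symm_onD)
  also have "\<dots> = bform J M v u" unfolding bform_def by (subst sum.swap) (simp add: mult_ac)
  finally show ?thesis .
qed

lemma qform_combination:
  assumes "symm_on J M"
  shows "qform J M (\<lambda>a. u a - c * v a) = qform J M u - 2 * c * bform J M u v + c\<^sup>2 * qform J M v"
proof -
  have "qform J M (\<lambda>a. u a - c * v a) = qform J M u - c * bform J M u v - c * bform J M v u + c\<^sup>2 * qform J M v"
    unfolding bform_def sum_distrib_left sum_subtractf[symmetric] sum.distrib[symmetric]
    by (intro sum.cong refl) (simp add: power2_eq_square algebra_simps)
  then show ?thesis using bform_commute[OF assms, of v u] by simp
qed

section \<open>Whitening\<close>

text \<open>The vectors \<open>t i\<close> are the rows of a matrix T with T S T^T = 1, hence S^-1 =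
  T^T T. Any such T does the work of an inverse square root of \<open>S\<close>, and elimination
  provides one.\<close>

locale whitening =
  fixes n :: nat and S t :: "nat \<Rightarrow> nat \<Rightarrow> real"
  assumes symm: "symm_on {..<n} S"
    and white: "\<And>i j. i < n \<Longrightarrow> j < n \<Longrightarrow> bform {..<n} S (t i) (t j) = kron i j"

text \<open>An inverse Cholesky factor. A whitening vector of the Schur complement is extended by
  the value at \<open>n\<close> that annihilates the completed square; the new vector is the last
  unit vector divided by the root of the pivot.\<close>

lemma pos_def_on_whitening:
  assumes "pos_def_on {..<n} S"
  shows "\<exists>t. whitening n S t"
  using assms
proof (induction n arbitrary: S)
  case 0
  then show ?case by (auto simp: whitening_def pos_def_on_def)
next
  case (Suc n)
  note ins = lessThan_Suc[of n]
  have hyps: "finite {..<n}" "n \<notin> {..<n}" by auto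
  have pd: "pos_def_on (insert n {..<n}) S" using Suc.prems by (simp add: ins)
  then have sym: "symm_on (insert n {..<n}) S" by (simp add: pos_def_on_def)
  let ?s = "S n n"
  have s: "?s > 0" by (rule pos_def_on_diag[OF _ pd]) auto
  obtain t' where t': "whitening n (schur S n) t'"
    using Suc.IH[OF pos_def_on_schur[OF hyps pd]] by blast
  define b where "b v = (\<Sum>j<n. S n j * v j) / ?s" for v
  define t where "t i = (if i < n then (t' i)(n := - b (t' i)) else (\<lambda>k. kron n k / sqrt ?s))" for i
  have eq: "bform (insert n {..<n}) S u v = ?s * (u n + b u) * (v n + b v) + bform {..<n} (schur S n) u v" for u v
    using bform_schur[OF hyps _ sym] s unfolding b_def by simp
  have bt: "t i n + b (t i) = 0" if "i < n" for i
  proof -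
    have "b (t i) = b (t' i)" unfolding b_def using that by (intro arg_cong2[of _ _ _ _ "(/)"] sum.cong) (auto simp: t_def)
    then show ?thesis using that by (simp add: t_def)
  qed
  have btn: "t n n + b (t n) = 1 / sqrt ?s"
    by (simp add: t_def b_def kron_def)
  have sch: "bform {..<n} (schur S n) (t i) (t j) = kron i j" if "i < n" "j < n" for i j
    unfolding whitening.white[OF t' that, symmetric]
    using that by (intro bform_cong) (auto simp: t_def)
  have sch0: "bform {..<n} (schur S n) (t n) v = 0" "bform {..<n} (schur S n) v (t n) = 0" for v
    by (auto simp: bform_def t_def kron_def intro!: sum.neutral)
  have "bform {..<Suc n} S (t i) (t j) = kron i j" if "i < Suc n" "j < Suc n" for i j
  proof -
    consider "i < n" "j < n" | "i < n" "j = n" | "i = n" "j < n" | "i = n" "j = n"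
      using \<open>i < Suc n\<close> \<open>j < Suc n\<close> unfolding less_Suc_eq by blast
    then show ?thesis
    proof cases
      case 4
      then show ?thesis using s unfolding ins eq
        by (simp add: btn sch0 kron_def)
    qed (unfold ins eq, auto simp: bt sch sch0 kron_def)
  qed
  moreover have "symm_on {..<Suc n} S" using sym by (simp add: ins)
  ultimately show ?case by (intro exI[of _ t]) (simp add: whitening_def)
qed

context whitening
begin

text \<open>The vector \<open>S (t i)\<close>. By \<open>sum_t_dual\<close> these vectors give the
  coefficients that expand unit vectors in the \<open>t i\<close>.\<close>

definition dual :: "nat \<Rightarrow> nat \<Rightarrow> real" where
  "dual i a = (\<Sum>c<n. S a c * t i c)"

lemma mat_white: "mat_of n t * mat_of n S * transpose_mat (mat_of n t) = 1\<^sub>m n"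
  unfolding mat_of_bform[symmetric] mat_of_kron[symmetric] by (rule mat_of_cong) (rule white)

lemma mat_white': "mat_of n S * (transpose_mat (mat_of n t) * mat_of n t) = 1\<^sub>m n"
proof -
  have "mat_of n t * (mat_of n S * transpose_mat (mat_of n t)) = 1\<^sub>m n"
    using mat_white by (simp add: assoc_mult_mat[where n\<^sub>1 = n and n\<^sub>2 = n and n\<^sub>3 = n and n\<^sub>4 = n])
  then have "mat_of n S * transpose_mat (mat_of n t) * mat_of n t = 1\<^sub>m n"
    by (rule mat_mult_left_right_inverse[rotated 2]) (auto intro!: mult_carrier_mat[of _ n n])
  then show ?thesis
    by (simp add: assoc_mult_mat[where n\<^sub>1 = n and n\<^sub>2 = n and n\<^sub>3 = n and n\<^sub>4 = n])
qed

lemma sum_t_dual: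
  assumes "a < n" "b < n"
  shows "(\<Sum>i<n. t i a * dual i b) = kron a b"
proof -
  have "mat_of n S * transpose_mat (mat_of n t) * mat_of n t = 1\<^sub>m n"
    using mat_white' by (simp add: assoc_mult_mat[where n\<^sub>1 = n and n\<^sub>2 = n and n\<^sub>3 = n and n\<^sub>4 = n])
  moreover have "(mat_of n S * transpose_mat (mat_of n t) * mat_of n t) $$ (b, a) = (\<Sum>i<n. dual i b * t i a)"
    using assms by (auto simp: mat_of_def dual_def scalar_prod_def lessThan_atLeast0 intro!: sum.cong)
  ultimately show ?thesis using assms by (auto simp: kron_def mult.commute)
qed

lemma det_congruence:
  assumes "det (mat_of n S) \<noteq> 0"
  shows "det (mat_of n (\<lambda>i j. bform {..<n} S' (t i) (t j))) = det (mat_of n S') / det (mat_of n S)"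
proof -
  have d: "det (mat_of n t * mat_of n R * transpose_mat (mat_of n t)) = (det (mat_of n t))\<^sup>2 * det (mat_of n R)" for R
    using det_mult[of "mat_of n t * mat_of n R" n "transpose_mat (mat_of n t)"]
      det_mult[of "mat_of n t" n "mat_of n R"] det_transpose[of "mat_of n t" n]
      mult_carrier_mat[of "mat_of n t" n n "mat_of n R" n]
    by (simp add: power2_eq_square)
  have "(det (mat_of n t))\<^sup>2 * det (mat_of n S) = 1"
    unfolding d[symmetric] mat_white by simp
  then show ?thesis unfolding mat_of_bform d using assms by (simp add: field_simps)
qed

text \<open>Since \<open>mat_inverse\<close> returns an option, the two-sided inverse T^T T is first
  used to rule out \<open>None\<close>; uniqueness of inverses then identifies the value.\<close>

lemma the_mat_inverse: "the (mat_inverse (mat_of n S)) = transpose_mat (mat_of n t) * mat_of n t"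
proof -
  let ?B = "transpose_mat (mat_of n t) * mat_of n t"
  have B: "?B \<in> carrier_mat n n" by (rule mult_carrier_mat[of _ n n]) auto
  have "?B * mat_of n S = 1\<^sub>m n"
    by (rule mat_mult_left_right_inverse[OF mat_of_carrier B mat_white'])
  then have "mat_of n S \<in> Units (ring_mat TYPE(real) n ())"
    using mat_white' B by (auto simp: Units_def ring_mat_def)
  then have "mat_inverse (mat_of n S) \<noteq> None"
    by (rule contrapos_pn) (rule mat_inverse(1)[OF mat_of_carrier, where b = "()"])
  then obtain C where C: "mat_inverse (mat_of n S) = Some C" by blast
  from mat_inverse(2)[OF mat_of_carrier C] have C': "C * mat_of n S = 1\<^sub>m n" "C \<in> carrier_mat n n" by auto
  have "C = C * (mat_of n S * ?B)" by (simp only: mat_white' right_mult_one_mat[OF C'(2)])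
  also have "\<dots> = C * mat_of n S * ?B"
    using C' B by (intro assoc_mult_mat[symmetric]) auto
  also have "\<dots> = ?B" by (simp only: C'(1) left_mult_one_mat[OF B])
  finally show ?thesis using C by simp
qed

lemma inverse_qform:
  assumes "y \<in> carrier_vec n"
  shows "y \<bullet> (the (mat_inverse (mat_of n S)) *\<^sub>v y) = (\<Sum>i<n. (\<Sum>a<n. t i a * y $ a)\<^sup>2)"
proof -
  let ?M = "mat_of n t"
  have My: "?M *\<^sub>v y \<in> carrier_vec n" by (simp add: carrier_vecI mat_of_def)
  have "y \<bullet> (the (mat_inverse (mat_of n S)) *\<^sub>v y) = y \<bullet> (transpose_mat ?M *\<^sub>v (?M *\<^sub>v y))"
    unfolding the_mat_inverse using assms by (simp add: assoc_mult_mat_vec[where n\<^sub>1 = n and n\<^sub>2 = n and n\<^sub>3 = n])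
  also have "\<dots> = (transpose_mat ?M *\<^sub>v (?M *\<^sub>v y)) \<bullet> y"
    using assms My by (intro comm_scalar_prod[where n = n] mult_mat_vec_carrier[where n = n]) auto
  also have "\<dots> = (?M *\<^sub>v y) \<bullet> (?M *\<^sub>v y)"
    by (rule transpose_vec_mult_scalar[OF mat_of_carrier assms My])
  also have "\<dots> = (\<Sum>i<n. (\<Sum>a<n. t i a * y $ a)\<^sup>2)"
    using assms by (auto simp: scalar_prod_def mat_of_def lessThan_atLeast0 power2_eq_square intro!: sum.cong)
  finally show ?thesis .
qed

text \<open>The vector S^-1 y, written as T^T T y.\<close>

definition inv_apply :: "(nat \<Rightarrow> real) \<Rightarrow> nat \<Rightarrow> real" where
  "inv_apply y a = (\<Sum>i<n. (\<Sum>c<n. t i c * y c) * t i a)"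

lemma bform_dual: "bform {..<n} S (t i) v = (\<Sum>a<n. dual i a * v a)"
proof -
  have "bform {..<n} S (t i) v = bform {..<n} S v (t i)" by (rule bform_commute[OF symm])
  also have "\<dots> = (\<Sum>a<n. dual i a * v a)"
    by (simp add: bform_def dual_def sum_distrib_right sum_distrib_left mult_ac)
  finally show ?thesis .
qed

lemma bform_inv_apply: "bform {..<n} S (inv_apply y) v = (\<Sum>a<n. y a * v a)"
proof -
  have "bform {..<n} S (inv_apply y) v = (\<Sum>i<n. (\<Sum>c<n. t i c * y c) * (\<Sum>a<n. dual i a * v a))"
    unfolding inv_apply_def bform_sum_left bform_dual ..
  also have "\<dots> = (\<Sum>i<n. \<Sum>c<n. \<Sum>a<n. y c * v a * (t i c * dual i a))"
    by (simp add: sum_product mult_ac)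
  also have "\<dots> = (\<Sum>c<n. \<Sum>a<n. y c * v a * (\<Sum>i<n. t i c * dual i a))"
    unfolding sum_distrib_left by (subst sum.swap) (intro sum.cong refl sum.swap)
  also have "\<dots> = (\<Sum>c<n. \<Sum>a<n. y c * v a * kron c a)"
    by (intro sum.cong refl) (simp add: sum_t_dual)
  also have "\<dots> = (\<Sum>a<n. y a * v a)"
    by (simp add: kron_def if_distrib[of "\<lambda>x. _ * x"] cong: if_cong)
  finally show ?thesis .
qed

lemma inner_inv_apply: "(\<Sum>a<n. y a * inv_apply y a) = (\<Sum>i<n. (\<Sum>a<n. t i a * y a)\<^sup>2)"
proof -
  have "(\<Sum>a<n. y a * inv_apply y a) = (\<Sum>a<n. \<Sum>i<n. (\<Sum>c<n. t i c * y c) * (t i a * y a))"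
    by (simp add: inv_apply_def sum_distrib_left mult_ac)
  also have "\<dots> = (\<Sum>i<n. (\<Sum>c<n. t i c * y c) * (\<Sum>a<n. t i a * y a))"
    by (subst sum.swap) (simp add: sum_distrib_left)
  finally show ?thesis by (simp add: power2_eq_square)
qed

text \<open>The whitened matrix determines \<open>D\<close>: expanding both unit vectors in the
  \<open>t i\<close>, with coefficients from \<open>dual\<close>, undoes the congruence.\<close>

lemma bform_congruence:
  assumes "a < n" "b < n"
  shows "D a b = (\<Sum>i<n. \<Sum>j<n. dual i a * dual j b * bform {..<n} D (t i) (t j))"
proof -
  have e: "(\<Sum>i<n. dual i a * t i c) = kron a c" if "a < n" "c < n" for a c
    using sum_t_dual[OF that(2,1)] kron_commute[of a c] by (simp add: mult.commute)
  have "D a b = bform {..<n} D (kron a) (kron b)"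
    using assms by (simp add: bform_def kron_def if_distrib[of "\<lambda>x. x * _"] if_distrib[of "\<lambda>x. _ * x"] cong: if_cong)
  also have "\<dots> = bform {..<n} D (\<lambda>c. \<Sum>i<n. dual i a * t i c) (\<lambda>c. \<Sum>j<n. dual j b * t j c)"
    using assms by (intro bform_cong) (auto simp: e)
  also have "\<dots> = (\<Sum>i<n. dual i a * bform {..<n} D (t i) (\<lambda>c. \<Sum>j<n. dual j b * t j c))"
    by (rule bform_sum_left)
  also have "\<dots> = (\<Sum>i<n. \<Sum>j<n. dual i a * dual j b * bform {..<n} D (t i) (t j))"
  proof (intro sum.cong refl)
    fix i
    have "bform {..<n} D (t i) (\<lambda>c. \<Sum>j<n. dual j b * t j c) = (\<Sum>j<n. dual j b * bform {..<n} D (t i) (t j))"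
    proof -
      have sw: "bform {..<n} D u v = bform {..<n} (\<lambda>x y. D y x) v u" for u v
        unfolding bform_def by (subst sum.swap) (simp add: mult_ac)
      show ?thesis unfolding sw[of "t i"] by (rule bform_sum_left)
    qed
    then show "dual i a * bform {..<n} D (t i) (\<lambda>c. \<Sum>j<n. dual j b * t j c)
      = (\<Sum>j<n. dual i a * dual j b * bform {..<n} D (t i) (t j))"
      by (simp add: sum_distrib_left mult_ac)
  qed
  finally show ?thesis .
qed

text \<open>The combination of the \<open>dual i\<close> with weights \<open>z\<close> is
  \<open>S\<close> applied to the vector \<open>\<tau>\<close>, at which the form equals the squared
  length of \<open>z\<close>. Nonnegativity of the form at \<open>\<tau> - u / h\<close> then gives
  the bound, as it would from S^2 \<le> h S.\<close>

lemma dual_norm: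
  assumes "\<And>v. qform {..<n} S v \<ge> 0"
    and "\<And>v. qform {..<n} S v \<le> h * (\<Sum>a<n. (v a)\<^sup>2)" "h > 0"
  shows "(\<Sum>a<n. (\<Sum>i<n. dual i a * z i)\<^sup>2) \<le> h * (\<Sum>i<n. (z i)\<^sup>2)"
proof -
  define u where "u a = (\<Sum>i<n. dual i a * z i)" for a
  define \<tau> where "\<tau> a = (\<Sum>i<n. z i * t i a)" for a
  have \<tau>: "bform {..<n} S \<tau> v = (\<Sum>i<n. z i * (\<Sum>a<n. dual i a * v a))" for v
    unfolding \<tau>_def bform_sum_left bform_dual ..
  have \<tau>u: "bform {..<n} S \<tau> u = (\<Sum>a<n. (u a)\<^sup>2)"
  proof -
    have "bform {..<n} S \<tau> u = (\<Sum>a<n. u a * (\<Sum>i<n. dual i a * z i))"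
      unfolding \<tau> sum_distrib_left by (subst sum.swap) (simp add: mult_ac)
    then show ?thesis by (simp add: u_def[symmetric] power2_eq_square)
  qed
  have \<tau>\<tau>: "qform {..<n} S \<tau> = (\<Sum>i<n. (z i)\<^sup>2)"
  proof -
    have "qform {..<n} S \<tau> = (\<Sum>i<n. z i * bform {..<n} S (t i) \<tau>)"
      unfolding \<tau>_def by (rule bform_sum_left)
    also have "\<dots> = (\<Sum>i<n. z i * bform {..<n} S \<tau> (t i))"
      using bform_commute[OF symm] by simp
    also have "\<dots> = (\<Sum>i<n. z i * (\<Sum>j<n. z j * kron j i))"
    proof (intro sum.cong refl arg_cong2[of _ _ _ _ "(*)"])
      fix i assume i: "i \<in> {..<n}"
      have "bform {..<n} S \<tau> (t i) = (\<Sum>j<n. z j * bform {..<n} S (t j) (t i))"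
        unfolding \<tau>_def by (rule bform_sum_left)
      also have "\<dots> = (\<Sum>j<n. z j * kron j i)"
        using i by (intro sum.cong refl) (simp add: white)
      finally show "bform {..<n} S \<tau> (t i) = \<dots>" .
    qed
    also have "\<dots> = (\<Sum>i<n. (z i)\<^sup>2)"
      by (simp add: kron_def if_distrib[of "\<lambda>x. _ * x"] power2_eq_square cong: if_cong)
    finally show ?thesis .
  qed
  define Z where "Z = (\<Sum>i<n. (z i)\<^sup>2)"
  define U where "U = (\<Sum>a<n. (u a)\<^sup>2)"
  have "0 \<le> qform {..<n} S (\<lambda>a. \<tau> a - 1 / h * u a)" by (rule assms)
  also have "\<dots> = Z - 2 * (1 / h) * U + (1 / h)\<^sup>2 * qform {..<n} S u"
    unfolding qform_combination[OF symm] \<tau>u \<tau>\<tau> Z_def U_def ..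
  also have "\<dots> \<le> Z - 2 * (1 / h) * U + (1 / h)\<^sup>2 * (h * U)"
    using assms(2)[of u] by (intro add_left_mono mult_left_mono) (auto simp: U_def)
  also have "\<dots> = Z - U / h" using assms(3) by (simp add: power2_eq_square)
  finally show ?thesis using assms(3) unfolding Z_def U_def u_def by (simp add: field_simps)
qed

text \<open>\<open>D\<close> is recovered from its whitened matrix by multiplication with the matrix
  of dual vectors on both sides, and each side costs one factor \<open>h\<close> by
  \<open>dual_norm\<close>.\<close>

lemma frobenius_congruence:
  assumes "\<And>v. qform {..<n} S v \<ge> 0"
    and "\<And>v. qform {..<n} S v \<le> h * (\<Sum>a<n. (v a)\<^sup>2)" "h > 0"
  shows "(\<Sum>a<n. \<Sum>b<n. (D a b)\<^sup>2) \<le> h\<^sup>2 * (\<Sum>i<n. \<Sum>j<n. (bform {..<n} D (t i) (t j))\<^sup>2)"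
proof -
  let ?N = "\<lambda>i j. bform {..<n} D (t i) (t j)"
  have "(\<Sum>a<n. \<Sum>b<n. (D a b)\<^sup>2)
      = (\<Sum>b<n. \<Sum>a<n. (\<Sum>i<n. dual i a * (\<Sum>j<n. dual j b * ?N i j))\<^sup>2)"
    by (subst sum.swap, intro sum.cong refl, subst bform_congruence[of _ _ D])
       (auto simp: sum_distrib_left mult_ac)
  also have "\<dots> \<le> (\<Sum>b<n. h * (\<Sum>i<n. (\<Sum>j<n. dual j b * ?N i j)\<^sup>2))"
    by (intro sum_mono dual_norm assms)
  also have "\<dots> = h * (\<Sum>i<n. \<Sum>b<n. (\<Sum>j<n. dual j b * ?N i j)\<^sup>2)"
    by (subst sum.swap) (simp add: sum_distrib_left)
  also have "\<dots> \<le> h * (\<Sum>i<n. h * (\<Sum>j<n. (?N i j)\<^sup>2))"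
    using assms by (intro mult_left_mono sum_mono dual_norm) auto
  finally show ?thesis by (simp add: sum_distrib_left power2_eq_square mult.assoc)
qed

end

text \<open>
  The quadratic form of the inverse of \<open>S\<close> at \<open>y\<close> is the supremum over \<open>v\<close> of
  \<open>2 * (v \<bullet> y) - qform S v\<close>; the test vector is the maximiser for \<open>S'\<close>, scaled by \<open>1 / c\<close>.
\<close>

lemma inverse_qform_antimono:
  assumes "whitening n S t" "whitening n S' t'" "c > 0"
    and "\<And>v. qform {..<n} S v \<ge> 0" "\<And>v. qform {..<n} S v \<le> c * qform {..<n} S' v"
  shows "(\<Sum>i<n. (\<Sum>a<n. t' i a * y a)\<^sup>2) \<le> c * (\<Sum>i<n. (\<Sum>a<n. t i a * y a)\<^sup>2)"
proof -
  interpret W: whitening n S t by fact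
  interpret W': whitening n S' t' by fact
  define q where "q = (\<Sum>i<n. (\<Sum>a<n. t i a * y a)\<^sup>2)"
  define q' where "q' = (\<Sum>i<n. (\<Sum>a<n. t' i a * y a)\<^sup>2)"
  define v where "v = W'.inv_apply y"
  have 1: "qform {..<n} S' v = q'"
    unfolding v_def q'_def W'.bform_inv_apply W'.inner_inv_apply ..
  have 2: "bform {..<n} S (W.inv_apply y) v = q'"
    unfolding W.bform_inv_apply v_def q'_def W'.inner_inv_apply ..
  have 3: "qform {..<n} S (W.inv_apply y) = q"
    unfolding W.bform_inv_apply q_def W.inner_inv_apply ..
  have "0 \<le> qform {..<n} S (\<lambda>a. W.inv_apply y a - (1 / c) * v a)" by (rule assms)
  also have "\<dots> = q - 2 * (1 / c) * q' + (1 / c)\<^sup>2 * qform {..<n} S v"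
    unfolding qform_combination[OF W.symm] 2 3 ..
  also have "\<dots> \<le> q - 2 * (1 / c) * q' + (1 / c)\<^sup>2 * (c * q')"
    using assms(5)[of v] by (intro add_left_mono mult_left_mono) (auto simp: 1)
  also have "\<dots> = q - q' / c" using \<open>c > 0\<close> by (simp add: power2_eq_square)
  finally show ?thesis using \<open>c > 0\<close> unfolding q_def q'_def by (simp add: field_simps)
qed

section \<open>Gaussian matrices\<close>

text \<open>The rows of the array are independent copies, so the total form is block diagonal with
  equal blocks: trace and squared Frobenius norm are multiplied by the number of rows, while the
  bound relative to the identity is unchanged.\<close>

lemma block_qform_mgf:
  fixes \<sigma> :: real and I :: "'a set" and J :: "'b set"
  assumes "finite I" "finite J" "\<sigma> > 0" "symm_on J M"
    and "\<And>v. \<bar>qform J M v\<bar> \<le> (\<Sum>i\<in>J. (v i)\<^sup>2) / 8"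
  shows "(\<integral>\<^sup>+ x. ennreal (exp (- (\<Sum>l\<in>I. qform J M (\<lambda>i. x (l, i))) / (2 * \<sigma>\<^sup>2))) \<partial>PiM (I \<times> J) (\<lambda>_. gauss \<sigma>))
         \<le> ennreal (exp (real (card I) * (- (\<Sum>i\<in>J. M i i) / 2 + (\<Sum>i\<in>J. \<Sum>j\<in>J. (M i j)\<^sup>2))))"
proof -
  define Mb :: "'a \<times> 'b \<Rightarrow> 'a \<times> 'b \<Rightarrow> real" where "Mb = (\<lambda>p q. kron (fst p) (fst q) * M (snd p) (snd q))"
  have sum_IJ: "(\<Sum>p\<in>I \<times> J. f p) = (\<Sum>l\<in>I. \<Sum>i\<in>J. f (l, i))" for f :: "'a \<times> 'b \<Rightarrow> real"
    by (simp add: sum.cartesian_product)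
  have k: "(\<Sum>l'\<in>I. kron l l' * f l') = f l" if "l \<in> I" for f :: "'a \<Rightarrow> real" and l
    using that \<open>finite I\<close> by (simp add: kron_def if_distrib[of "\<lambda>x. x * _"] cong: if_cong)
  have q: "qform (I \<times> J) Mb v = (\<Sum>l\<in>I. qform J M (\<lambda>i. v (l, i)))" for v
  proof -
    have "qform (I \<times> J) Mb v = (\<Sum>l\<in>I. \<Sum>i\<in>J. \<Sum>l'\<in>I. kron l l' * (\<Sum>j\<in>J. M i j * v (l, i) * v (l', j)))"
      by (simp add: bform_def sum_IJ Mb_def sum_distrib_left mult_ac)
    also have "\<dots> = (\<Sum>l\<in>I. \<Sum>i\<in>J. \<Sum>j\<in>J. M i j * v (l, i) * v (l, j))"
      by (intro sum.cong refl) (simp add: k)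
    finally show ?thesis by (simp add: bform_def)
  qed
  have tr: "(\<Sum>p\<in>I \<times> J. Mb p p) = real (card I) * (\<Sum>i\<in>J. M i i)"
    by (simp add: sum_IJ Mb_def kron_def)
  have fr: "(\<Sum>p\<in>I \<times> J. \<Sum>q\<in>I \<times> J. (Mb p q)\<^sup>2) = real (card I) * (\<Sum>i\<in>J. \<Sum>j\<in>J. (M i j)\<^sup>2)"
  proof -
    have "(\<Sum>p\<in>I \<times> J. \<Sum>q\<in>I \<times> J. (Mb p q)\<^sup>2)
        = (\<Sum>l\<in>I. \<Sum>i\<in>J. \<Sum>l'\<in>I. kron l l' * (\<Sum>j\<in>J. (M i j)\<^sup>2))"
      unfolding sum_IJ sum_distrib_left by (intro sum.cong refl) (simp add: Mb_def kron_def)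
    also have "\<dots> = (\<Sum>l\<in>I. \<Sum>i\<in>J. \<Sum>j\<in>J. (M i j)\<^sup>2)"
      by (intro sum.cong refl) (simp add: k)
    finally show ?thesis by simp
  qed
  have sym: "symm_on (I \<times> J) Mb"
  proof (rule symm_onI)
    fix p q assume pq: "p \<in> I \<times> J" "q \<in> I \<times> J"
    then have "M (snd p) (snd q) = M (snd q) (snd p)" by (intro symm_onD[OF assms(4)]) auto
    then show "Mb p q = Mb q p" by (simp only: Mb_def kron_commute[of "fst p"])
  qed
  have "\<bar>qform (I \<times> J) Mb v\<bar> \<le> (\<Sum>p\<in>I \<times> J. (v p)\<^sup>2) / 8" for v
  proof -
    have "\<bar>qform (I \<times> J) Mb v\<bar> \<le> (\<Sum>l\<in>I. \<bar>qform J M (\<lambda>i. v (l, i))\<bar>)" unfolding q by (rule sum_abs)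
    also have "\<dots> \<le> (\<Sum>l\<in>I. (\<Sum>i\<in>J. (v (l, i))\<^sup>2) / 8)" by (intro sum_mono assms)
    finally show ?thesis by (simp add: sum_IJ sum_divide_distrib)
  qed
  from gaussian_qform_mgf[OF _ assms(3) sym this] show ?thesis
    using assms(1,2) unfolding q tr fr by (simp add: algebra_simps)
qed

lemma emeasure_exp_Markov:
  fixes f :: "'a \<Rightarrow> real"
  assumes [measurable]: "f \<in> borel_measurable M"
    and "(\<integral>\<^sup>+ x. ennreal (exp (f x)) \<partial>M) \<le> ennreal (exp c)"
  shows "emeasure M {x \<in> space M. \<tau> \<le> f x} \<le> ennreal (exp (c - \<tau>))"
proof -
  have "emeasure M {x \<in> space M. \<tau> \<le> f x} = (\<integral>\<^sup>+ x. indicator {x \<in> space M. \<tau> \<le> f x} x \<partial>M)"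
    by simp
  also have "\<dots> \<le> (\<integral>\<^sup>+ x. ennreal (exp (- \<tau>)) * ennreal (exp (f x)) \<partial>M)"
    by (intro nn_integral_mono)
       (auto simp: indicator_def ennreal_mult[symmetric] exp_add[symmetric] simp flip: ennreal_1 intro!: ennreal_leI)
  also have "\<dots> = ennreal (exp (- \<tau>)) * (\<integral>\<^sup>+ x. ennreal (exp (f x)) \<partial>M)"
    by (rule nn_integral_cmult) simp
  also have "\<dots> \<le> ennreal (exp (- \<tau>)) * ennreal (exp c)"
    by (intro mult_left_mono assms) simp
  also have "\<dots> = ennreal (exp (c - \<tau>))"
    by (simp add: ennreal_mult[symmetric] exp_add[symmetric])
  finally show ?thesis .
qed

text \<open>From M^2 \<le> \<epsilon> M, read off at each diagonal entry: the form is evaluated at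
  the unit vector minus \<open>1 / \<epsilon>\<close> times the row. This makes the variance term of
  a positive semidefinite form proportional to its mean.\<close>

lemma frobenius_le_trace:
  assumes "finite J" "symm_on J M" "\<epsilon> > 0"
    and "\<And>v. 0 \<le> qform J M v" "\<And>v. qform J M v \<le> \<epsilon> * (\<Sum>i\<in>J. (v i)\<^sup>2)"
  shows "(\<Sum>i\<in>J. \<Sum>j\<in>J. (M i j)\<^sup>2) \<le> \<epsilon> * (\<Sum>i\<in>J. M i i)"
proof -
  have "(\<Sum>j\<in>J. (M i j)\<^sup>2) \<le> \<epsilon> * M i i" if i: "i \<in> J" for i
  proof -
    define B where "B = (\<Sum>j\<in>J. (M i j)\<^sup>2)"
    have b: "bform J M (kron i) (M i) = B"
    proof -
      have "bform J M (kron i) (M i) = (\<Sum>a\<in>J. kron i a * (\<Sum>j\<in>J. M a j * M i j))"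
        by (simp add: bform_def sum_distrib_left mult_ac)
      also have "\<dots> = (\<Sum>j\<in>J. M i j * M i j)"
        using assms(1) i by (simp add: kron_def if_distrib[of "\<lambda>x. x * _"] cong: if_cong)
      finally show ?thesis by (simp add: B_def power2_eq_square)
    qed
    have "0 \<le> qform J M (\<lambda>a. kron i a - 1 / \<epsilon> * M i a)" by (rule assms)
    also have "\<dots> = M i i - 2 * (1 / \<epsilon>) * B + (1 / \<epsilon>)\<^sup>2 * qform J M (M i)"
      unfolding qform_combination[OF assms(2)] b qform_single[OF assms(1) i] ..
    also have "\<dots> \<le> M i i - 2 * (1 / \<epsilon>) * B + (1 / \<epsilon>)\<^sup>2 * (\<epsilon> * B)"
      using assms(5)[of "M i"] by (intro add_left_mono mult_left_mono) (auto simp: B_def)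
    also have "\<dots> = M i i - B / \<epsilon>" using assms(3) by (simp add: power2_eq_square)
    finally show ?thesis using assms(3) unfolding B_def by (simp add: field_simps)
  qed
  then show ?thesis unfolding sum_distrib_left by (intro sum_mono)
qed

lemma gaussian_norm_tail:
  fixes \<sigma> :: real and L n :: nat
  assumes "\<sigma> > 0"
  defines "P \<equiv> PiM ({..<L} \<times> {..<n}) (\<lambda>_. gauss \<sigma>)"
  shows "emeasure P {w \<in> space P. 4 * real L * real n * \<sigma>\<^sup>2 \<le> (\<Sum>l<L. \<Sum>i<n. (w (l, i))\<^sup>2)}
     \<le> ennreal (exp (- (real L * real n / 8)))"
proof -
  let ?M = "\<lambda>i j. (- 1 / 8) * kron i j :: real"
  have q: "qform {..<n} ?M v = - 1 / 8 * (\<Sum>i<n. (v i)\<^sup>2)" for v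
    unfolding bform_scale by (simp add: bform_kron power2_eq_square)
  have nn: "(\<Sum>i<n. (v i)\<^sup>2) \<ge> (0::real)" for v by (simp add: sum_nonneg)
  have fr: "(\<Sum>i<n. \<Sum>j<n. (?M i j)\<^sup>2) = real n / 64"
    by (simp add: kron_def power2_eq_square if_distrib[of "\<lambda>x. _ * x"] cong: if_cong)
  have meas: "(\<lambda>w. - (\<Sum>l<L. qform {..<n} ?M (\<lambda>i. w (l, i))) / (2 * \<sigma>\<^sup>2)) \<in> borel_measurable P"
    unfolding P_def bform_def by measurable
  have "(\<integral>\<^sup>+ w. ennreal (exp (- (\<Sum>l<L. qform {..<n} ?M (\<lambda>i. w (l, i))) / (2 * \<sigma>\<^sup>2))) \<partial>P)
     \<le> ennreal (exp (real (card {..<L}) * (- (\<Sum>i<n. ?M i i) / 2 + (\<Sum>i<n. \<Sum>j<n. (?M i j)\<^sup>2))))"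
    unfolding P_def
  proof (rule block_qform_mgf[OF _ _ assms(1)])
    show "symm_on {..<n} ?M" by (rule symm_onI) (simp only: kron_commute)
    show "\<bar>qform {..<n} ?M v\<bar> \<le> (\<Sum>i<n. (v i)\<^sup>2) / 8" for v
      unfolding q using nn[of v] by simp
  qed auto
  from emeasure_exp_Markov[OF meas this, of "real L * real n / 4"]
  have "emeasure P {w \<in> space P. real L * real n / 4 \<le> - (\<Sum>l<L. qform {..<n} ?M (\<lambda>i. w (l, i))) / (2 * \<sigma>\<^sup>2)}
     \<le> ennreal (exp (real L * (real n / 16 + real n / 64) - real L * real n / 4))"
    unfolding fr by (simp add: kron_def)
  also have "\<dots> \<le> ennreal (exp (- (real L * real n / 8)))"
    by (intro ennreal_leI) (simp add: field_simps)
  also have "{w \<in> space P. real L * real n / 4 \<le> - (\<Sum>l<L. qform {..<n} ?M (\<lambda>i. w (l, i))) / (2 * \<sigma>\<^sup>2)}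
     = {w \<in> space P. 4 * real L * real n * \<sigma>\<^sup>2 \<le> (\<Sum>l<L. \<Sum>i<n. (w (l, i))\<^sup>2)}"
  proof -
    have e: "- (\<Sum>l<L. - 1 / 8 * f l) / (2 * \<sigma>\<^sup>2) = (\<Sum>l<L. f l) / (16 * \<sigma>\<^sup>2)" for f
      unfolding sum_distrib_left[symmetric] by simp
    have "real L * real n / 4 \<le> x / (16 * \<sigma>\<^sup>2) \<longleftrightarrow> 4 * real L * real n * \<sigma>\<^sup>2 \<le> x" for x
      using assms(1) by (simp add: field_simps)
    then show ?thesis unfolding q e by simp
  qed
  finally show ?thesis .
qed

section \<open>The operator norm of a Gaussian matrix\<close>

lemma int_abs_le_square: "\<bar>z\<bar> \<le> z\<^sup>2" for z :: int
proof (cases "z = 0")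
  case False
  then have "\<bar>z\<bar> * 1 \<le> \<bar>z\<bar> * \<bar>z\<bar>" by (intro mult_left_mono) auto
  then show ?thesis by (simp only: mult_1_right abs_mult_self_eq power2_eq_square)
qed simp

lemma sum_exp_neg_square_le:
  "(\<Sum>z\<in>{- int K..int K}. exp (- (real_of_int z)\<^sup>2)) \<le> 3"
proof -
  have e: "exp (- (real_of_int z)\<^sup>2) \<le> (1/2) ^ nat \<bar>z\<bar>" for z
  proof -
    have "\<bar>real_of_int z\<bar> \<le> (real_of_int z)\<^sup>2"
    proof -
      have "\<bar>z\<bar> \<le> z\<^sup>2" by (rule int_abs_le_square)
      then have "real_of_int \<bar>z\<bar> \<le> real_of_int (z\<^sup>2)" by (simp only: of_int_le_iff)
      then show ?thesis by simp
    qed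
    then have "exp (- (real_of_int z)\<^sup>2) \<le> exp (- real (nat \<bar>z\<bar>))" by simp
    also have "\<dots> = (exp (- 1)) ^ nat \<bar>z\<bar>" by (simp add: exp_of_nat_mult[symmetric])
    also have "\<dots> \<le> (1/2) ^ nat \<bar>z\<bar>"
    proof (rule power_mono)
      have "exp (1::real) \<ge> 2" using exp_ge_add_one_self[of 1] by simp
      then show "exp (- 1) \<le> (1/2::real)" by (simp add: exp_minus field_simps)
    qed simp
    finally show ?thesis .
  qed
  have "(\<Sum>z\<in>{- int K..int K}. (1/2::real) ^ nat \<bar>z\<bar>) = 3 - 2 * (1/2) ^ K"
  proof (induction K)
    case (Suc K)
    have "{- int (Suc K)..int (Suc K)} = insert (- int (Suc K)) (insert (int (Suc K)) {- int K..int K})"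
      by auto
    then show ?case using Suc by (simp add: nat_add_distrib)
  qed simp
  moreover have "(\<Sum>z\<in>{- int K..int K}. exp (- (real_of_int z)\<^sup>2)) \<le> (\<Sum>z\<in>{- int K..int K}. (1/2) ^ nat \<bar>z\<bar>)"
    by (intro sum_mono e)
  moreover have "(1/2::real) ^ K \<ge> 0" by simp
  ultimately show ?thesis by linarith
qed

text \<open>
  Rounding the coordinates of \<open>sqrt n * v\<close>, for a unit vector \<open>v\<close>, gives a point of this net
  at distance at most \<open>sqrt n / 2\<close>.
\<close>

definition int_net :: "nat \<Rightarrow> (nat \<Rightarrow> int) set" where
  "int_net n = {p \<in> PiE {..<n} (\<lambda>_. {- int (4 * n)..int (4 * n)}). (\<Sum>a<n. (real_of_int (p a))\<^sup>2) \<le> 4 * real n}"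

lemma finite_int_net: "finite (int_net n)"
proof (rule finite_subset)
  show "int_net n \<subseteq> PiE {..<n} (\<lambda>_. {- int (4 * n)..int (4 * n)})" by (auto simp: int_net_def)
  show "finite (PiE {..<n} (\<lambda>_. {- int (4 * n)..int (4 * n)}))" by (intro finite_PiE) auto
qed

text \<open>Counting with a Gaussian weight: on the net, exp (4 n) times the product of the exp (-
  p_a^2) is at least 1, and over the whole box the weights factor into \<open>n\<close> sums, each
  at most 3 and hence at most exp 2.\<close>

lemma card_int_net: "real (card (int_net n)) \<le> exp (6 * real n)"
proof -
  have "real (card (int_net n)) = (\<Sum>p\<in>int_net n. 1)" by simp
  also have "\<dots> \<le> (\<Sum>p\<in>int_net n. exp (4 * real n) * (\<Prod>a<n. exp (- (real_of_int (p a))\<^sup>2)))"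
  proof (rule sum_mono)
    fix p assume "p \<in> int_net n"
    then have "0 \<le> 4 * real n + (\<Sum>a<n. - (real_of_int (p a))\<^sup>2)" by (simp add: int_net_def sum_negf)
    then show "1 \<le> exp (4 * real n) * (\<Prod>a<n. exp (- (real_of_int (p a))\<^sup>2))"
      by (simp add: exp_sum[symmetric] exp_add[symmetric])
  qed
  also have "\<dots> \<le> (\<Sum>p\<in>PiE {..<n} (\<lambda>_. {- int (4 * n)..int (4 * n)}).
      exp (4 * real n) * (\<Prod>a<n. exp (- (real_of_int (p a))\<^sup>2)))"
  proof (rule sum_mono2)
    show "finite (PiE {..<n} (\<lambda>_. {- int (4 * n)..int (4 * n)}))" by (intro finite_PiE) auto
    show "int_net n \<subseteq> PiE {..<n} (\<lambda>_. {- int (4 * n)..int (4 * n)})" by (auto simp: int_net_def)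
    show "0 \<le> exp (4 * real n) * (\<Prod>a<n. exp (- (real_of_int (p a))\<^sup>2))" for p
      by (intro mult_nonneg_nonneg prod_nonneg ballI) simp_all
  qed
  also have "\<dots> = exp (4 * real n) * (\<Prod>a<n. \<Sum>z\<in>{- int (4 * n)..int (4 * n)}. exp (- (real_of_int z)\<^sup>2))"
    unfolding sum_distrib_left[symmetric] by (simp only: prod_sum_PiE finite_lessThan finite_atLeastAtMost_int)
  also have "\<dots> \<le> exp (4 * real n) * (\<Prod>a<n. exp 2)"
  proof (intro mult_left_mono prod_mono conjI)
    have "(3::real) \<le> exp 2" using exp_ge_add_one_self[of 2] by simp
    then show "(\<Sum>z\<in>{- int (4 * n)..int (4 * n)}. exp (- (real_of_int z)\<^sup>2)) \<le> exp 2"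
      using sum_exp_neg_square_le[of "4 * n"] by linarith
  qed (auto intro: sum_nonneg)
  also have "\<dots> = exp (6 * real n)" by (simp add: exp_of_nat_mult[symmetric] exp_add[symmetric])
  finally show ?thesis .
qed

text \<open>Rounding at most doubles an absolute value, because a nonzero rounded value needs one of
  at least 1/2. Hence the sum of squares grows at most fourfold.\<close>

lemma round_vector_in_int_net:
  assumes "(\<Sum>a<n. (u a)\<^sup>2) \<le> real n"
  shows "(\<lambda>a\<in>{..<n}. round (u a)) \<in> int_net n"
proof -
  have r: "(real_of_int (round x))\<^sup>2 \<le> 4 * x\<^sup>2" for x :: real
  proof (cases "round x = 0")
    case False
    have "\<bar>real_of_int (round x) - x\<bar> \<le> 1/2" by (rule of_int_round_abs_le)
    moreover have "1 \<le> \<bar>real_of_int (round x)\<bar>" using False by linarith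
    ultimately have "\<bar>real_of_int (round x)\<bar> \<le> \<bar>2 * x\<bar>" by linarith
    then have "(real_of_int (round x))\<^sup>2 \<le> (2 * x)\<^sup>2" by (rule abs_le_square_iff[THEN iffD1])
    then show ?thesis by (simp add: power_mult_distrib)
  qed simp
  have s: "(\<Sum>a<n. (real_of_int (round (u a)))\<^sup>2) \<le> 4 * real n"
  proof -
    have "(\<Sum>a<n. (real_of_int (round (u a)))\<^sup>2) \<le> (\<Sum>a<n. 4 * (u a)\<^sup>2)" by (intro sum_mono r)
    then show ?thesis using assms by (simp add: sum_distrib_left[symmetric])
  qed
  have "round (u a) \<in> {- int (4 * n)..int (4 * n)}" if "a < n" for a
  proof -
    have "(real_of_int (round (u a)))\<^sup>2 \<le> 4 * real n"
      using s that member_le_sum[of a "{..<n}" "\<lambda>a. (real_of_int (round (u a)))\<^sup>2"] by simp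
    then have "real_of_int ((round (u a))\<^sup>2) \<le> real_of_int (4 * int n)" by simp
    then have "(round (u a))\<^sup>2 \<le> 4 * int n" by (simp only: of_int_le_iff)
    moreover have "\<bar>round (u a)\<bar> \<le> (round (u a))\<^sup>2"
      by (rule int_abs_le_square)
    ultimately show ?thesis by (simp add: abs_le_iff)
  qed
  then show ?thesis using s by (auto simp: int_net_def)
qed

text \<open>Let \<open>S\<close> be the supremum of \<open>N\<close> on the unit ball, finite by the
  crude Frobenius bound \<open>C\<close>. Splitting a scaled vector into a net point and a remainder
  of half its admissible length gives \<open>S \<le> sqrt Q / s + S / 2\<close>, which can be solved
  for \<open>S\<close>.\<close>

lemma opnorm_of_net:
  fixes A :: "nat \<times> nat \<Rightarrow> real"
  assumes n: "n > 0"
    and net: "\<And>p. p \<in> int_net n \<Longrightarrow> (\<Sum>i<m. (\<Sum>a<n. A (i, a) * real_of_int (p a))\<^sup>2) \<le> Q"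
  shows "(\<Sum>i<m. (\<Sum>a<n. A (i, a) * v a)\<^sup>2) \<le> 4 * Q / real n * (\<Sum>a<n. (v a)\<^sup>2)"
proof -
  define N where "N v = L2_set (\<lambda>i. \<Sum>a<n. A (i, a) * v a) {..<m}" for v
  define \<nu> where "\<nu> v = L2_set v {..<n}" for v :: "nat \<Rightarrow> real"
  have N0: "N v \<ge> 0" for v by (simp add: N_def)
  have Nscale: "N (\<lambda>a. c * v a) = \<bar>c\<bar> * N v" for c v
  proof -
    have "N (\<lambda>a. c * v a) = sqrt (c\<^sup>2 * (\<Sum>i<m. (\<Sum>a<n. A (i, a) * v a)\<^sup>2))"
      by (simp add: N_def L2_set_def sum_distrib_left power_mult_distrib[symmetric] mult_ac)
    then show ?thesis by (simp add: N_def L2_set_def real_sqrt_mult)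
  qed
  have \<nu>scale: "\<nu> (\<lambda>a. c * v a) = \<bar>c\<bar> * \<nu> v" for c v
    by (simp add: \<nu>_def L2_set_def power_mult_distrib sum_distrib_left[symmetric] real_sqrt_mult)
  have Nadd: "N (\<lambda>a. u a + v a) \<le> N u + N v" for u v
    unfolding N_def by (simp add: distrib_left sum.distrib L2_set_triangle_ineq)
  define C where "C = sqrt (\<Sum>i<m. \<Sum>a<n. (A (i, a))\<^sup>2)"
  have Nbound: "N v \<le> C * \<nu> v" for v
  proof -
    have "(\<Sum>i<m. (\<Sum>a<n. A (i, a) * v a)\<^sup>2) \<le> (\<Sum>i<m. (\<Sum>a<n. (A (i, a))\<^sup>2) * (\<Sum>a<n. (v a)\<^sup>2))"
      by (intro sum_mono Cauchy_Schwarz_ineq_sum)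
    then show ?thesis
      by (simp add: N_def \<nu>_def C_def L2_set_def real_sqrt_mult[symmetric] sum_distrib_right)
  qed
  define B where "B = N ` {v. \<nu> v \<le> 1}"
  have C0: "C \<ge> 0" by (simp add: C_def sum_nonneg)
  have bdd: "bdd_above B"
  proof (rule bdd_aboveI)
    fix x assume "x \<in> B"
    then obtain v where v: "\<nu> v \<le> 1" "x = N v" by (auto simp: B_def)
    then show "x \<le> C" using Nbound[of v] mult_left_mono[OF v(1) C0] by simp
  qed
  have ne: "B \<noteq> {}" by (auto simp: B_def \<nu>_def L2_set_def intro!: exI[of _ "\<lambda>_. 0"])
  define S where "S = Sup B"
  have NS: "N v \<le> S * \<nu> v" for v
  proof (cases "\<nu> v = 0")
    case True
    then show ?thesis using Nbound[of v] by simp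
  next
    case False
    then have pos: "\<nu> v > 0" by (simp add: \<nu>_def order_less_le)
    then have "\<nu> (\<lambda>a. 1 / \<nu> v * v a) \<le> 1" unfolding \<nu>scale by simp
    then have "N (\<lambda>a. 1 / \<nu> v * v a) \<le> S"
      unfolding S_def by (intro cSup_upper bdd) (auto simp: B_def)
    then have "\<bar>1 / \<nu> v\<bar> * N v \<le> S" unfolding Nscale .
    then show ?thesis using pos by (simp add: field_simps)
  qed
  have Q0: "Q \<ge> 0"
    by (rule order_trans[OF _ net[OF round_vector_in_int_net[of "\<lambda>_. 0"]]]) (auto intro: sum_nonneg)
  define s where "s = sqrt (real n)"
  have s: "s > 0" using n by (simp add: s_def)
  have "x \<le> sqrt Q / s + S / 2" if "x \<in> B" for x
  proof -
    from that obtain v where v: "\<nu> v \<le> 1" and x: "x = N v" by (auto simp: B_def)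
    define u where "u a = s * v a" for a
    define p where "p a = real_of_int (round (u a))" for a
    have ueq: "u = (\<lambda>a. s * v a)" by (simp add: u_def fun_eq_iff)
    have "\<nu> u \<le> s" using v s unfolding ueq \<nu>scale by simp
    then have "(\<Sum>a<n. (u a)\<^sup>2) \<le> real n" by (simp add: \<nu>_def L2_set_def s_def)
    from net[OF round_vector_in_int_net[OF this]]
    have Np: "N p \<le> sqrt Q" by (simp add: N_def L2_set_def p_def)
    have "\<nu> (\<lambda>a. u a - p a) \<le> s / 2"
    proof -
      have "(u a - p a)\<^sup>2 \<le> 1 / 4" for a
      proof -
        have "\<bar>p a - u a\<bar> \<le> 1/2" unfolding p_def by (rule of_int_round_abs_le)
        then have "\<bar>u a - p a\<bar> \<le> \<bar>1/2\<bar>" by linarith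
        then have "(u a - p a)\<^sup>2 \<le> (1/2)\<^sup>2" by (rule abs_le_square_iff[THEN iffD1])
        then show ?thesis by (simp add: power2_eq_square)
      qed
      then have "(\<Sum>a<n. (u a - p a)\<^sup>2) \<le> (\<Sum>a<n. 1 / 4)" by (rule sum_mono)
      then have "(\<Sum>a<n. (u a - p a)\<^sup>2) \<le> (s / 2)\<^sup>2" by (simp add: s_def power_divide)
      then have "sqrt (\<Sum>a<n. (u a - p a)\<^sup>2) \<le> s / 2" using s by (intro real_le_lsqrt) auto
      then show ?thesis by (simp only: \<nu>_def L2_set_def)
    qed
    moreover have "S \<ge> 0"
      unfolding S_def by (rule order_trans[OF N0 cSup_upper[OF _ bdd]]) (use v in \<open>auto simp: B_def\<close>)
    ultimately have "N (\<lambda>a. u a - p a) \<le> S * (s / 2)"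
      using NS[of "\<lambda>a. u a - p a"] mult_left_mono by (meson order_trans)
    then have "N u \<le> sqrt Q + S * (s / 2)" using Nadd[of p "\<lambda>a. u a - p a"] Np by simp
    then have "s * N v \<le> sqrt Q + S * (s / 2)" using s unfolding ueq Nscale by simp
    then show ?thesis using s x by (simp add: field_simps)
  qed
  then have "S \<le> sqrt Q / s + S / 2" unfolding S_def by (intro cSup_least ne)
  then have S: "S \<le> 2 * sqrt Q / s" by (simp add: field_simps)
  have "N v \<le> 2 * sqrt Q / s * \<nu> v"
    using NS[of v] mult_right_mono[OF S, of "\<nu> v"] by (simp add: \<nu>_def)
  then have "(N v)\<^sup>2 \<le> (2 * sqrt Q / s * \<nu> v)\<^sup>2" using N0 by (intro power_mono) auto
  also have "\<dots> = 4 * Q / real n * (\<Sum>a<n. (v a)\<^sup>2)"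
    using Q0 by (simp add: power_mult_distrib power_divide s_def \<nu>_def L2_set_def sum_nonneg)
  finally show ?thesis by (simp add: N_def L2_set_def sum_nonneg)
qed

text \<open>A bound at finitely many points stands for the operator norm bound: it is evidently
  measurable, and it is the event that the union bound controls.\<close>

definition net_bounded :: "nat \<Rightarrow> nat \<Rightarrow> (nat \<times> nat \<Rightarrow> real) \<Rightarrow> bool" where
  "net_bounded m n A \<longleftrightarrow>
     (\<forall>p\<in>int_net n. (\<Sum>i<m. (\<Sum>a<n. A (i, a) * real_of_int (p a))\<^sup>2) \<le> 480 * (real n)\<^sup>2)"

lemma net_bounded_opnorm:
  assumes "n > 0" "net_bounded m n A"
  shows "(\<Sum>i<m. (\<Sum>a<n. A (i, a) * v a)\<^sup>2) \<le> 1920 * real n * (\<Sum>a<n. (v a)\<^sup>2)"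
proof -
  have "4 * (480 * (real n)\<^sup>2) / real n = 1920 * real n"
    using assms(1) by (simp add: power2_eq_square)
  then show ?thesis
    using opnorm_of_net[OF assms(1), where m = m and A = A and Q = "480 * (real n)\<^sup>2" and v = v] assms(2)
    unfolding net_bounded_def by simp
qed

lemma net_bounded_mono:
  assumes "net_bounded m n A" "m' \<le> m"
  shows "net_bounded m' n A"
  unfolding net_bounded_def
proof
  fix p assume "p \<in> int_net n"
  then have "(\<Sum>i<m. (\<Sum>a<n. A (i, a) * real_of_int (p a))\<^sup>2) \<le> 480 * (real n)\<^sup>2"
    using assms(1) unfolding net_bounded_def by blast
  moreover have "(\<Sum>i<m'. (\<Sum>a<n. A (i, a) * real_of_int (p a))\<^sup>2)
      \<le> (\<Sum>i<m. (\<Sum>a<n. A (i, a) * real_of_int (p a))\<^sup>2)"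
    using assms(2) by (intro sum_mono2) auto
  ultimately show "(\<Sum>i<m'. (\<Sum>a<n. A (i, a) * real_of_int (p a))\<^sup>2) \<le> 480 * (real n)\<^sup>2" by linarith
qed

lemma sets_net_bounded:
  "{A \<in> space (PiM ({..<m} \<times> {..<n}) (\<lambda>_. gauss 1)). net_bounded m n A}
     \<in> sets (PiM ({..<m} \<times> {..<n}) (\<lambda>_. gauss 1))"
  unfolding net_bounded_def using finite_int_net[of n] by measurable

text \<open>The exponents add up as n for the moment generating function, - 15/2 n from the
  threshold and 6 n for the size of the net, leaving - n / 2. This balance determines the constant
  480.\<close>

lemma gaussian_net_bounded:
  assumes n: "n > 0" and mn: "m \<le> n"
  defines "P \<equiv> PiM ({..<m} \<times> {..<n}) (\<lambda>_. gauss 1)"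
  shows "emeasure P {A \<in> space P. \<not> net_bounded m n A} \<le> ennreal (exp (- real n / 2))"
proof -
  define q where "q p A = (\<Sum>i<m. (\<Sum>a<n. A (i, a) * real_of_int (p a))\<^sup>2)"
    for p :: "nat \<Rightarrow> int" and A :: "nat \<times> nat \<Rightarrow> real"
  define Q where "Q = 480 * (real n)\<^sup>2"
  define E where "E p = {A \<in> space P. Q \<le> q p A}" for p
  have qm [measurable]: "q p \<in> borel_measurable P" for p
    unfolding q_def P_def by measurable
  have Em: "E p \<in> sets P" for p unfolding E_def by measurable
  have E: "emeasure P (E p) \<le> ennreal (exp (real n - 15 / 2 * real n))" if p: "p \<in> int_net n" for p
  proof -
    \<comment> \<open>Net points have squared length at most 4 n, so 1 / (64 n) is the largest
      parameter for which the rank-one form stays within 1/8 of the squared length.\<close>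
    define t where "t = 1 / (64 * real n)"
    have t: "t > 0" using n by (simp add: t_def)
    define M where "M i j = (- 2 * t) * (real_of_int (p i) * real_of_int (p j))" for i j
    define W where "W = (\<Sum>a<n. (real_of_int (p a))\<^sup>2)"
    have W: "0 \<le> W" "W \<le> 4 * real n" using p by (auto simp: W_def int_net_def sum_nonneg)
    then have tW: "0 \<le> t * W" "t * W \<le> 1/16" using n by (auto simp: t_def field_simps)
    have qM: "qform {..<n} M v = - 2 * t * (\<Sum>a<n. v a * real_of_int (p a))\<^sup>2" for v
      unfolding M_def bform_scale bform_rank_one by (simp add: power2_eq_square mult.commute)
    have bound: "\<bar>qform {..<n} M v\<bar> \<le> (\<Sum>a<n. (v a)\<^sup>2) / 8" for v
    proof -
      have V: "(\<Sum>a<n. (v a)\<^sup>2) \<ge> 0" by (simp add: sum_nonneg)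
      have "(\<Sum>a<n. v a * real_of_int (p a))\<^sup>2 \<le> (\<Sum>a<n. (v a)\<^sup>2) * W"
        unfolding W_def by (rule Cauchy_Schwarz_ineq_sum)
      then have "2 * t * (\<Sum>a<n. v a * real_of_int (p a))\<^sup>2 \<le> 2 * t * ((\<Sum>a<n. (v a)\<^sup>2) * W)"
        using t by (intro mult_left_mono) auto
      also have "\<dots> = 2 * (\<Sum>a<n. (v a)\<^sup>2) * (t * W)" by simp
      also have "\<dots> \<le> 2 * (\<Sum>a<n. (v a)\<^sup>2) * (1 / 16)" using tW V by (intro mult_left_mono) auto
      finally show ?thesis unfolding qM using t by (simp add: abs_mult)
    qed
    have tr: "(\<Sum>i<n. M i i) = - 2 * (t * W)"
      by (simp add: M_def W_def sum_distrib_left power2_eq_square sum_negf mult_ac)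
    have fr: "(\<Sum>i<n. \<Sum>j<n. (M i j)\<^sup>2) = 4 * (t * W)\<^sup>2"
    proof -
      have "(\<Sum>i<n. \<Sum>j<n. (M i j)\<^sup>2) = 4 * t\<^sup>2 * (W * W)"
        unfolding W_def sum_product by (simp add: M_def power_mult_distrib sum_distrib_left)
      then show ?thesis by (simp add: power2_eq_square)
    qed
    have fr': "4 * (t * W)\<^sup>2 \<le> 1 / 64"
      using power_mono[OF tW(2,1), of 2] by (simp add: power2_eq_square)
    have "(\<integral>\<^sup>+ A. ennreal (exp (- (\<Sum>i<m. qform {..<n} M (\<lambda>a. A (i, a))) / (2 * 1\<^sup>2))) \<partial>P)
      \<le> ennreal (exp (real (card {..<m}) * (- (\<Sum>i<n. M i i) / 2 + (\<Sum>i<n. \<Sum>j<n. (M i j)\<^sup>2))))"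
      unfolding P_def by (rule block_qform_mgf[OF _ _ _ _ bound]) (auto simp: M_def intro: symm_onI)
    also have "\<dots> \<le> ennreal (exp (real n))"
    proof (intro ennreal_leI, unfold exp_le_cancel_iff)
      have "- (\<Sum>i<n. M i i) / 2 + (\<Sum>i<n. \<Sum>j<n. (M i j)\<^sup>2) \<le> 1"
        unfolding tr fr using tW fr' by simp
      then have "real m * (- (\<Sum>i<n. M i i) / 2 + (\<Sum>i<n. \<Sum>j<n. (M i j)\<^sup>2)) \<le> real m * 1"
        by (intro mult_left_mono) auto
      then show "real (card {..<m}) * (- (\<Sum>i<n. M i i) / 2 + (\<Sum>i<n. \<Sum>j<n. (M i j)\<^sup>2)) \<le> real n"
        using mn by simp
    qed
    also have "(\<lambda>A. - (\<Sum>i<m. qform {..<n} M (\<lambda>a. A (i, a))) / (2 * 1\<^sup>2)) = (\<lambda>A. t * q p A)"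
      by (simp add: qM q_def sum_negf sum_distrib_left[symmetric] mult.assoc)
    finally have "emeasure P {A \<in> space P. t * Q \<le> t * q p A} \<le> ennreal (exp (real n - t * Q))"
      by (intro emeasure_exp_Markov) simp_all
    moreover have "t * Q = 15 / 2 * real n" using n by (simp add: t_def Q_def power2_eq_square)
    moreover have "{A \<in> space P. t * Q \<le> t * q p A} = E p" using t by (auto simp: E_def)
    ultimately show ?thesis by (simp only:)
  qed
  have "emeasure P {A \<in> space P. \<not> net_bounded m n A} \<le> emeasure P (\<Union>p\<in>int_net n. E p)"
    using Em finite_int_net
    by (intro emeasure_mono sets.finite_UN) (auto simp: net_bounded_def E_def q_def Q_def intro: less_imp_le)
  also have "\<dots> \<le> (\<Sum>p\<in>int_net n. emeasure P (E p))"
    using Em finite_int_net by (intro emeasure_subadditive_finite) auto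
  also have "\<dots> \<le> (\<Sum>p\<in>int_net n. ennreal (exp (real n - 15 / 2 * real n)))" by (intro sum_mono E)
  also have "\<dots> = ennreal (real (card (int_net n)) * exp (real n - 15 / 2 * real n))"
    by (simp add: ennreal_mult ennreal_of_nat_eq_real_of_nat)
  also have "\<dots> \<le> ennreal (exp (6 * real n) * exp (real n - 15 / 2 * real n))"
    by (intro ennreal_leI mult_right_mono card_int_net) simp
  also have "\<dots> = ennreal (exp (- real n / 2))" by (simp add: exp_add[symmetric])
  finally show ?thesis .
qed

section \<open>Lower tails of Gram matrices\<close>

lemma prob_space_gauss: "\<sigma> > 0 \<Longrightarrow> prob_space (gauss \<sigma>)"
  by (rule prob_space_normal_density)

lemma product_sigma_finite_gauss: "\<sigma> > 0 \<Longrightarrow> product_sigma_finite (\<lambda>_. gauss \<sigma>)"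
  by (rule product_sigma_finite.intro) (rule prob_space_imp_sigma_finite, rule prob_space_gauss)

lemma prob_space_PiM_gauss: "\<sigma> > 0 \<Longrightarrow> prob_space (PiM I (\<lambda>_. gauss \<sigma>))"
  by (intro prob_space_PiM prob_space_gauss)

text \<open>Half of the mean is removed. This energy is, up to a factor, the trace of the quadratic
  form to which the next lemma applies, so its lower bound makes the conditional mean there
  large.\<close>

lemma weighted_energy_lower_tail:
  fixes d :: "nat \<Rightarrow> real" and m n :: nat
  assumes B: "B > 0" "\<And>a. a < n \<Longrightarrow> \<bar>d a\<bar> \<le> B"
  defines "P \<equiv> PiM ({..<m} \<times> {..<n}) (\<lambda>_. gauss 1)" and "D \<equiv> (\<Sum>a<n. (d a)\<^sup>2)"
  shows "emeasure P {A \<in> space P. (\<Sum>i<m. \<Sum>a<n. (d a * A (i, a))\<^sup>2) \<le> real m * D / 2}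
     \<le> ennreal (exp (- real m * D / (64 * B\<^sup>2)))"
proof -
  define c where "c = 1 / (8 * B\<^sup>2)"
  have c: "c > 0" using B by (simp add: c_def)
  have cd: "0 \<le> c * (d a)\<^sup>2" "c * (d a)\<^sup>2 \<le> 1/8" if "a < n" for a
  proof -
    have "(d a)\<^sup>2 \<le> B\<^sup>2" using B(2)[OF that] B(1) by (intro abs_le_square_iff[THEN iffD1]) auto
    then show "c * (d a)\<^sup>2 \<le> 1/8" using B(1) by (simp add: c_def field_simps)
  qed (use c in simp)
  define M where "M i j = kron i j * (c * (d i)\<^sup>2)" for i j
  have q: "qform {..<n} M v = c * (\<Sum>a<n. (d a * v a)\<^sup>2)" for v
  proof -
    have "qform {..<n} M v = (\<Sum>i<n. \<Sum>j<n. kron i j * (c * (d i)\<^sup>2 * v i * v j))"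
      by (simp add: bform_def M_def mult_ac)
    also have "\<dots> = (\<Sum>i<n. c * (d i)\<^sup>2 * v i * v i)"
      by (intro sum.cong refl) (simp add: kron_def if_distrib[of "\<lambda>x. x * _"] cong: if_cong)
    finally show ?thesis by (simp add: sum_distrib_left power_mult_distrib power2_eq_square mult_ac)
  qed
  have bound: "\<bar>qform {..<n} M v\<bar> \<le> (\<Sum>a<n. (v a)\<^sup>2) / 8" for v
  proof -
    have "qform {..<n} M v = (\<Sum>a<n. (c * (d a)\<^sup>2) * (v a)\<^sup>2)"
      unfolding q by (simp add: sum_distrib_left power_mult_distrib mult.assoc)
    also have "\<dots> \<le> (\<Sum>a<n. 1/8 * (v a)\<^sup>2)" using cd by (intro sum_mono mult_right_mono) auto
    finally have "qform {..<n} M v \<le> (\<Sum>a<n. (v a)\<^sup>2) / 8" by (simp only: sum_distrib_left[symmetric])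
    moreover have "qform {..<n} M v \<ge> 0" unfolding q using c by (simp add: sum_nonneg)
    ultimately show ?thesis by simp
  qed
  have tr: "(\<Sum>i<n. M i i) = c * D" by (simp add: M_def kron_def D_def sum_distrib_left)
  have fr: "(\<Sum>i<n. \<Sum>j<n. (M i j)\<^sup>2) \<le> c * D / 8"
  proof -
    have "(\<Sum>i<n. \<Sum>j<n. (M i j)\<^sup>2) = (\<Sum>i<n. (c * (d i)\<^sup>2) * (c * (d i)\<^sup>2))"
      by (intro sum.cong refl) (simp add: M_def kron_def power2_eq_square if_distrib[of "\<lambda>x. x * _"] cong: if_cong)
    also have "\<dots> \<le> (\<Sum>i<n. (c * (d i)\<^sup>2) * (1/8))" using cd by (intro sum_mono mult_left_mono) auto
    finally show ?thesis by (simp add: D_def sum_distrib_left sum_divide_distrib)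
  qed
  define S where "S A = (\<Sum>i<m. \<Sum>a<n. (d a * A (i, a))\<^sup>2)" for A :: "nat \<times> nat \<Rightarrow> real"
  have meas: "(\<lambda>A. - (c / 2) * S A) \<in> borel_measurable P" unfolding S_def P_def by measurable
  have "(\<lambda>A. - (\<Sum>i<m. qform {..<n} M (\<lambda>a. A (i, a))) / (2 * 1\<^sup>2)) = (\<lambda>A. - (c / 2) * S A)"
    unfolding q S_def by (simp add: sum_distrib_left[symmetric])
  then have "(\<integral>\<^sup>+ A. ennreal (exp (- (c / 2) * S A)) \<partial>P)
      = (\<integral>\<^sup>+ A. ennreal (exp (- (\<Sum>i<m. qform {..<n} M (\<lambda>a. A (i, a))) / (2 * 1\<^sup>2))) \<partial>P)"
    by (metis (no_types, lifting))
  also have "\<dots> \<le> ennreal (exp (real (card {..<m}) * (- (\<Sum>i<n. M i i) / 2 + (\<Sum>i<n. \<Sum>j<n. (M i j)\<^sup>2))))"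
    unfolding P_def by (rule block_qform_mgf[OF _ _ _ _ bound]) (auto simp: M_def kron_def intro: symm_onI)
  also have "\<dots> \<le> ennreal (exp (real m * (- (3 / 8) * (c * D))))"
  proof (intro ennreal_leI, unfold exp_le_cancel_iff card_lessThan, intro mult_left_mono)
    show "- (\<Sum>i<n. M i i) / 2 + (\<Sum>i<n. \<Sum>j<n. (M i j)\<^sup>2) \<le> - (3 / 8) * (c * D)"
      unfolding tr using fr by (simp add: field_simps)
  qed simp
  finally have "emeasure P {A \<in> space P. - (c / 4) * (real m * D) \<le> - (c / 2) * S A}
      \<le> ennreal (exp (real m * (- (3 / 8) * (c * D)) - (- (c / 4) * (real m * D))))"
    by (rule emeasure_exp_Markov[OF meas])
  also have "real m * (- (3 / 8) * (c * D)) - (- (c / 4) * (real m * D)) = - real m * D / (64 * B\<^sup>2)"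
    using B by (simp add: c_def field_simps)
  also have "{A \<in> space P. - (c / 4) * (real m * D) \<le> - (c / 2) * S A} = {A \<in> space P. S A \<le> real m * D / 2}"
    using c by (auto simp: field_simps)
  finally show ?thesis by (simp add: S_def)
qed

text \<open>The first group of rows is frozen in \<open>x\<close>; the sum is then a positive
  semidefinite form in each row of the second group. The net condition bounds the form from above,
  the energy bounds its trace from below, and \<open>frobenius_le_trace\<close> bounds the variance
  term by an eighth of the trace.\<close>

lemma bilinear_lower_tail:
  fixes d :: "nat \<Rightarrow> real" and x :: "nat \<times> nat \<Rightarrow> real" and R :: "nat set"
  assumes B: "B > 0" "\<And>a. a < n \<Longrightarrow> \<bar>d a\<bar> \<le> B" and n: "n > 0" and R: "finite R"
    and net: "net_bounded m1 n x" and D: "real m1 * D / 2 \<le> (\<Sum>i<m1. \<Sum>a<n. (d a * x (i, a))\<^sup>2)"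
  defines "P \<equiv> PiM (R \<times> {..<n}) (\<lambda>_. gauss 1)"
  shows "emeasure P {y \<in> space P. (\<Sum>i<m1. \<Sum>j\<in>R. (\<Sum>a<n. d a * x (i, a) * y (j, a))\<^sup>2)
             \<le> real m1 * real (card R) * D / 4}
     \<le> ennreal (exp (- real m1 * real (card R) * D / (245760 * real n * B\<^sup>2)))"
proof -
  \<comment> \<open>The operator norm bound gives 1920 n B^2 for the unscaled form, and 2 s times
    this equals 1/8. Since the exponent keeps one eighth of s, the constant 245760 is 8 times
    30720.\<close>
  define s where "s = 1 / (30720 * real n * B\<^sup>2)"
  have s: "s > 0" using B n by (simp add: s_def)
  define S where "S = (\<Sum>i<m1. \<Sum>a<n. (d a * x (i, a))\<^sup>2)"
  define M where "M a b = 2 * s * (\<Sum>i<m1. (d a * x (i, a)) * (d b * x (i, b)))" for a b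
  have q: "qform {..<n} M v = 2 * s * (\<Sum>i<m1. (\<Sum>a<n. d a * x (i, a) * v a)\<^sup>2)" for v
  proof -
    have "qform {..<n} M v = 2 * s * (\<Sum>a<n. \<Sum>b<n. \<Sum>i<m1. (d a * x (i, a) * v a) * (d b * x (i, b) * v b))"
      by (simp add: bform_def M_def sum_distrib_left sum_distrib_right mult_ac)
    also have "(\<Sum>a<n. \<Sum>b<n. \<Sum>i<m1. (d a * x (i, a) * v a) * (d b * x (i, b) * v b))
        = (\<Sum>i<m1. \<Sum>a<n. \<Sum>b<n. (d a * x (i, a) * v a) * (d b * x (i, b) * v b))"
      by (simp only: sum.swap[of _ "{..<m1}"])
    also have "\<dots> = (\<Sum>i<m1. (\<Sum>a<n. d a * x (i, a) * v a)\<^sup>2)"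
      by (simp only: sum_product[symmetric] power2_eq_square)
    finally show ?thesis .
  qed
  have q0: "qform {..<n} M v \<ge> 0" for v unfolding q using s by (simp add: sum_nonneg)
  have q1: "qform {..<n} M v \<le> 1/8 * (\<Sum>a<n. (v a)\<^sup>2)" for v
  proof -
    have "(\<Sum>i<m1. (\<Sum>a<n. d a * x (i, a) * v a)\<^sup>2) \<le> 1920 * real n * (\<Sum>a<n. (d a * v a)\<^sup>2)"
      using net_bounded_opnorm[OF n net, of "\<lambda>a. d a * v a"] by (simp add: mult_ac)
    also have "(\<Sum>a<n. (d a * v a)\<^sup>2) \<le> (\<Sum>a<n. B\<^sup>2 * (v a)\<^sup>2)"
    proof (intro sum_mono)
      fix a assume "a \<in> {..<n}"
      then have "(d a)\<^sup>2 \<le> B\<^sup>2" using B(2)[of a] B(1) by (intro abs_le_square_iff[THEN iffD1]) auto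
      then show "(d a * v a)\<^sup>2 \<le> B\<^sup>2 * (v a)\<^sup>2" by (simp add: power_mult_distrib mult_right_mono)
    qed
    finally have "(\<Sum>i<m1. (\<Sum>a<n. d a * x (i, a) * v a)\<^sup>2) \<le> 1920 * real n * (B\<^sup>2 * (\<Sum>a<n. (v a)\<^sup>2))"
      by (simp add: sum_distrib_left mult_left_mono)
    then have "2 * s * (\<Sum>i<m1. (\<Sum>a<n. d a * x (i, a) * v a)\<^sup>2)
        \<le> 2 * s * (1920 * real n * (B\<^sup>2 * (\<Sum>a<n. (v a)\<^sup>2)))"
      using s by (intro mult_left_mono) auto
    also have "\<dots> = 1/8 * (\<Sum>a<n. (v a)\<^sup>2)" using n B by (simp add: s_def)
    finally show ?thesis unfolding q .
  qed
  have sym: "symm_on {..<n} M" by (rule symm_onI) (simp add: M_def mult_ac)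
  have tr: "(\<Sum>a<n. M a a) = 2 * s * S"
    unfolding M_def S_def sum_distrib_left by (subst sum.swap) (simp add: power2_eq_square)
  have fr: "(\<Sum>i<n. \<Sum>j<n. (M i j)\<^sup>2) \<le> 1/8 * (\<Sum>a<n. M a a)"
    by (rule frobenius_le_trace[OF _ sym _ q0 q1]) auto
  define Q where "Q y = (\<Sum>i<m1. \<Sum>j\<in>R. (\<Sum>a<n. d a * x (i, a) * y (j, a))\<^sup>2)" for y :: "nat \<times> nat \<Rightarrow> real"
  have meas: "(\<lambda>y. - s * Q y) \<in> borel_measurable P" unfolding Q_def P_def using R by measurable
  have "(\<lambda>y. - (\<Sum>j\<in>R. qform {..<n} M (\<lambda>a. y (j, a))) / (2 * 1\<^sup>2)) = (\<lambda>y. - s * Q y)"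
    unfolding q Q_def by (subst sum.swap) (simp add: sum_distrib_left[symmetric])
  then have "(\<integral>\<^sup>+ y. ennreal (exp (- s * Q y)) \<partial>P)
      = (\<integral>\<^sup>+ y. ennreal (exp (- (\<Sum>j\<in>R. qform {..<n} M (\<lambda>a. y (j, a))) / (2 * 1\<^sup>2))) \<partial>P)"
    by (metis (no_types, lifting))
  also have "\<dots> \<le> ennreal (exp (real (card R) * (- (\<Sum>i<n. M i i) / 2 + (\<Sum>i<n. \<Sum>j<n. (M i j)\<^sup>2))))"
    unfolding P_def by (rule block_qform_mgf[OF R _ _ sym]) (use q0 q1 in auto)
  also have "\<dots> \<le> ennreal (exp (real (card R) * (- (3 / 8) * s * (real m1 * D))))"
  proof (intro ennreal_leI, unfold exp_le_cancel_iff, intro mult_left_mono)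
    have "s * (real m1 * D / 2) \<le> s * S" using D s unfolding S_def by (intro mult_left_mono) auto
    then show "- (\<Sum>i<n. M i i) / 2 + (\<Sum>i<n. \<Sum>j<n. (M i j)\<^sup>2) \<le> - (3 / 8) * s * (real m1 * D)"
      using fr unfolding tr by (simp add: field_simps)
  qed simp
  finally have "emeasure P {y \<in> space P. - s * (real m1 * real (card R) * D / 4) \<le> - s * Q y}
      \<le> ennreal (exp (real (card R) * (- (3 / 8) * s * (real m1 * D)) - (- s * (real m1 * real (card R) * D / 4))))"
    by (rule emeasure_exp_Markov[OF meas])
  also have "real (card R) * (- (3 / 8) * s * (real m1 * D)) - (- s * (real m1 * real (card R) * D / 4))
      = - real m1 * real (card R) * D / (245760 * real n * B\<^sup>2)"
    using B n by (simp add: s_def field_simps)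
  also have "{y \<in> space P. - s * (real m1 * real (card R) * D / 4) \<le> - s * Q y}
      = {y \<in> space P. Q y \<le> real m1 * real (card R) * D / 4}"
    using s by (auto simp: field_simps)
  finally show ?thesis by (simp add: Q_def)
qed

text \<open>
  The rows of \<open>A\<close> are split into two groups. Only the products of a row of the first group with a
  row of the second are kept: given the first group they form a positive semidefinite quadratic
  form in the second, so the one-sided tail is exponential in its trace over its operator norm.
\<close>

lemma frobenius_lower_tail:
  fixes d :: "nat \<Rightarrow> real"
  assumes B: "B > 0" "\<And>a. a < n \<Longrightarrow> \<bar>d a\<bar> \<le> B" and n: "n > 0" and m1: "m1 \<le> m"
  defines "P \<equiv> PiM ({..<m} \<times> {..<n}) (\<lambda>_. gauss 1)" and "D \<equiv> (\<Sum>a<n. (d a)\<^sup>2)"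
  shows "emeasure P {A \<in> space P. net_bounded m n A \<and>
      (\<Sum>i<m. \<Sum>j<m. (\<Sum>a<n. d a * A (i, a) * A (j, a))\<^sup>2) \<le> real m1 * real (m - m1) * D / 4}
     \<le> ennreal (exp (- real m1 * D / (64 * B\<^sup>2))
          + exp (- real m1 * real (m - m1) * D / (245760 * real n * B\<^sup>2)))"
proof -
  define R where "R = {m1..<m}"
  define I where "I = {..<m1} \<times> {..<n}"
  define J where "J = R \<times> {..<n}"
  define \<tau> where "\<tau> = real m1 * real (m - m1) * D / 4"
  have IJ: "I \<inter> J = {}" "finite I" "finite J" "I \<union> J = {..<m} \<times> {..<n}"
    using m1 by (auto simp: I_def J_def R_def)
  let ?PI = "PiM I (\<lambda>_. gauss 1)" and ?PJ = "PiM J (\<lambda>_. gauss 1)"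
  have PIJ: "P = PiM (I \<union> J) (\<lambda>_. gauss 1)" by (simp add: P_def IJ)
  interpret product_sigma_finite "\<lambda>_::nat \<times> nat. gauss 1" by (rule product_sigma_finite_gauss) simp
  interpret PJ: prob_space ?PJ by (rule prob_space_PiM_gauss) simp
  define Q where "Q A A' = (\<Sum>i<m1. \<Sum>j\<in>R. (\<Sum>a<n. d a * A (i, a) * A' (j, a))\<^sup>2)"
    for A A' :: "nat \<times> nat \<Rightarrow> real"
  \<comment> \<open>Of the net condition only the part on the first \<open>m1\<close> rows is kept,
    so that under the Fubini integral it restricts the outer variable alone.\<close>
  define E where "E = {A \<in> space P. net_bounded m1 n A \<and> Q A A \<le> \<tau>}"
  define S where "S = {x \<in> space ?PI. (\<Sum>i<m1. \<Sum>a<n. (d a * x (i, a))\<^sup>2) \<le> real m1 * D / 2}"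
  define b where "b = exp (- real m1 * real (m - m1) * D / (245760 * real n * B\<^sup>2))"
  have Em: "E \<in> sets P"
  proof -
    have "(\<lambda>A. A (i, a)) \<in> borel_measurable P" if "i < m" "a < n" for i a
      using measurable_component_singleton[of "(i, a)" "{..<m} \<times> {..<n}" "\<lambda>_. gauss 1"] that
      by (simp add: P_def)
    then have [measurable]: "(\<lambda>A. \<Sum>i<m1. (\<Sum>a<n. A (i, a) * real_of_int (p a))\<^sup>2) \<in> borel_measurable P"
      "(\<lambda>A. Q A A) \<in> borel_measurable P" for p
      unfolding Q_def R_def using m1
      by (auto intro!: borel_measurable_sum borel_measurable_times borel_measurable_power)
    show ?thesis unfolding E_def net_bounded_def using finite_int_net[of n] by measurable
  qed
  have Sm: "S \<in> sets ?PI" unfolding S_def I_def by measurable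
  have "emeasure P {A \<in> space P. net_bounded m n A \<and>
      (\<Sum>i<m. \<Sum>j<m. (\<Sum>a<n. d a * A (i, a) * A (j, a))\<^sup>2) \<le> \<tau>} \<le> emeasure P E"
  proof (rule emeasure_mono[OF _ Em], safe)
    fix A assume A: "A \<in> space P" "net_bounded m n A"
      "(\<Sum>i<m. \<Sum>j<m. (\<Sum>a<n. d a * A (i, a) * A (j, a))\<^sup>2) \<le> \<tau>"
    have "Q A A \<le> (\<Sum>i<m1. \<Sum>j<m. (\<Sum>a<n. d a * A (i, a) * A (j, a))\<^sup>2)"
      unfolding Q_def R_def by (intro sum_mono sum_mono2) auto
    also have "\<dots> \<le> (\<Sum>i<m. \<Sum>j<m. (\<Sum>a<n. d a * A (i, a) * A (j, a))\<^sup>2)"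
      using m1 by (intro sum_mono2) (auto intro: sum_nonneg)
    finally show "A \<in> E" using A net_bounded_mono[OF A(2) m1] by (simp add: E_def)
  qed
  also have "emeasure P E = (\<integral>\<^sup>+ x. (\<integral>\<^sup>+ y. indicator E (merge I J (x, y)) \<partial>?PJ) \<partial>?PI)"
  proof -
    have "emeasure P E = (\<integral>\<^sup>+ A. indicator E A \<partial>P)" using Em by simp
    also have "\<dots> = (\<integral>\<^sup>+ x. (\<integral>\<^sup>+ y. indicator E (merge I J (x, y)) \<partial>?PJ) \<partial>?PI)"
      unfolding PIJ by (rule product_nn_integral_fold[OF IJ(1-3)]) (use Em PIJ in auto)
    finally show ?thesis .
  qed
  also have "\<dots> \<le> (\<integral>\<^sup>+ x. indicator S x + ennreal b \<partial>?PI)"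
  proof (intro nn_integral_mono)
    fix x assume x: "x \<in> space ?PI"
    have mI: "merge I J (x, y) (i, a) = x (i, a)" if "i < m1" "a < n" for i a y
      using that by (simp add: I_def merge_def)
    have mJ: "merge I J (x, y) (j, a) = y (j, a)" if "j \<in> R" "a < n" for j a y
      using that by (simp add: I_def J_def R_def merge_def)
    have Qm: "Q (merge I J (x, y)) (merge I J (x, y)) = Q x y" for y
      unfolding Q_def by (intro sum.cong refl arg_cong[of _ _ "\<lambda>z. z\<^sup>2"]) (simp add: mI mJ)
    have Nm: "net_bounded m1 n (merge I J (x, y)) \<longleftrightarrow> net_bounded m1 n x" for y
    proof -
      have "(\<Sum>i<m1. (\<Sum>a<n. merge I J (x, y) (i, a) * real_of_int (p a))\<^sup>2)
          = (\<Sum>i<m1. (\<Sum>a<n. x (i, a) * real_of_int (p a))\<^sup>2)" for p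
        by (intro sum.cong refl arg_cong[of _ _ "\<lambda>z. z\<^sup>2"]) (simp add: mI)
      then show ?thesis unfolding net_bounded_def by simp
    qed
    show "(\<integral>\<^sup>+ y. indicator E (merge I J (x, y)) \<partial>?PJ) \<le> indicator S x + ennreal b"
    proof (cases "x \<in> S")
      case True
      have "(\<integral>\<^sup>+ y. indicator E (merge I J (x, y)) \<partial>?PJ) \<le> (\<integral>\<^sup>+ y. 1 \<partial>?PJ)"
        by (intro nn_integral_mono) (simp add: indicator_def)
      also have "\<dots> = 1" by (simp add: PJ.emeasure_space_1)
      finally show ?thesis using True by (simp add: add_increasing2)
    next
      case False
      show ?thesis
      proof (cases "net_bounded m1 n x")
        case True
        define F where "F = {y \<in> space ?PJ. Q x y \<le> \<tau>}"
        have Fm: "F \<in> sets ?PJ" unfolding F_def Q_def J_def R_def by measurable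
        have "(\<integral>\<^sup>+ y. indicator E (merge I J (x, y)) \<partial>?PJ) \<le> (\<integral>\<^sup>+ y. indicator F y \<partial>?PJ)"
          by (intro nn_integral_mono) (auto simp: indicator_def E_def F_def Qm)
        also have "\<dots> = emeasure ?PJ F" using Fm by simp
        also have "\<dots> \<le> ennreal b"
        proof -
          have "real m1 * D / 2 \<le> (\<Sum>i<m1. \<Sum>a<n. (d a * x (i, a))\<^sup>2)"
            using False x by (simp add: S_def)
          from bilinear_lower_tail[OF B n _ True this, of R]
          show ?thesis unfolding F_def J_def Q_def \<tau>_def b_def by (simp add: R_def)
        qed
        finally show ?thesis using False by simp
      next
        case nb: False
        have "(\<integral>\<^sup>+ y. indicator E (merge I J (x, y)) \<partial>?PJ) = (\<integral>\<^sup>+ y. 0 \<partial>?PJ)"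
          using nb by (intro nn_integral_cong) (simp add: indicator_def E_def Nm)
        then show ?thesis by simp
      qed
    qed
  qed
  also have "\<dots> = emeasure ?PI S + ennreal b"
  proof -
    interpret PI: prob_space ?PI by (rule prob_space_PiM_gauss) simp
    show ?thesis using Sm by (subst nn_integral_add) (auto simp: PI.emeasure_space_1)
  qed
  also have "\<dots> \<le> ennreal (exp (- real m1 * D / (64 * B\<^sup>2))) + ennreal b"
    unfolding S_def I_def D_def by (intro add_right_mono weighted_energy_lower_tail B)
  finally show ?thesis unfolding \<tau>_def b_def by (simp add: ennreal_plus[symmetric] del: ennreal_plus)
qed

section \<open>Nonsingularity of a Gaussian matrix\<close>

lemma borel_measurable_det_mat_of [measurable (raw)]:
  fixes f :: "'a \<Rightarrow> nat \<Rightarrow> nat \<Rightarrow> real"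
  assumes "\<And>i j. i < n \<Longrightarrow> j < n \<Longrightarrow> (\<lambda>\<omega>. f \<omega> i j) \<in> borel_measurable N"
  shows "(\<lambda>\<omega>. det (mat_of n (f \<omega>))) \<in> borel_measurable N"
proof -
  have "det (mat_of n (f \<omega>)) = (\<Sum>p\<in>{p. p permutes {0..<n}}. signof p * (\<Prod>i = 0..<n. f \<omega> i (p i)))" for \<omega>
    unfolding det_def'[OF mat_of_carrier]
  proof (intro sum.cong refl arg_cong2[of _ _ _ _ "(*)"] prod.cong)
    fix p i assume "p \<in> {p. p permutes {0..<n}}" "i \<in> {0..<n}"
    then show "mat_of n (f \<omega>) $$ (i, p i) = f \<omega> i (p i)"
      using permutes_in_image[of p "{0..<n}" i] by (simp add: mat_of_def)
  qed
  moreover have "(\<lambda>\<omega>. \<Sum>p\<in>{p. p permutes {0..<n}}. signof p * (\<Prod>i = 0..<n. f \<omega> i (p i))) \<in> borel_measurable N"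
  proof (intro borel_measurable_sum borel_measurable_times borel_measurable_const borel_measurable_prod)
    fix p i assume "p \<in> {p. p permutes {0..<n}}" "i \<in> {0..<n}"
    then show "(\<lambda>\<omega>. f \<omega> i (p i)) \<in> borel_measurable N"
      using permutes_in_image[of p "{0..<n}" i] by (intro assms) auto
  qed
  ultimately show ?thesis by simp
qed

lemma cofactor_mat_of:
  assumes "i < n" "j < n"
  shows "cofactor (mat_of n S) i j
    = (-1) ^ (i + j) * det (mat_of (n - 1) (\<lambda>a b. S (if a < i then a else Suc a) (if b < j then b else Suc b)))"
proof -
  have "mat_delete (mat_of n S) i j
      = mat_of (n - 1) (\<lambda>a b. S (if a < i then a else Suc a) (if b < j then b else Suc b))"
    using assms by (intro eq_matI) (auto simp: mat_delete_def mat_of_def)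
  then show ?thesis by (simp add: cofactor_def)
qed

lemma borel_measurable_cofactor_mat_of [measurable (raw)]:
  fixes f :: "'a \<Rightarrow> nat \<Rightarrow> nat \<Rightarrow> real"
  assumes "\<And>i j. i < n \<Longrightarrow> j < n \<Longrightarrow> (\<lambda>\<omega>. f \<omega> i j) \<in> borel_measurable N" "i < n" "j < n"
  shows "(\<lambda>\<omega>. cofactor (mat_of n (f \<omega>)) i j) \<in> borel_measurable N"
  unfolding cofactor_mat_of[OF assms(2,3)]
  by (intro borel_measurable_times borel_measurable_const borel_measurable_det_mat_of assms(1)) auto

text \<open>The determinant is affine in its last diagonal entry, with the preceding leading minor
  as slope: in the Laplace expansion along the last row, no other term contains this entry.\<close>

lemma det_mat_of_last_entry:
  assumes "\<And>i k. i < Suc j \<Longrightarrow> k < Suc j \<Longrightarrow> (i, k) \<noteq> (j, j) \<Longrightarrow> S i k = S' i k"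
  shows "det (mat_of (Suc j) S) = (S j j - S' j j) * det (mat_of j S') + det (mat_of (Suc j) S')"
proof -
  have exp: "det (mat_of (Suc j) R) = (\<Sum>k<j. R j k * cofactor (mat_of (Suc j) R) j k) + R j j * det (mat_of j R)"
    for R :: "nat \<Rightarrow> nat \<Rightarrow> real"
  proof -
    have "det (mat_of (Suc j) R) = (\<Sum>k<Suc j. mat_of (Suc j) R $$ (j, k) * cofactor (mat_of (Suc j) R) j k)"
      by (rule laplace_expansion_row) auto
    also have "\<dots> = (\<Sum>k<Suc j. R j k * cofactor (mat_of (Suc j) R) j k)"
      by (intro sum.cong refl) (simp add: mat_of_def)
    also have "\<dots> = (\<Sum>k<j. R j k * cofactor (mat_of (Suc j) R) j k) + R j j * cofactor (mat_of (Suc j) R) j j"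
      by simp
    also have "cofactor (mat_of (Suc j) R) j j = det (mat_of j R)"
    proof -
      have "mat_of j (\<lambda>a b. R (if a < j then a else Suc a) (if b < j then b else Suc b)) = mat_of j R"
        by (rule mat_of_cong) simp
      then show ?thesis by (simp add: cofactor_mat_of)
    qed
    finally show ?thesis .
  qed
  have "det (mat_of j S) = det (mat_of j S')"
    by (rule arg_cong[of _ _ det], rule mat_of_cong, rule assms) auto
  moreover have "(\<Sum>k<j. S j k * cofactor (mat_of (Suc j) S) j k) = (\<Sum>k<j. S' j k * cofactor (mat_of (Suc j) S') j k)"
  proof (intro sum.cong refl)
    fix k assume k: "k \<in> {..<j}"
    have "cofactor (mat_of (Suc j) S) j k = cofactor (mat_of (Suc j) S') j k"
    proof -
      have "mat_of (Suc j - 1) (\<lambda>a b. S (if a < j then a else Suc a) (if b < k then b else Suc b))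
          = mat_of (Suc j - 1) (\<lambda>a b. S' (if a < j then a else Suc a) (if b < k then b else Suc b))"
        by (rule mat_of_cong, rule assms) auto
      then show ?thesis using k by (simp add: cofactor_mat_of)
    qed
    then show "S j k * cofactor (mat_of (Suc j) S) j k = S' j k * cofactor (mat_of (Suc j) S') j k"
      using k assms[of j k] by simp
  qed
  ultimately show ?thesis unfolding exp by (simp add: algebra_simps)
qed

lemma emeasure_gauss_singleton: "emeasure (gauss \<sigma>) {t} = 0"
proof -
  have "emeasure (gauss \<sigma>) {t} = (\<integral>\<^sup>+ x. ennreal (normal_density 0 \<sigma> x) * indicator {t} x \<partial>lborel)"
    by (subst emeasure_density) auto
  also have "\<dots> = 0"
  proof (subst nn_integral_0_iff_AE)
    show "AE x in lborel. ennreal (normal_density 0 \<sigma> x) * indicator {t} x = 0"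
      using AE_lborel_singleton[of t] by eventually_elim simp
  qed measurable
  finally show ?thesis .
qed

text \<open>Induction on the size of the minor. Where the minor of size \<open>j\<close> does not
  vanish, the next one is a nonconstant affine function of the independent entry at
  \<open>(j, j)\<close>, so it vanishes for a single value, which has Gaussian measure 0.\<close>

lemma gaussian_leading_minor_singular:
  assumes "j \<le> m" "m \<le> n"
  defines "P \<equiv> PiM ({..<m} \<times> {..<n}) (\<lambda>_. gauss 1)"
  shows "emeasure P {A \<in> space P. det (mat_of j (\<lambda>i k. A (i, k))) = 0} = 0"
  using assms(1)
proof (induction j)
  case 0
  have "det (mat_of 0 S) = 1" for S by (simp add: mat_of_def)
  then show ?case by simp
next
  case (Suc j)
  define K where "K = {..<m} \<times> {..<n} - {(j, j)}"
  have K: "finite K" "(j, j) \<notin> K" and ins: "{..<m} \<times> {..<n} = insert (j, j) K"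
    using Suc.prems assms(2) by (auto simp: K_def)
  have comp: "(\<lambda>A. A (i, k)) \<in> borel_measurable P" if "i < Suc j" "k < Suc j" for i k
    using measurable_component_singleton[of "(i, k)" "{..<m} \<times> {..<n}" "\<lambda>_. gauss 1"] that Suc.prems assms(2)
    by (simp add: P_def)
  have dm: "(\<lambda>A. det (mat_of l (\<lambda>i k. A (i, k)))) \<in> borel_measurable P" if "l \<le> Suc j" for l
    using that by (intro borel_measurable_det_mat_of comp) auto
  define D where "D l A = det (mat_of l (\<lambda>i k. A (i, k)))" for l and A :: "nat \<times> nat \<Rightarrow> real"
  have [measurable]: "D j \<in> borel_measurable P" "D (Suc j) \<in> borel_measurable P"
    using dm[of j] dm[of "Suc j"] by (auto simp: D_def[abs_def])
  interpret product_sigma_finite "\<lambda>_::nat \<times> nat. gauss 1" by (rule product_sigma_finite_gauss) simp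
  define E where "E = {A \<in> space P. D j A \<noteq> 0 \<and> D (Suc j) A = 0}"
  have Em: "E \<in> sets P" unfolding E_def by measurable
  have "emeasure P E = (\<integral>\<^sup>+ A. indicator E A \<partial>P)" using Em by simp
  also have "\<dots> = (\<integral>\<^sup>+ x. (\<integral>\<^sup>+ t. indicator E (x((j, j) := t)) \<partial>gauss 1) \<partial>PiM K (\<lambda>_. gauss 1))"
    unfolding P_def ins by (rule product_nn_integral_insert[OF K]) (use Em in \<open>auto simp: P_def ins\<close>)
  also have "\<dots> = (\<integral>\<^sup>+ x. 0 \<partial>PiM K (\<lambda>_. gauss 1))"
  proof (intro nn_integral_cong)
    fix x :: "nat \<times> nat \<Rightarrow> real"
    let ?x0 = "x((j, j) := 0)"
    have D1: "D (Suc j) (x((j, j) := t)) = t * D j ?x0 + D (Suc j) ?x0" for t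
      unfolding D_def by (subst det_mat_of_last_entry[where S' = "\<lambda>i k. ?x0 (i, k)"]) auto
    have D0: "D j (x((j, j) := t)) = D j ?x0" for t
      unfolding D_def by (rule arg_cong[of _ _ det], rule mat_of_cong) auto
    \<comment> \<open>If the smaller minor vanishes, the quotient is 0 by the convention on
      division, which does no harm: such points are not in \<open>E\<close>, so the left side is
      0.\<close>
    have "indicator E (x((j, j) := t)) \<le> (indicator {- D (Suc j) ?x0 / D j ?x0} t :: ennreal)" for t
    proof (cases "x((j, j) := t) \<in> E")
      case True
      then have "D j (x((j, j) := t)) \<noteq> 0" "D (Suc j) (x((j, j) := t)) = 0" unfolding E_def by blast+
      then have "D j ?x0 \<noteq> 0" "t * D j ?x0 + D (Suc j) ?x0 = 0" unfolding D0[of t] D1[of t] .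
      then have "t = - D (Suc j) ?x0 / D j ?x0" by (simp add: field_simps eq_neg_iff_add_eq_0)
      then show ?thesis by (simp add: indicator_def)
    qed simp
    then have "(\<integral>\<^sup>+ t. indicator E (x((j, j) := t)) \<partial>gauss 1)
        \<le> (\<integral>\<^sup>+ t. indicator {- D (Suc j) ?x0 / D j ?x0} t \<partial>gauss 1)"
      by (intro nn_integral_mono)
    also have "\<dots> = 0" by (simp add: emeasure_gauss_singleton)
    finally show "(\<integral>\<^sup>+ t. indicator E (x((j, j) := t)) \<partial>gauss 1) = 0" by simp
  qed
  finally have E0: "emeasure P E = 0" by simp
  have Zm: "{A \<in> space P. D j A = 0} \<in> sets P" by measurable
  have "{A \<in> space P. D (Suc j) A = 0} \<subseteq> E \<union> {A \<in> space P. D j A = 0}" by (auto simp: E_def)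
  then have "emeasure P {A \<in> space P. D (Suc j) A = 0} \<le> emeasure P (E \<union> {A \<in> space P. D j A = 0})"
    using Em Zm by (intro emeasure_mono) auto
  also have "\<dots> \<le> emeasure P E + emeasure P {A \<in> space P. D j A = 0}"
    using Em Zm by (intro emeasure_subadditive) auto
  also have "\<dots> = 0" using E0 Suc by (simp add: D_def)
  finally show ?case by (simp add: D_def)
qed

section \<open>Gram matrices\<close>

definition gram :: "nat \<Rightarrow> (nat \<times> nat \<Rightarrow> real) \<Rightarrow> (nat \<Rightarrow> real) \<Rightarrow> nat \<Rightarrow> nat \<Rightarrow> real" where
  "gram n A x i j = (\<Sum>a<n. A (i, a) * A (j, a) * (x a)\<^sup>2)"

lemma bform_gram:
  "bform {..<m} (gram n A x) u v
     = (\<Sum>a<n. (x a * (\<Sum>i<m. u i * A (i, a))) * (x a * (\<Sum>i<m. v i * A (i, a))))"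
proof -
  have "bform {..<m} (gram n A x) u v
      = (\<Sum>i<m. \<Sum>j<m. \<Sum>a<n. (x a)\<^sup>2 * ((u i * A (i, a)) * (v j * A (j, a))))"
    by (simp add: bform_def gram_def sum_distrib_left sum_distrib_right mult_ac)
  also have "\<dots> = (\<Sum>a<n. \<Sum>i<m. \<Sum>j<m. (x a)\<^sup>2 * ((u i * A (i, a)) * (v j * A (j, a))))"
    by (simp only: sum.swap[of _ "{..<n}"])
  also have "\<dots> = (\<Sum>a<n. (x a)\<^sup>2 * ((\<Sum>i<m. u i * A (i, a)) * (\<Sum>i<m. v i * A (i, a))))"
    by (intro sum.cong refl, subst sum_product) (simp only: sum_distrib_left)
  finally show ?thesis by (simp add: power2_eq_square mult_ac)
qed

lemma symm_on_gram: "symm_on J (gram n A x)"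
  by (rule symm_onI) (simp add: gram_def mult_ac)

lemma qform_gram: "qform {..<m} (gram n A x) v = (\<Sum>a<n. (x a * (\<Sum>i<m. v i * A (i, a)))\<^sup>2)"
  unfolding bform_gram by (simp add: power2_eq_square)

lemma qform_gram_nonneg: "qform {..<m} (gram n A x) v \<ge> 0"
  unfolding qform_gram by (simp add: sum_nonneg)

text \<open>Coordinatewise comparison of squared signals becomes comparison of Gram matrices in the
  Loewner order, whatever \<open>A\<close> is. Both the fixed ratio of the signal bounds and the
  ratio 1 + \<delta> between a signal and its net point enter this way.\<close>

lemma qform_gram_mono:
  assumes "\<And>a. a < n \<Longrightarrow> (x a)\<^sup>2 \<le> c * (x' a)\<^sup>2"
  shows "qform {..<m} (gram n A x) v \<le> c * qform {..<m} (gram n A x') v"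
  unfolding qform_gram
proof (subst sum_distrib_left, rule sum_mono)
  fix a assume "a \<in> {..<n}"
  then have "(x a)\<^sup>2 * (\<Sum>i<m. v i * A (i, a))\<^sup>2 \<le> c * (x' a)\<^sup>2 * (\<Sum>i<m. v i * A (i, a))\<^sup>2"
    using assms by (intro mult_right_mono) auto
  then show "(x a * (\<Sum>i<m. v i * A (i, a)))\<^sup>2 \<le> c * (x' a * (\<Sum>i<m. v i * A (i, a)))\<^sup>2"
    by (simp add: power_mult_distrib mult.assoc)
qed

text \<open>A zero of the form annihilates every column of \<open>A\<close>, in particular the first
  \<open>m\<close> of them, which form a nonsingular square matrix.\<close>

lemma pos_def_on_gram:
  assumes "\<And>a. a < n \<Longrightarrow> x a \<noteq> 0" "m \<le> n" "det (mat_of m (\<lambda>i k. A (i, k))) \<noteq> 0"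
  shows "pos_def_on {..<m} (gram n A x)"
  unfolding pos_def_on_def
proof (intro conjI allI impI symm_on_gram)
  fix v :: "nat \<Rightarrow> real" assume v: "\<exists>i\<in>{..<m}. v i \<noteq> 0"
  show "0 < qform {..<m} (gram n A x) v"
  proof (rule ccontr)
    assume "\<not> ?thesis"
    then have "qform {..<m} (gram n A x) v = 0" using qform_gram_nonneg[of m n A x v] by linarith
    then have "\<forall>a\<in>{..<n}. (x a * (\<Sum>i<m. v i * A (i, a)))\<^sup>2 = 0"
      unfolding qform_gram by (subst (asm) sum_nonneg_eq_0_iff) auto
    then have z: "(\<Sum>i<m. v i * A (i, a)) = 0" if "a < m" for a
      using that assms(1,2) by (auto simp: dest: bspec[of _ _ a])
    let ?M = "transpose_mat (mat_of m (\<lambda>i k. A (i, k)))"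
    let ?v = "Matrix.vec m v"
    have M: "?M \<in> carrier_mat m m" by simp
    have "?M *\<^sub>v ?v = 0\<^sub>v m"
      by (rule eq_vecI)
         (auto simp: mat_of_def scalar_prod_def lessThan_atLeast0[symmetric] z mult.commute)
    moreover have "?v \<noteq> 0\<^sub>v m" using v by (auto simp: vec_eq_iff)
    ultimately have "det ?M = 0"
      using det_0_iff_vec_prod_zero[OF M] by (metis vec_carrier)
    then show False using assms(3) by (simp add: det_transpose[where n = m])
  qed
qed

lemma bessel:
  fixes r :: "nat \<Rightarrow> nat \<Rightarrow> real" and m n :: nat
  assumes "\<And>l l'. l < m \<Longrightarrow> l' < m \<Longrightarrow> (\<Sum>a<n. r l a * r l' a) = kron l l'"
  shows "(\<Sum>l<m. (\<Sum>a<n. r l a * v a)\<^sup>2) \<le> (\<Sum>a<n. (v a)\<^sup>2)"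
proof -
  define c where "c l = (\<Sum>a<n. r l a * v a)" for l
  have 1: "(\<Sum>a<n. v a * (\<Sum>l<m. c l * r l a)) = (\<Sum>l<m. (c l)\<^sup>2)"
  proof -
    have "(\<Sum>a<n. v a * (\<Sum>l<m. c l * r l a)) = (\<Sum>l<m. c l * (\<Sum>a<n. r l a * v a))"
      unfolding sum_distrib_left by (subst sum.swap) (simp add: mult_ac)
    then show ?thesis by (simp add: c_def power2_eq_square)
  qed
  have 2: "(\<Sum>a<n. (\<Sum>l<m. c l * r l a)\<^sup>2) = (\<Sum>l<m. (c l)\<^sup>2)"
  proof -
    have "(\<Sum>a<n. (\<Sum>l<m. c l * r l a)\<^sup>2) = (\<Sum>a<n. \<Sum>l<m. \<Sum>l'<m. c l * c l' * (r l a * r l' a))"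
      by (simp add: power2_eq_square sum_product mult_ac)
    also have "\<dots> = (\<Sum>l<m. \<Sum>l'<m. \<Sum>a<n. c l * c l' * (r l a * r l' a))"
      by (simp only: sum.swap[of _ _ "{..<n}"])
    also have "\<dots> = (\<Sum>l<m. \<Sum>l'<m. c l * c l' * kron l l')"
      by (intro sum.cong refl) (simp add: sum_distrib_left[symmetric] assms)
    also have "\<dots> = (\<Sum>l<m. (c l)\<^sup>2)"
    proof (intro sum.cong refl)
      have k: "(\<Sum>l'<m. f l' * kron l l') = f l" if "l < m" for f :: "nat \<Rightarrow> real" and l
        using that by (simp add: kron_def if_distrib[of "\<lambda>x. _ * x"] cong: if_cong)
      fix l assume "l \<in> {..<m}"
      then show "(\<Sum>l'<m. c l * c l' * kron l l') = (c l)\<^sup>2" by (subst k) (auto simp: power2_eq_square)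
    qed
    finally show ?thesis .
  qed
  have sq: "(\<Sum>a<n. (v a - s a)\<^sup>2) = (\<Sum>a<n. (v a)\<^sup>2) - 2 * (\<Sum>a<n. v a * s a) + (\<Sum>a<n. (s a)\<^sup>2)" for s
    by (simp add: power2_diff sum.distrib sum_subtractf sum_distrib_left mult.assoc)
  have "0 \<le> (\<Sum>a<n. (v a - (\<Sum>l<m. c l * r l a))\<^sup>2)" by (simp add: sum_nonneg)
  also have "\<dots> = (\<Sum>a<n. (v a)\<^sup>2) - 2 * (\<Sum>a<n. v a * (\<Sum>l<m. c l * r l a)) + (\<Sum>a<n. (\<Sum>l<m. c l * r l a)\<^sup>2)"
    by (rule sq)
  finally show ?thesis unfolding 1 2 by (simp add: c_def)
qed

lemma (in whitening) inverse_entry: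
  assumes "det (mat_of n S) \<noteq> 0" "i < n" "j < n"
  shows "(\<Sum>l<n. t l i * t l j) = cofactor (mat_of n S) j i / det (mat_of n S)"
proof -
  let ?S = "mat_of n S" and ?B = "transpose_mat (mat_of n t) * mat_of n t"
  have adj: "adj_mat ?S \<in> carrier_mat n n" "adj_mat ?S * ?S = det ?S \<cdot>\<^sub>m 1\<^sub>m n"
    using adj_mat[OF mat_of_carrier] by auto
  have B: "?B \<in> carrier_mat n n" by (rule mult_carrier_mat[of _ n n]) auto
  have "adj_mat ?S = adj_mat ?S * (?S * ?B)" by (simp only: mat_white' right_mult_one_mat[OF adj(1)])
  also have "\<dots> = adj_mat ?S * ?S * ?B"
    by (rule assoc_mult_mat[symmetric, OF adj(1) mat_of_carrier B])
  also have "\<dots> = det ?S \<cdot>\<^sub>m ?B"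
    unfolding adj(2) mult_smult_assoc_mat[OF one_carrier_mat B] left_mult_one_mat[OF B] ..
  finally have "adj_mat ?S $$ (i, j) = (det ?S \<cdot>\<^sub>m ?B) $$ (i, j)" by simp
  moreover have "adj_mat ?S $$ (i, j) = cofactor ?S j i"
    using assms by (simp add: adj_mat_def mat_of_def)
  moreover have "(det ?S \<cdot>\<^sub>m ?B) $$ (i, j) = det ?S * (\<Sum>l<n. t l i * t l j)"
    using assms by (auto simp: mat_of_def scalar_prod_def lessThan_atLeast0)
  ultimately show ?thesis using assms(1) by (simp add: field_simps)
qed

lemma (in whitening) det_pos: "det (mat_of n S) > 0"
proof -
  have "det (mat_of n t) * det (mat_of n S) * det (mat_of n t) = 1"
    using mat_white det_mult[of "mat_of n t * mat_of n S" n "transpose_mat (mat_of n t)"]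
      det_mult[of "mat_of n t" n "mat_of n S"] det_transpose[of "mat_of n t" n]
      mult_carrier_mat[of "mat_of n t" n n "mat_of n S" n]
    by simp
  then have "(det (mat_of n t))\<^sup>2 * det (mat_of n S) = 1" by (simp add: power2_eq_square mult_ac)
  moreover have "(det (mat_of n t))\<^sup>2 * det (mat_of n S) \<le> 0" if "det (mat_of n S) \<le> 0"
    using that by (intro mult_nonneg_nonpos) auto
  ultimately show ?thesis by fastforce
qed

lemma pos_def_on_det_pos: "pos_def_on {..<n} S \<Longrightarrow> det (mat_of n S) > 0"
  using pos_def_on_whitening whitening.det_pos by blast

lemma bform_sum_right: "bform J M u (\<lambda>a. \<Sum>i\<in>K. z i * v i a) = (\<Sum>i\<in>K. z i * bform J M u (v i))"
proof -
  have sw: "bform J M u v = bform J (\<lambda>x y. M y x) v u" for u v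
    unfolding bform_def by (subst sum.swap) (simp add: mult_ac)
  show ?thesis unfolding sw[of u] by (rule bform_sum_left)
qed

lemma qform_sum:
  "qform J M (\<lambda>a. \<Sum>i\<in>K. z i * u i a) = qform K (\<lambda>i j. bform J M (u i) (u j)) z"
  unfolding bform_sum_left bform_sum_right by (simp add: bform_def[of K] sum_distrib_left mult_ac)

lemma qform_sum_squares:
  "qform J (\<lambda>a b. \<Sum>l\<in>K. u l a * u l b) v = (\<Sum>l\<in>K. (\<Sum>a\<in>J. u l a * v a)\<^sup>2)"
proof -
  have "qform J (\<lambda>a b. \<Sum>l\<in>K. u l a * u l b) v = (\<Sum>a\<in>J. \<Sum>b\<in>J. \<Sum>l\<in>K. (u l a * v a) * (u l b * v b))"
    unfolding bform_def sum_distrib_right by (simp add: mult_ac)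
  also have "\<dots> = (\<Sum>l\<in>K. \<Sum>a\<in>J. \<Sum>b\<in>J. (u l a * v a) * (u l b * v b))"
    by (simp only: sum.swap[of _ K])
  finally show ?thesis by (simp only: sum_product[symmetric] power2_eq_square)
qed

text \<open>
  Cramer's rule keeps the entries of the inverse measurable in the matrix; they are \<open>0\<close>
  for a singular matrix.
\<close>

definition inv_entry :: "nat \<Rightarrow> (nat \<Rightarrow> nat \<Rightarrow> real) \<Rightarrow> nat \<Rightarrow> nat \<Rightarrow> real" where
  "inv_entry n S i j = cofactor (mat_of n S) j i / det (mat_of n S)"

lemma (in whitening) qform_inv_entry:
  assumes "det (mat_of n S) \<noteq> 0"
  shows "qform {..<n} (inv_entry n S) y = (\<Sum>l<n. (\<Sum>a<n. t l a * y a)\<^sup>2)"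
  unfolding qform_sum_squares[symmetric]
  by (rule bform_cong) (simp_all add: inv_entry_def inverse_entry[OF assms])

lemma (in whitening) trace_inv_entry:
  assumes "det (mat_of n S) \<noteq> 0"
  shows "(\<Sum>i<n. \<Sum>j<n. inv_entry n S i j * S' i j) = (\<Sum>l<n. qform {..<n} S' (t l))"
proof -
  have "(\<Sum>i<n. \<Sum>j<n. inv_entry n S i j * S' i j) = (\<Sum>i<n. \<Sum>j<n. \<Sum>l<n. S' i j * t l i * t l j)"
    by (intro sum.cong refl)
       (simp add: inv_entry_def inverse_entry[OF assms, symmetric] sum_distrib_left sum_distrib_right mult_ac)
  also have "\<dots> = (\<Sum>i<n. \<Sum>l<n. \<Sum>j<n. S' i j * t l i * t l j)"
    by (intro sum.cong refl sum.swap)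
  also have "\<dots> = (\<Sum>l<n. \<Sum>i<n. \<Sum>j<n. S' i j * t l i * t l j)"
    by (rule sum.swap)
  also have "\<dots> = (\<Sum>l<n. qform {..<n} S' (t l))"
    by (simp only: bform_def)
  finally show ?thesis .
qed

text \<open>For z = A^T v, Cauchy-Schwarz bounds the square of |z|^2 = (v, A z) by |v|^2 R |z|^2,
  and one factor |z|^2 cancels.\<close>

lemma opnorm_transpose:
  fixes A :: "nat \<times> nat \<Rightarrow> real"
  assumes "\<And>v. (\<Sum>i<m. (\<Sum>a<n. A (i, a) * v a)\<^sup>2) \<le> R * (\<Sum>a<n. (v a)\<^sup>2)"
    and R: "R \<ge> 0"
  shows "(\<Sum>a<n. (\<Sum>i<m. v i * A (i, a))\<^sup>2) \<le> R * (\<Sum>i<m. (v i)\<^sup>2)"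
proof -
  define z where "z a = (\<Sum>i<m. v i * A (i, a))" for a
  define W where "W = (\<Sum>a<n. (z a)\<^sup>2)"
  define V where "V = (\<Sum>i<m. (v i)\<^sup>2)"
  have W0: "W \<ge> 0" and V0: "V \<ge> 0" by (simp_all add: W_def V_def sum_nonneg)
  have "W = (\<Sum>a<n. z a * (\<Sum>i<m. v i * A (i, a)))" by (simp add: W_def z_def power2_eq_square)
  also have "\<dots> = (\<Sum>i<m. v i * (\<Sum>a<n. A (i, a) * z a))"
    unfolding sum_distrib_left by (subst sum.swap) (simp add: mult_ac)
  finally have "W\<^sup>2 \<le> V * (\<Sum>i<m. (\<Sum>a<n. A (i, a) * z a)\<^sup>2)"
    unfolding V_def using Cauchy_Schwarz_ineq_sum[of v "\<lambda>i. \<Sum>a<n. A (i, a) * z a" "{..<m}"] by simp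
  also have "\<dots> \<le> V * (R * W)" using assms(1)[of z] V0 by (intro mult_left_mono) (auto simp: W_def)
  finally have WW: "W * W \<le> (R * V) * W" by (simp add: power2_eq_square mult_ac)
  have "W \<le> R * V"
  proof (cases "W = 0")
    case True
    then show ?thesis using R V0 by simp
  next
    case False
    then show ?thesis using WW W0 by simp
  qed
  then show ?thesis by (simp add: W_def V_def z_def)
qed

section \<open>The likelihood gap\<close>

lemma pointwise_ratio:
  fixes x_min x_max s t :: real
  assumes "0 < x_min" "x_min \<le> s" "s \<le> x_max" "x_min \<le> t" "t \<le> x_max"
  shows "s\<^sup>2 \<le> (x_max / x_min)\<^sup>2 * t\<^sup>2"
proof -
  have "s \<le> x_max / x_min * t"
  proof -
    have "x_max * x_min \<le> x_max * t" using assms by (intro mult_left_mono) auto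
    then have "x_max \<le> x_max / x_min * t" using assms(1) by (simp add: field_simps)
    then show ?thesis using assms by linarith
  qed
  then have "s\<^sup>2 \<le> (x_max / x_min * t)\<^sup>2" using assms by (intro power_mono) auto
  then show ?thesis by (simp only: power_mult_distrib)
qed

text \<open>Whitening by the Gram matrix of \<open>x\<close> turns that of \<open>x'\<close> into a
  form between \<open>1 / \<kappa>\<close> and \<open>\<kappa>\<close> times the identity, and the
  determinant into a ratio; then \<open>det_pos_def\<close> applies. It serves twice: with the ratio
  of the signal bounds for the divergence, and with 1 + \<delta> for the passage to the net.\<close>

lemma gram_log_det_le:
  assumes W: "whitening m (gram n A x) t" and pd: "pos_def_on {..<m} (gram n A x')" and \<kappa>: "\<kappa> \<ge> 1"
    and r: "\<And>a. a < n \<Longrightarrow> (x a)\<^sup>2 \<le> \<kappa> * (x' a)\<^sup>2" "\<And>a. a < n \<Longrightarrow> (x' a)\<^sup>2 \<le> \<kappa> * (x a)\<^sup>2"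
  shows "ln (det (mat_of m (gram n A x'))) - ln (det (mat_of m (gram n A x)))
    \<le> (\<Sum>i<m. qform {..<m} (gram n A x') (t i) - 1)
      - (\<Sum>i<m. \<Sum>j<m. (bform {..<m} (gram n A x') (t i) (t j) - kron i j)\<^sup>2) / (4 * \<kappa>)"
proof -
  interpret whitening m "gram n A x" t by (rule W)
  define P where "P = (\<lambda>i j. bform {..<m} (gram n A x') (t i) (t j))"
  have qP: "qform {..<m} P v = qform {..<m} (gram n A x') (\<lambda>a. \<Sum>i<m. v i * t i a)" for v
    unfolding P_def qform_sum ..
  have qS: "qform {..<m} (gram n A x) (\<lambda>a. \<Sum>i<m. v i * t i a) = (\<Sum>i<m. (v i)\<^sup>2)" for v
  proof -
    have "qform {..<m} (gram n A x) (\<lambda>a. \<Sum>i<m. v i * t i a) = qform {..<m} kron v"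
      unfolding qform_sum by (rule bform_cong) (simp_all add: white)
    then show ?thesis by (simp add: bform_kron power2_eq_square)
  qed
  have P_hi: "qform {..<m} P v \<le> \<kappa> * (\<Sum>i<m. (v i)\<^sup>2)" for v
    unfolding qP qS[symmetric] by (rule qform_gram_mono[OF r(2)])
  have P_lo: "(\<Sum>i<m. (v i)\<^sup>2) \<le> \<kappa> * qform {..<m} P v" for v
    unfolding qP qS[symmetric] by (rule qform_gram_mono[OF r(1)])
  have pdP: "pos_def_on {..<m} P"
    unfolding pos_def_on_def
  proof (intro conjI allI impI)
    show "symm_on {..<m} P"
      by (rule symm_onI) (simp only: P_def bform_commute[OF symm_on_gram])
    fix v :: "nat \<Rightarrow> real" assume "\<exists>i\<in>{..<m}. v i \<noteq> 0"
    then obtain i where i: "i < m" "v i \<noteq> 0" by auto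
    have "0 < (v i)\<^sup>2" using i by simp
    also have "\<dots> \<le> (\<Sum>i<m. (v i)\<^sup>2)" using i by (intro member_le_sum) auto
    also have "\<dots> \<le> \<kappa> * qform {..<m} P v" by (rule P_lo)
    finally show "0 < qform {..<m} P v" using \<kappa> by (simp add: zero_less_mult_iff)
  qed
  have "ln (det (mat_of m P)) \<le> (\<Sum>i<m. P i i - 1) - (\<Sum>i<m. \<Sum>j<m. (P i j - kron i j)\<^sup>2) / (4 * \<kappa>)"
    using det_pos_def[OF pdP P_hi \<kappa>] by simp
  moreover have "ln (det (mat_of m P)) = ln (det (mat_of m (gram n A x'))) - ln (det (mat_of m (gram n A x)))"
    unfolding P_def using det_congruence[of "gram n A x'"] det_pos pos_def_on_det_pos[OF pd] by (simp add: ln_div)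
  ultimately show ?thesis by (simp add: P_def)
qed

text \<open>Whitening is done at \<open>x\<close>, since the trace involves the inverse of the Gram
  matrix of \<open>x\<close>. The quadratic gain is the squared Frobenius norm of the whitened
  difference; \<open>frobenius_congruence\<close> removes the whitening at the price of (x_max^2
  R)^2.\<close>

lemma likelihood_gap_lower:
  fixes x xo :: "nat \<Rightarrow> real" and A :: "nat \<times> nat \<Rightarrow> real"
  assumes xm: "0 < x_min" and x: "\<And>a. a < n \<Longrightarrow> x_min \<le> x a \<and> x a \<le> x_max"
    and xo: "\<And>a. a < n \<Longrightarrow> x_min \<le> xo a \<and> xo a \<le> x_max"
    and mn: "m \<le> n" "n > 0" and A: "det (mat_of m (\<lambda>i k. A (i, k))) \<noteq> 0"
    and op: "\<And>v. (\<Sum>i<m. (\<Sum>a<n. A (i, a) * v a)\<^sup>2) \<le> R * (\<Sum>a<n. (v a)\<^sup>2)" and R: "R > 0"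
  shows "det (mat_of m (gram n A x)) > 0"
    and "(\<Sum>i<m. \<Sum>j<m. (\<Sum>a<n. ((xo a)\<^sup>2 - (x a)\<^sup>2) * A (i, a) * A (j, a))\<^sup>2)
            / (4 * (x_max / x_min)\<^sup>2 * (x_max\<^sup>2 * R)\<^sup>2)
       \<le> ln (det (mat_of m (gram n A x))) - ln (det (mat_of m (gram n A xo)))
         + (\<Sum>i<m. \<Sum>j<m. inv_entry m (gram n A x) i j * gram n A xo i j) - real m"
proof -
  define \<kappa> where "\<kappa> = (x_max / x_min)\<^sup>2"
  have xM: "x_min \<le> x_max" using x[of 0] mn by auto
  then have \<kappa>: "\<kappa> \<ge> 1" using xm by (simp add: \<kappa>_def)
  have xM0: "x_max > 0" using xM xm by linarith
  have nz: "x a \<noteq> 0" "xo a \<noteq> 0" if "a < n" for a using x[OF that] xo[OF that] xm by auto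
  have pd: "pos_def_on {..<m} (gram n A x)" "pos_def_on {..<m} (gram n A xo)"
    using nz mn A by (auto intro!: pos_def_on_gram)
  have hx: "qform {..<m} (gram n A z) v \<le> x_max\<^sup>2 * R * (\<Sum>i<m. (v i)\<^sup>2)"
    if "\<And>a. a < n \<Longrightarrow> x_min \<le> z a \<and> z a \<le> x_max" for z v
  proof -
    have "qform {..<m} (gram n A z) v \<le> x_max\<^sup>2 * qform {..<m} (gram n A (\<lambda>_. 1)) v"
      using that xm by (intro qform_gram_mono) (fastforce intro: power_mono)
    also have "\<dots> \<le> x_max\<^sup>2 * (R * (\<Sum>i<m. (v i)\<^sup>2))"
      unfolding qform_gram using opnorm_transpose[OF op less_imp_le[OF R], of v] by (intro mult_left_mono) auto
    finally show ?thesis by (simp add: mult.assoc)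
  qed
  show dx: "det (mat_of m (gram n A x)) > 0" by (rule pos_def_on_det_pos[OF pd(1)])
  have dxo: "det (mat_of m (gram n A xo)) > 0" by (rule pos_def_on_det_pos[OF pd(2)])
  obtain t where "whitening m (gram n A x) t" using pos_def_on_whitening[OF pd(1)] by blast
  then interpret W: whitening m "gram n A x" t .
  define P where "P = (\<lambda>i j. bform {..<m} (gram n A xo) (t i) (t j))"
  have r: "(x a)\<^sup>2 \<le> \<kappa> * (xo a)\<^sup>2" "(xo a)\<^sup>2 \<le> \<kappa> * (x a)\<^sup>2" if "a < n" for a
    unfolding \<kappa>_def using x[OF that] xo[OF that] xm by (auto intro!: pointwise_ratio)
  have "ln (det (mat_of m (gram n A xo))) - ln (det (mat_of m (gram n A x)))
      \<le> (\<Sum>i<m. P i i - 1) - (\<Sum>i<m. \<Sum>j<m. (P i j - kron i j)\<^sup>2) / (4 * \<kappa>)"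
    unfolding P_def by (rule gram_log_det_le[OF W.whitening_axioms pd(2) \<kappa> r])
  moreover have "(\<Sum>i<m. P i i - 1) = (\<Sum>i<m. \<Sum>j<m. inv_entry m (gram n A x) i j * gram n A xo i j) - real m"
    using W.trace_inv_entry[of "gram n A xo"] dx by (simp add: P_def sum_subtractf)
  ultimately have 1: "(\<Sum>i<m. \<Sum>j<m. (P i j - kron i j)\<^sup>2) / (4 * \<kappa>)
      \<le> ln (det (mat_of m (gram n A x))) - ln (det (mat_of m (gram n A xo)))
         + (\<Sum>i<m. \<Sum>j<m. inv_entry m (gram n A x) i j * gram n A xo i j) - real m" by linarith
  define Df where "Df = (\<lambda>i j. gram n A xo i j - gram n A x i j)"
  have PD: "bform {..<m} Df (t i) (t j) = P i j - kron i j" if "i < m" "j < m" for i j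
    unfolding Df_def bform_diff P_def W.white[OF that] ..
  have Dfe: "Df i j = (\<Sum>a<n. ((xo a)\<^sup>2 - (x a)\<^sup>2) * A (i, a) * A (j, a))" for i j
    unfolding Df_def gram_def sum_subtractf[symmetric] by (intro sum.cong refl) (simp add: algebra_simps)
  have h: "x_max\<^sup>2 * R > 0" using R xM0 by simp
  have "(\<Sum>i<m. \<Sum>j<m. (Df i j)\<^sup>2)
      \<le> (x_max\<^sup>2 * R)\<^sup>2 * (\<Sum>i<m. \<Sum>j<m. (bform {..<m} Df (t i) (t j))\<^sup>2)"
    by (rule W.frobenius_congruence[OF qform_gram_nonneg hx[OF x] h])
  also have "(\<Sum>i<m. \<Sum>j<m. (bform {..<m} Df (t i) (t j))\<^sup>2) = (\<Sum>i<m. \<Sum>j<m. (P i j - kron i j)\<^sup>2)"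
    by (intro sum.cong refl) (simp add: PD)
  finally have "(\<Sum>i<m. \<Sum>j<m. (Df i j)\<^sup>2) / (x_max\<^sup>2 * R)\<^sup>2 \<le> (\<Sum>i<m. \<Sum>j<m. (P i j - kron i j)\<^sup>2)"
    using h zero_less_power[OF h, of 2] by (simp only: pos_divide_le_eq mult.commute)
  then have "(\<Sum>i<m. \<Sum>j<m. (Df i j)\<^sup>2) / (x_max\<^sup>2 * R)\<^sup>2 / (4 * \<kappa>)
      \<le> (\<Sum>i<m. \<Sum>j<m. (P i j - kron i j)\<^sup>2) / (4 * \<kappa>)"
    using \<kappa> by (intro divide_right_mono) auto
  with 1 show "(\<Sum>i<m. \<Sum>j<m. (\<Sum>a<n. ((xo a)\<^sup>2 - (x a)\<^sup>2) * A (i, a) * A (j, a))\<^sup>2)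
            / (4 * (x_max / x_min)\<^sup>2 * (x_max\<^sup>2 * R)\<^sup>2)
       \<le> ln (det (mat_of m (gram n A x))) - ln (det (mat_of m (gram n A xo)))
         + (\<Sum>i<m. \<Sum>j<m. inv_entry m (gram n A x) i j * gram n A xo i j) - real m"
    unfolding Dfe \<kappa>_def by (simp add: mult_ac)
qed

text \<open>The vectors \<open>r l\<close>, obtained from the whitening vectors by A^T and then the
  signal \<open>x\<close>, are orthonormal, and \<open>u l\<close> differs from \<open>r l\<close>
  by the coordinatewise factor \<open>xo / x\<close>. Bessel's inequality thus bounds the data term
  by \<open>\<kappa>\<close> times the speckle energy, and the trace is at most
  \<open>\<kappa> m\<close>, not \<open>\<kappa> n\<close>.\<close>

lemma speckle_projection:
  fixes x xo :: "nat \<Rightarrow> real" and A :: "nat \<times> nat \<Rightarrow> real"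
  assumes W: "whitening m (gram n A x) t"
    and xo: "\<forall>a<n. x a \<noteq> 0 \<and> (xo a)\<^sup>2 \<le> \<kappa> * (x a)\<^sup>2"
    and u: "\<And>l a. u l a = (\<Sum>i<m. t l i * A (i, a)) * xo a"
  shows "(\<Sum>l<m. (\<Sum>a<n. u l a * v a)\<^sup>2) \<le> \<kappa> * (\<Sum>a<n. (v a)\<^sup>2)"
    and "(\<Sum>a<n. \<Sum>l<m. u l a * u l a) = (\<Sum>l<m. qform {..<m} (gram n A xo) (t l))"
    and "(\<Sum>l<m. qform {..<m} (gram n A xo) (t l)) \<le> \<kappa> * real m"
    and "(\<Sum>l<m. (\<Sum>i<m. t l i * (\<Sum>a<n. A (i, a) * xo a * v a))\<^sup>2) = (\<Sum>l<m. (\<Sum>a<n. u l a * v a)\<^sup>2)"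
proof -
  interpret whitening m "gram n A x" t by (rule W)
  define r where "r l a = x a * (\<Sum>i<m. t l i * A (i, a))" for l a
  have on: "(\<Sum>a<n. r l a * r l' a) = kron l l'" if "l < m" "l' < m" for l l'
    using white[OF that] unfolding bform_gram r_def .
  have ur: "u l a = r l a * (xo a / x a)" if "a < n" for l a
    using xo that by (simp add: u r_def)
  have "(\<Sum>l<m. (\<Sum>a<n. u l a * v a)\<^sup>2) = (\<Sum>l<m. (\<Sum>a<n. r l a * (xo a / x a * v a))\<^sup>2)"
    by (intro sum.cong refl arg_cong[of _ _ "\<lambda>z. z\<^sup>2"]) (simp add: ur mult.assoc)
  also have "\<dots> \<le> (\<Sum>a<n. (xo a / x a * v a)\<^sup>2)" by (rule bessel[OF on])
  also have "\<dots> \<le> (\<Sum>a<n. \<kappa> * (v a)\<^sup>2)"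
  proof (intro sum_mono)
    fix a assume a: "a \<in> {..<n}"
    then have "(xo a / x a)\<^sup>2 \<le> \<kappa>" using xo by (simp add: power_divide pos_divide_le_eq)
    then show "(xo a / x a * v a)\<^sup>2 \<le> \<kappa> * (v a)\<^sup>2"
      unfolding power_mult_distrib by (intro mult_right_mono) auto
  qed
  finally show "(\<Sum>l<m. (\<Sum>a<n. u l a * v a)\<^sup>2) \<le> \<kappa> * (\<Sum>a<n. (v a)\<^sup>2)"
    by (simp add: sum_distrib_left)
  show "(\<Sum>a<n. \<Sum>l<m. u l a * u l a) = (\<Sum>l<m. qform {..<m} (gram n A xo) (t l))"
    unfolding qform_gram u by (subst sum.swap) (simp add: power2_eq_square mult_ac)
  have "(\<Sum>l<m. qform {..<m} (gram n A xo) (t l)) \<le> (\<Sum>l<m. \<kappa> * qform {..<m} (gram n A x) (t l))"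
    using xo by (intro sum_mono qform_gram_mono) auto
  also have "\<dots> = \<kappa> * real m"
    by (simp add: white kron_def)
  finally show "(\<Sum>l<m. qform {..<m} (gram n A xo) (t l)) \<le> \<kappa> * real m" .
  have "(\<Sum>i<m. t l i * (\<Sum>a<n. A (i, a) * xo a * v a)) = (\<Sum>a<n. u l a * v a)" for l
    unfolding u sum_distrib_left sum_distrib_right by (subst sum.swap) (simp add: mult_ac)
  then show "(\<Sum>l<m. (\<Sum>i<m. t l i * (\<Sum>a<n. A (i, a) * xo a * v a))\<^sup>2) = (\<Sum>l<m. (\<Sum>a<n. u l a * v a)\<^sup>2)"
    by simp
qed

text \<open>Both forms lie between 0 and \<open>\<kappa>\<close>, so their difference stays within
  \<open>\<kappa>\<close>, and the condition on \<open>s\<close> puts its multiple in the range of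
  \<open>block_qform_mgf\<close>. The trace bounds make the variance term of order m instead of n.
  The parameter \<open>s\<close> stays free, to be balanced against \<open>\<tau>\<close>.\<close>

lemma speckle_qform_tail:
  fixes U U0 :: "nat \<Rightarrow> nat \<Rightarrow> real" and \<sigma> s \<kappa> \<tau> :: real
  assumes \<sigma>: "\<sigma> > 0" and L: "L > 0" and s: "0 < s" "16 * s * \<kappa> \<le> 1" and \<kappa>: "\<kappa> \<ge> 1"
    and U: "\<And>v. (\<Sum>l<m. (\<Sum>a<n. U l a * v a)\<^sup>2) \<le> \<kappa> * (\<Sum>a<n. (v a)\<^sup>2)"
    and U0: "\<And>v. (\<Sum>l<m. (\<Sum>a<n. U0 l a * v a)\<^sup>2) \<le> \<kappa> * (\<Sum>a<n. (v a)\<^sup>2)"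
    and T: "(\<Sum>a<n. \<Sum>l<m. U l a * U l a) = T" "T \<le> \<kappa> * real m"
    and T0: "(\<Sum>a<n. \<Sum>l<m. U0 l a * U0 l a) = T0" "T0 \<le> \<kappa> * real m"
  defines "P \<equiv> PiM ({..<L} \<times> {..<n}) (\<lambda>_. gauss \<sigma>)"
  shows "emeasure P {w \<in> space P.
      (\<Sum>q<L. (\<Sum>l<m. (\<Sum>a<n. U l a * w (q, a))\<^sup>2) - (\<Sum>l<m. (\<Sum>a<n. U0 l a * w (q, a))\<^sup>2)) / (real L * \<sigma>\<^sup>2)
        \<le> T - T0 - \<tau>}
    \<le> ennreal (exp (real L * (16 * s\<^sup>2 * \<kappa>\<^sup>2 * real m - s * \<tau>)))"
proof -
  define B where "B = (\<lambda>a b. \<Sum>l<m. U l a * U l b)"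
  define B0 where "B0 = (\<lambda>a b. \<Sum>l<m. U0 l a * U0 l b)"
  define M where "M a b = 2 * s * (B a b - B0 a b)" for a b
  have qB: "qform {..<n} B v = (\<Sum>l<m. (\<Sum>a<n. U l a * v a)\<^sup>2)"
    and qB0: "qform {..<n} B0 v = (\<Sum>l<m. (\<Sum>a<n. U0 l a * v a)\<^sup>2)" for v
    unfolding B_def B0_def by (rule qform_sum_squares)+
  have B0le: "0 \<le> qform {..<n} B v" "0 \<le> qform {..<n} B0 v" for v
    unfolding qB qB0 by (simp_all add: sum_nonneg)
  have qM: "qform {..<n} M v = 2 * s * (qform {..<n} B v - qform {..<n} B0 v)" for v
    unfolding M_def bform_scale bform_diff ..
  have symB: "symm_on {..<n} B" "symm_on {..<n} B0"
    by (rule symm_onI, simp add: B_def B0_def mult.commute)+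
  have symM: "symm_on {..<n} M"
  proof (rule symm_onI)
    fix a b assume ab: "a \<in> {..<n}" "b \<in> {..<n}"
    show "M a b = M b a" unfolding M_def symm_onD[OF symB(1) ab] symm_onD[OF symB(2) ab] ..
  qed
  have bound: "\<bar>qform {..<n} M v\<bar> \<le> (\<Sum>a<n. (v a)\<^sup>2) / 8" for v
  proof -
    have V: "0 \<le> (\<Sum>a<n. (v a)\<^sup>2)" by (simp add: sum_nonneg)
    have "\<bar>qform {..<n} B v - qform {..<n} B0 v\<bar> \<le> \<kappa> * (\<Sum>a<n. (v a)\<^sup>2)"
      using U[of v] U0[of v] B0le[of v] unfolding qB qB0 by linarith
    then have "2 * s * \<bar>qform {..<n} B v - qform {..<n} B0 v\<bar> \<le> 2 * s * (\<kappa> * (\<Sum>a<n. (v a)\<^sup>2))"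
      using s by (intro mult_left_mono) auto
    also have "\<dots> = (16 * s * \<kappa>) * ((\<Sum>a<n. (v a)\<^sup>2) / 8)" by simp
    also have "\<dots> \<le> 1 * ((\<Sum>a<n. (v a)\<^sup>2) / 8)" using s V by (intro mult_right_mono) auto
    finally show ?thesis unfolding qM using s by (simp add: abs_mult)
  qed
  have tr: "(\<Sum>a<n. M a a) = 2 * s * (T - T0)"
    unfolding M_def B_def B0_def T(1)[symmetric] T0(1)[symmetric] sum_subtractf[symmetric]
    by (subst sum_distrib_left) (rule refl)
  have frB: "(\<Sum>a<n. \<Sum>b<n. (B a b)\<^sup>2) \<le> \<kappa>\<^sup>2 * real m"
  proof -
    have "(\<Sum>a<n. \<Sum>b<n. (B a b)\<^sup>2) \<le> \<kappa> * (\<Sum>a<n. B a a)"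
      using \<kappa> U B0le(1) by (intro frobenius_le_trace symB) (auto simp: qB)
    also have "\<dots> \<le> \<kappa> * (\<kappa> * real m)" using T \<kappa> by (intro mult_left_mono) (auto simp: B_def)
    finally show ?thesis by (simp add: power2_eq_square)
  qed
  have frB0: "(\<Sum>a<n. \<Sum>b<n. (B0 a b)\<^sup>2) \<le> \<kappa>\<^sup>2 * real m"
  proof -
    have "(\<Sum>a<n. \<Sum>b<n. (B0 a b)\<^sup>2) \<le> \<kappa> * (\<Sum>a<n. B0 a a)"
      using \<kappa> U0 B0le(2) by (intro frobenius_le_trace symB) (auto simp: qB0)
    also have "\<dots> \<le> \<kappa> * (\<kappa> * real m)" using T0 \<kappa> by (intro mult_left_mono) (auto simp: B0_def)
    finally show ?thesis by (simp add: power2_eq_square)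
  qed
  have frM: "(\<Sum>a<n. \<Sum>b<n. (M a b)\<^sup>2) \<le> 16 * s\<^sup>2 * \<kappa>\<^sup>2 * real m"
  proof -
    have "(M a b)\<^sup>2 \<le> 8 * s\<^sup>2 * ((B a b)\<^sup>2 + (B0 a b)\<^sup>2)" for a b
    proof -
      have "(B a b - B0 a b)\<^sup>2 + (B a b + B0 a b)\<^sup>2 = 2 * ((B a b)\<^sup>2 + (B0 a b)\<^sup>2)"
        by (simp add: power2_eq_square algebra_simps)
      moreover have "0 \<le> (B a b + B0 a b)\<^sup>2" by simp
      ultimately have "(B a b - B0 a b)\<^sup>2 \<le> 2 * ((B a b)\<^sup>2 + (B0 a b)\<^sup>2)" by linarith
      then have "4 * s\<^sup>2 * (B a b - B0 a b)\<^sup>2 \<le> 4 * s\<^sup>2 * (2 * ((B a b)\<^sup>2 + (B0 a b)\<^sup>2))"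
        by (intro mult_left_mono) auto
      moreover have "(M a b)\<^sup>2 = 4 * s\<^sup>2 * (B a b - B0 a b)\<^sup>2" by (simp add: M_def power_mult_distrib)
      moreover have "4 * s\<^sup>2 * (2 * X) = 8 * s\<^sup>2 * X" for X by simp
      ultimately show ?thesis by (simp only:)
    qed
    then have "(\<Sum>a<n. \<Sum>b<n. (M a b)\<^sup>2) \<le> (\<Sum>a<n. \<Sum>b<n. 8 * s\<^sup>2 * ((B a b)\<^sup>2 + (B0 a b)\<^sup>2))"
      by (intro sum_mono)
    also have "\<dots> = 8 * s\<^sup>2 * ((\<Sum>a<n. \<Sum>b<n. (B a b)\<^sup>2) + (\<Sum>a<n. \<Sum>b<n. (B0 a b)\<^sup>2))"
      by (simp only: sum.distrib sum_distrib_left[symmetric])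
    also have "\<dots> \<le> 8 * s\<^sup>2 * (\<kappa>\<^sup>2 * real m + \<kappa>\<^sup>2 * real m)"
      using frB frB0 by (intro mult_left_mono add_mono) auto
    finally show ?thesis by (simp add: mult_ac)
  qed
  define Z where "Z w = (\<Sum>q<L. (\<Sum>l<m. (\<Sum>a<n. U l a * w (q, a))\<^sup>2) - (\<Sum>l<m. (\<Sum>a<n. U0 l a * w (q, a))\<^sup>2))"
    for w :: "nat \<times> nat \<Rightarrow> real"
  have meas: "(\<lambda>w. - (s / \<sigma>\<^sup>2) * Z w) \<in> borel_measurable P" unfolding Z_def P_def by measurable
  have "- (\<Sum>q<L. qform {..<n} M (\<lambda>a. w (q, a))) / (2 * \<sigma>\<^sup>2) = - (s / \<sigma>\<^sup>2) * Z w" for w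
    unfolding qM qB qB0 sum_distrib_left[symmetric] Z_def using \<sigma> by simp
  then have "(\<integral>\<^sup>+ w. ennreal (exp (- (s / \<sigma>\<^sup>2) * Z w)) \<partial>P)
      = (\<integral>\<^sup>+ w. ennreal (exp (- (\<Sum>q<L. qform {..<n} M (\<lambda>a. w (q, a))) / (2 * \<sigma>\<^sup>2))) \<partial>P)"
    by (simp only:)
  also have "\<dots> \<le> ennreal (exp (real (card {..<L}) * (- (\<Sum>i<n. M i i) / 2 + (\<Sum>i<n. \<Sum>j<n. (M i j)\<^sup>2))))"
    unfolding P_def by (rule block_qform_mgf[OF _ _ \<sigma> symM bound]) auto
  also have "\<dots> \<le> ennreal (exp (real L * (- s * (T - T0) + 16 * s\<^sup>2 * \<kappa>\<^sup>2 * real m)))"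
  proof (intro ennreal_leI, unfold exp_le_cancel_iff card_lessThan, intro mult_left_mono)
    show "- (\<Sum>i<n. M i i) / 2 + (\<Sum>i<n. \<Sum>j<n. (M i j)\<^sup>2) \<le> - s * (T - T0) + 16 * s\<^sup>2 * \<kappa>\<^sup>2 * real m"
      unfolding tr using frM by simp
  qed simp
  finally have "emeasure P {w \<in> space P. - s * real L * (T - T0 - \<tau>) \<le> - (s / \<sigma>\<^sup>2) * Z w}
      \<le> ennreal (exp (real L * (- s * (T - T0) + 16 * s\<^sup>2 * \<kappa>\<^sup>2 * real m) - (- s * real L * (T - T0 - \<tau>))))"
    by (rule emeasure_exp_Markov[OF meas])
  also have "real L * (- s * (T - T0) + 16 * s\<^sup>2 * \<kappa>\<^sup>2 * real m) - (- s * real L * (T - T0 - \<tau>))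
      = real L * (16 * s\<^sup>2 * \<kappa>\<^sup>2 * real m - s * \<tau>)"
    by (simp add: algebra_simps)
  also have "{w \<in> space P. - s * real L * (T - T0 - \<tau>) \<le> - (s / \<sigma>\<^sup>2) * Z w}
      = {w \<in> space P. Z w / (real L * \<sigma>\<^sup>2) \<le> T - T0 - \<tau>}"
  proof -
    have "- s * real L * c \<le> - (s / \<sigma>\<^sup>2) * z \<longleftrightarrow> z / (real L * \<sigma>\<^sup>2) \<le> c" for c z
    proof -
      have "- s * real L * c \<le> - (s / \<sigma>\<^sup>2) * z \<longleftrightarrow> s * (z / \<sigma>\<^sup>2) \<le> s * (real L * c)" by (simp add: mult_ac)
      also have "\<dots> \<longleftrightarrow> z / \<sigma>\<^sup>2 \<le> real L * c" using s by (simp only: mult_le_cancel_left_pos)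
      also have "\<dots> \<longleftrightarrow> z / \<sigma>\<^sup>2 / real L \<le> c" using L by (simp only: pos_divide_le_eq[of "real L"] of_nat_0_less_iff mult.commute)
      finally show ?thesis by (simp add: mult.commute)
    qed
    then show ?thesis by simp
  qed
  finally show ?thesis unfolding Z_def .
qed

definition obs_entry :: "nat \<Rightarrow> (nat \<Rightarrow> real) \<Rightarrow> outcome \<Rightarrow> nat \<Rightarrow> nat \<Rightarrow> real" where
  "obs_entry n xo \<omega> q i = (\<Sum>a<n. fst \<omega> (i, a) * xo a * snd \<omega> (q, a))"

text \<open>
  Minus the centred difference of the data terms of the likelihood at \<open>x\<close> and at \<open>xo\<close>; given a
  nonsingular sensing matrix, the mean of that difference is the first line.
\<close>

definition gap_deviation :: "nat \<Rightarrow> nat \<Rightarrow> nat \<Rightarrow> real \<Rightarrow> (nat \<Rightarrow> real) \<Rightarrow> (nat \<Rightarrow> real) \<Rightarrow> outcome \<Rightarrow> real" where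
  "gap_deviation m n L \<sigma> xo x \<omega> =
     (\<Sum>i<m. \<Sum>j<m. inv_entry m (gram n (fst \<omega>) x) i j * gram n (fst \<omega>) xo i j) - real m
     - (\<Sum>q<L. qform {..<m} (inv_entry m (gram n (fst \<omega>) x)) (obs_entry n xo \<omega> q)
          - qform {..<m} (inv_entry m (gram n (fst \<omega>) xo)) (obs_entry n xo \<omega> q)) / (real L * \<sigma>\<^sup>2)"

section \<open>Measurability of the deviation\<close>

lemma space_speckle: "space (speckle_space m n L \<sigma>)
    = space (PiM ({..<m} \<times> {..<n}) (\<lambda>_. gauss 1)) \<times> space (PiM ({..<L} \<times> {..<n}) (\<lambda>_. gauss \<sigma>))"
  by (simp add: speckle_space_def space_pair_measure)

lemma measurable_sensing_entry:
  "i < m \<Longrightarrow> a < n \<Longrightarrow> (\<lambda>\<omega>. fst \<omega> (i, a)) \<in> borel_measurable (speckle_space m n L \<sigma>)"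
  unfolding speckle_space_def
  using measurable_compose[OF measurable_fst measurable_component_singleton[of "(i, a)" "{..<m} \<times> {..<n}" "\<lambda>_. gauss 1"]]
  by simp

lemma measurable_speckle_entry:
  "q < L \<Longrightarrow> a < n \<Longrightarrow> (\<lambda>\<omega>. snd \<omega> (q, a)) \<in> borel_measurable (speckle_space m n L \<sigma>)"
  unfolding speckle_space_def
  using measurable_compose[OF measurable_snd measurable_component_singleton[of "(q, a)" "{..<L} \<times> {..<n}" "\<lambda>_. gauss \<sigma>"]]
  by simp

lemma measurable_gram:
  "i < m \<Longrightarrow> j < m \<Longrightarrow> (\<lambda>\<omega>. gram n (fst \<omega>) x i j) \<in> borel_measurable (speckle_space m n L \<sigma>)"
  unfolding gram_def
  by (intro borel_measurable_sum borel_measurable_times borel_measurable_const measurable_sensing_entry) auto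

lemma measurable_inv_entry:
  "i < m \<Longrightarrow> j < m \<Longrightarrow> (\<lambda>\<omega>. inv_entry m (gram n (fst \<omega>) x) i j) \<in> borel_measurable (speckle_space m n L \<sigma>)"
  unfolding inv_entry_def
  by (intro borel_measurable_divide borel_measurable_cofactor_mat_of borel_measurable_det_mat_of measurable_gram) auto

lemma measurable_obs_entry:
  "i < m \<Longrightarrow> q < L \<Longrightarrow> (\<lambda>\<omega>. obs_entry n xo \<omega> q i) \<in> borel_measurable (speckle_space m n L \<sigma>)"
  unfolding obs_entry_def
  by (intro borel_measurable_sum borel_measurable_times borel_measurable_const
      measurable_sensing_entry measurable_speckle_entry) auto

lemma measurable_gap_deviation:
  "gap_deviation m n L \<sigma> xo x \<in> borel_measurable (speckle_space m n L \<sigma>)"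
  unfolding gap_deviation_def[abs_def] bform_def
  by (intro borel_measurable_diff borel_measurable_divide borel_measurable_const borel_measurable_sum
      borel_measurable_times measurable_inv_entry measurable_gram measurable_obs_entry) auto

lemma measurable_sensing_det:
  "m \<le> n \<Longrightarrow> (\<lambda>\<omega>. det (mat_of m (\<lambda>i k. fst \<omega> (i, k)))) \<in> borel_measurable (speckle_space m n L \<sigma>)"
  by (intro borel_measurable_det_mat_of measurable_sensing_entry) auto

text \<open>Conditioning on \<open>A\<close> by Fubini. For nonsingular \<open>A\<close> the
  deviation is the centred difference of two quadratic forms in the speckle, and the one belonging
  to \<open>xo\<close> has trace exactly \<open>m\<close>; for singular \<open>A\<close> the section
  of the event is empty.\<close>

lemma gap_deviation_tail:
  fixes x xo :: "nat \<Rightarrow> real"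
  assumes xm: "0 < x_min" and x: "\<And>a. a < n \<Longrightarrow> x_min \<le> x a \<and> x a \<le> x_max"
    and xo: "\<And>a. a < n \<Longrightarrow> x_min \<le> xo a \<and> xo a \<le> x_max"
    and mn: "m \<le> n" "n > 0" and \<sigma>: "\<sigma> > 0" and L: "L > 0"
    and s: "0 < s" "16 * s * (x_max / x_min)\<^sup>2 \<le> 1"
  defines "P \<equiv> speckle_space m n L \<sigma>"
  shows "emeasure P {\<omega> \<in> space P. det (mat_of m (\<lambda>i k. fst \<omega> (i, k))) \<noteq> 0 \<and> \<tau> \<le> gap_deviation m n L \<sigma> xo x \<omega>}
    \<le> ennreal (exp (real L * (16 * s\<^sup>2 * ((x_max / x_min)\<^sup>2)\<^sup>2 * real m - s * \<tau>)))"
proof -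
  define \<kappa> where "\<kappa> = (x_max / x_min)\<^sup>2"
  have xM: "x_min \<le> x_max" using x[of 0] mn by auto
  then have \<kappa>: "\<kappa> \<ge> 1" using xm by (simp add: \<kappa>_def)
  have nz: "x a \<noteq> 0" "xo a \<noteq> 0" if "a < n" for a using x[OF that] xo[OF that] xm by auto
  have r: "(xo a)\<^sup>2 \<le> \<kappa> * (x a)\<^sup>2" "(xo a)\<^sup>2 \<le> \<kappa> * (xo a)\<^sup>2" if "a < n" for a
    unfolding \<kappa>_def using x[OF that] xo[OF that] xm by (auto intro!: pointwise_ratio)
  let ?PA = "PiM ({..<m} \<times> {..<n}) (\<lambda>_. gauss 1)"
  let ?PW = "PiM ({..<L} \<times> {..<n}) (\<lambda>_. gauss \<sigma>)"
  interpret PA: prob_space ?PA by (rule prob_space_PiM_gauss) simp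
  interpret PW: prob_space ?PW by (rule prob_space_PiM_gauss[OF \<sigma>])
  define E where "E = {\<omega> \<in> space P. det (mat_of m (\<lambda>i k. fst \<omega> (i, k))) \<noteq> 0 \<and> \<tau> \<le> gap_deviation m n L \<sigma> xo x \<omega>}"
  define e where "e = exp (real L * (16 * s\<^sup>2 * \<kappa>\<^sup>2 * real m - s * \<tau>))"
  have [measurable]: "(\<lambda>\<omega>. det (mat_of m (\<lambda>i k. fst \<omega> (i, k)))) \<in> borel_measurable P"
    "gap_deviation m n L \<sigma> xo x \<in> borel_measurable P"
    unfolding P_def using mn by (auto intro: measurable_sensing_det measurable_gap_deviation)
  have Em: "E \<in> sets P" unfolding E_def by measurable
  have Ppair: "P = ?PA \<Otimes>\<^sub>M ?PW" by (simp add: P_def speckle_space_def)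
  have "emeasure P E = (\<integral>\<^sup>+ A. emeasure ?PW (Pair A -` E) \<partial>?PA)"
    unfolding Ppair using Em Ppair by (intro PW.emeasure_pair_measure_alt) simp
  also have "\<dots> \<le> (\<integral>\<^sup>+ A. ennreal e \<partial>?PA)"
  proof (rule nn_integral_mono)
    fix A
    show "emeasure ?PW (Pair A -` E) \<le> ennreal e"
    proof (cases "det (mat_of m (\<lambda>i k. A (i, k))) = 0")
      case True
      then have "Pair A -` E = {}" by (auto simp: E_def)
      then show ?thesis by simp
    next
      case False
      have pd: "pos_def_on {..<m} (gram n A x)" "pos_def_on {..<m} (gram n A xo)"
        using nz mn False by (auto intro!: pos_def_on_gram)
      obtain t t0 where t: "whitening m (gram n A x) t" and t0: "whitening m (gram n A xo) t0"
        using pos_def_on_whitening pd by blast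
      interpret W: whitening m "gram n A x" t by (rule t)
      interpret W0: whitening m "gram n A xo" t0 by (rule t0)
      define U where "U l a = (\<Sum>i<m. t l i * A (i, a)) * xo a" for l a
      define U0 where "U0 l a = (\<Sum>i<m. t0 l i * A (i, a)) * xo a" for l a
      have cx: "\<forall>a<n. x a \<noteq> 0 \<and> (xo a)\<^sup>2 \<le> \<kappa> * (x a)\<^sup>2"
        and cxo: "\<forall>a<n. xo a \<noteq> 0 \<and> (xo a)\<^sup>2 \<le> \<kappa> * (xo a)\<^sup>2"
        using nz r by auto
      note U = speckle_projection[where \<kappa> = \<kappa> and xo = xo, OF t cx U_def]
      note U0 = speckle_projection[where \<kappa> = \<kappa> and xo = xo, OF t0 cxo U0_def]
      define T where "T = (\<Sum>l<m. qform {..<m} (gram n A xo) (t l))"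
      have T0: "(\<Sum>l<m. qform {..<m} (gram n A xo) (t0 l)) = real m"
        by (simp add: W0.white kron_def)
      have ob: "obs_entry n xo (A, w) q i = (\<Sum>a<n. A (i, a) * xo a * w (q, a))" for w q i
        by (simp add: obs_entry_def)
      have obU: "(\<Sum>l<m. (\<Sum>i<m. t l i * obs_entry n xo (A, w) q i)\<^sup>2) = (\<Sum>l<m. (\<Sum>a<n. U l a * w (q, a))\<^sup>2)"
        and obU0: "(\<Sum>l<m. (\<Sum>i<m. t0 l i * obs_entry n xo (A, w) q i)\<^sup>2) = (\<Sum>l<m. (\<Sum>a<n. U0 l a * w (q, a))\<^sup>2)"
        for w q
        unfolding ob by - (rule U(4), rule U0(4))
      have dev: "gap_deviation m n L \<sigma> xo x (A, w) = T - real m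
          - (\<Sum>q<L. (\<Sum>l<m. (\<Sum>a<n. U l a * w (q, a))\<^sup>2) - (\<Sum>l<m. (\<Sum>a<n. U0 l a * w (q, a))\<^sup>2))
              / (real L * \<sigma>\<^sup>2)" for w
        unfolding gap_deviation_def fst_conv W.trace_inv_entry[OF W.det_pos[THEN less_imp_neq, symmetric]]
          W.qform_inv_entry[OF W.det_pos[THEN less_imp_neq, symmetric]] W0.qform_inv_entry[OF W0.det_pos[THEN less_imp_neq, symmetric]] obU obU0 T_def ..
      have "Pair A -` E \<subseteq> {w \<in> space ?PW. (\<Sum>q<L. (\<Sum>l<m. (\<Sum>a<n. U l a * w (q, a))\<^sup>2)
          - (\<Sum>l<m. (\<Sum>a<n. U0 l a * w (q, a))\<^sup>2)) / (real L * \<sigma>\<^sup>2) \<le> T - real m - \<tau>}" (is "_ \<subseteq> ?F")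
      proof
        fix w assume "w \<in> Pair A -` E"
        then have "w \<in> space ?PW" "\<tau> \<le> gap_deviation m n L \<sigma> xo x (A, w)"
          by (auto simp: E_def P_def space_speckle)
        then show "w \<in> ?F" unfolding dev by simp
      qed
      then have "emeasure ?PW (Pair A -` E) \<le> emeasure ?PW ?F"
        by (rule emeasure_mono) measurable
      also have "\<dots> \<le> ennreal e"
        unfolding e_def
        by (rule speckle_qform_tail[OF \<sigma> L s(1) s(2)[folded \<kappa>_def] \<kappa> U(1) U0(1)
              U(2)[folded T_def] U(3)[folded T_def] U0(2)[unfolded T0] U0(3)[unfolded T0]])
      finally show ?thesis .
    qed
  qed
  also have "\<dots> = ennreal e" by (simp add: PA.emeasure_space_1)
  finally show ?thesis by (simp add: E_def e_def \<kappa>_def)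
qed

section \<open>The likelihood in coordinates\<close>

definition quad_misfit :: "nat \<Rightarrow> nat \<Rightarrow> nat \<Rightarrow> (nat \<Rightarrow> real) \<Rightarrow> (nat \<Rightarrow> real) \<Rightarrow> outcome \<Rightarrow> real" where
  "quad_misfit m n L xo x \<omega> = (\<Sum>q<L. qform {..<m} (inv_entry m (gram n (fst \<omega>) x)) (obs_entry n xo \<omega> q))"

lemma observation_entry:
  assumes "xo \<in> carrier_vec n"
  shows "observation m n xo \<omega> q \<in> carrier_vec m"
    and "i < m \<Longrightarrow> observation m n xo \<omega> q $ i = obs_entry n (\<lambda>a. xo $ a) \<omega> q i"
proof -
  have d: "dim_vec xo = n" using assms by auto
  have e: "sensing_mat m n \<omega> * diag_of xo = Matrix.mat m n (\<lambda>(i, a). fst \<omega> (i, a) * xo $ a)"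
    unfolding diag_of_def d by (subst mat_diag_mult_right[of _ m n]) (auto simp: sensing_mat_def)
  show "observation m n xo \<omega> q \<in> carrier_vec m"
    unfolding observation_def e by (simp add: carrier_vecI)
  show "observation m n xo \<omega> q $ i = obs_entry n (\<lambda>a. xo $ a) \<omega> q i" if "i < m"
    unfolding observation_def e using that
    by (simp add: obs_entry_def speckle_def scalar_prod_def lessThan_atLeast0)
qed

lemma cov_mat_eq:
  assumes "x \<in> carrier_vec n"
  shows "cov_mat \<sigma> (sensing_mat m n \<omega>) x = mat_of m (\<lambda>i j. \<sigma>\<^sup>2 * gram n (fst \<omega>) (\<lambda>a. x $ a) i j)"
proof -
  have d: "dim_vec x = n" using assms by auto
  have e: "sensing_mat m n \<omega> * (diag_of x * diag_of x) = Matrix.mat m n (\<lambda>(i, a). fst \<omega> (i, a) * (x $ a * x $ a))"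
    unfolding diag_of_def d mat_diag_diag by (subst mat_diag_mult_right[of _ m n]) (auto simp: sensing_mat_def)
  show ?thesis
    unfolding cov_mat_def e
    by (rule eq_matI)
       (auto simp: sensing_mat_def mat_of_def gram_def scalar_prod_def lessThan_atLeast0 power2_eq_square mult_ac
         intro!: sum.cong)
qed

text \<open>Dividing whitening vectors by \<open>\<sigma>\<close> whitens the covariance. The first
  summand is the same for all signals and cancels when likelihoods are compared.\<close>

lemma neg_log_lik_eq:
  assumes x: "x \<in> carrier_vec n" and xo: "xo \<in> carrier_vec n" and \<sigma>: "\<sigma> > 0"
    and pd: "pos_def_on {..<m} (gram n (fst \<omega>) (\<lambda>a. x $ a))"
  shows "neg_log_lik \<sigma> L (sensing_mat m n \<omega>) (observation m n xo \<omega>) x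
    = real m * ln (\<sigma>\<^sup>2) + ln (det (mat_of m (gram n (fst \<omega>) (\<lambda>a. x $ a))))
      + quad_misfit m n L (\<lambda>a. xo $ a) (\<lambda>a. x $ a) \<omega> / (real L * \<sigma>\<^sup>2)"
proof -
  let ?S = "gram n (fst \<omega>) (\<lambda>a. x $ a)"
  obtain t where "whitening m ?S t" using pos_def_on_whitening[OF pd] by blast
  then interpret W: whitening m ?S t .
  interpret Ws: whitening m "\<lambda>i j. \<sigma>\<^sup>2 * ?S i j" "\<lambda>i a. 1 / \<sigma> * t i a"
  proof
    show "symm_on {..<m} (\<lambda>i j. \<sigma>\<^sup>2 * ?S i j)"
      by (rule symm_onI) (simp add: symm_onD[OF symm_on_gram[of UNIV]])
    fix i j assume ij: "i < m" "j < m"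
    have "bform {..<m} (\<lambda>i j. \<sigma>\<^sup>2 * ?S i j) (\<lambda>a. 1 / \<sigma> * t i a) (\<lambda>a. 1 / \<sigma> * t j a)
        = bform {..<m} ?S (t i) (t j)"
      unfolding bform_def by (intro sum.cong refl) (use \<sigma> in \<open>simp add: power2_eq_square\<close>)
    then show "bform {..<m} (\<lambda>i j. \<sigma>\<^sup>2 * ?S i j) (\<lambda>a. 1 / \<sigma> * t i a) (\<lambda>a. 1 / \<sigma> * t j a) = kron i j"
      using W.white[OF ij] by simp
  qed
  have "mat_of m (\<lambda>i j. \<sigma>\<^sup>2 * ?S i j) = \<sigma>\<^sup>2 \<cdot>\<^sub>m mat_of m ?S"
    by (rule eq_matI) (auto simp: mat_of_def)
  then have "det (mat_of m (\<lambda>i j. \<sigma>\<^sup>2 * ?S i j)) = (\<sigma>\<^sup>2) ^ m * det (mat_of m ?S)"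
    by (simp add: mat_of_def)
  then have ln_det: "ln (det (mat_of m (\<lambda>i j. \<sigma>\<^sup>2 * ?S i j))) = real m * ln (\<sigma>\<^sup>2) + ln (det (mat_of m ?S))"
    using W.det_pos \<sigma> by (simp add: ln_mult ln_realpow)
  have "observation m n xo \<omega> q \<bullet> (the (mat_inverse (mat_of m (\<lambda>i j. \<sigma>\<^sup>2 * ?S i j))) *\<^sub>v observation m n xo \<omega> q)
     = qform {..<m} (inv_entry m ?S) (obs_entry n (\<lambda>a. xo $ a) \<omega> q) / \<sigma>\<^sup>2" for q
  proof -
    let ?y = "obs_entry n (\<lambda>a. xo $ a) \<omega> q"
    have "observation m n xo \<omega> q \<bullet> (the (mat_inverse (mat_of m (\<lambda>i j. \<sigma>\<^sup>2 * ?S i j))) *\<^sub>v observation m n xo \<omega> q)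
      = (\<Sum>i<m. (\<Sum>a<m. 1 / \<sigma> * t i a * observation m n xo \<omega> q $ a)\<^sup>2)"
      by (rule Ws.inverse_qform) (rule observation_entry(1)[OF xo])
    also have "\<dots> = (\<Sum>i<m. (1 / \<sigma> * (\<Sum>a<m. t i a * ?y a))\<^sup>2)"
      unfolding sum_distrib_left
      by (intro sum.cong refl arg_cong[of _ _ "\<lambda>z. z\<^sup>2"]) (simp add: observation_entry(2)[OF xo])
    also have "\<dots> = (\<Sum>i<m. (\<Sum>a<m. t i a * ?y a)\<^sup>2) / \<sigma>\<^sup>2"
    proof -
      have "(1 / \<sigma> * X)\<^sup>2 = X\<^sup>2 / \<sigma>\<^sup>2" for X by (simp add: power_mult_distrib power_divide)
      then show ?thesis by (simp only: sum_divide_distrib)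
    qed
    also have "(\<Sum>i<m. (\<Sum>a<m. t i a * ?y a)\<^sup>2) = qform {..<m} (inv_entry m ?S) ?y"
      using W.qform_inv_entry W.det_pos by simp
    finally show ?thesis .
  qed
  then show ?thesis
    unfolding neg_log_lik_def cov_mat_eq[OF x] ln_det quad_misfit_def
    by (simp add: sum_divide_distrib mult.commute)
qed

lemma quad_misfit_bounds:
  assumes "whitening m (gram n (fst \<omega>) x) t" "\<forall>a<n. x a \<noteq> 0 \<and> (xo a)\<^sup>2 \<le> \<kappa> * (x a)\<^sup>2"
  shows "quad_misfit m n L xo x \<omega> = (\<Sum>q<L. \<Sum>l<m. (\<Sum>i<m. t l i * obs_entry n xo \<omega> q i)\<^sup>2)"
    and "quad_misfit m n L xo x \<omega> \<le> \<kappa> * (\<Sum>q<L. \<Sum>a<n. (snd \<omega> (q, a))\<^sup>2)"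
    and "0 \<le> quad_misfit m n L xo x \<omega>"
proof -
  interpret whitening m "gram n (fst \<omega>) x" t by fact
  define U where "U l a = (\<Sum>i<m. t l i * fst \<omega> (i, a)) * xo a" for l a
  note U = speckle_projection[OF assms U_def]
  show eq: "quad_misfit m n L xo x \<omega> = (\<Sum>q<L. \<Sum>l<m. (\<Sum>i<m. t l i * obs_entry n xo \<omega> q i)\<^sup>2)"
    unfolding quad_misfit_def using qform_inv_entry det_pos by simp
  have "quad_misfit m n L xo x \<omega> = (\<Sum>q<L. \<Sum>l<m. (\<Sum>a<n. U l a * snd \<omega> (q, a))\<^sup>2)"
    unfolding eq obs_entry_def U(4) ..
  also have "\<dots> \<le> (\<Sum>q<L. \<kappa> * (\<Sum>a<n. (snd \<omega> (q, a))\<^sup>2))" by (intro sum_mono U(1))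
  finally show "quad_misfit m n L xo x \<omega> \<le> \<kappa> * (\<Sum>q<L. \<Sum>a<n. (snd \<omega> (q, a))\<^sup>2)"
    by (simp only: sum_distrib_left[of \<kappa>])
  show "0 \<le> quad_misfit m n L xo x \<omega>" unfolding eq by (intro sum_nonneg) auto
qed

text \<open>In the application \<open>x\<close> is the minimiser and \<open>x'\<close> a net point.
  The two Gram matrices agree up to 1 + \<delta> in the Loewner order, so each whitened diagonal
  entry exceeds 1 by at most \<delta>, and the data terms are comparable by
  \<open>inverse_qform_antimono\<close>.\<close>

lemma discretisation_error:
  fixes x x' xo :: "nat \<Rightarrow> real"
  assumes pd: "pos_def_on {..<m} (gram n (fst \<omega>) x)" "pos_def_on {..<m} (gram n (fst \<omega>) x')"
    and r: "\<And>a. a < n \<Longrightarrow> (x a)\<^sup>2 \<le> (1 + \<delta>) * (x' a)\<^sup>2" "\<And>a. a < n \<Longrightarrow> (x' a)\<^sup>2 \<le> (1 + \<delta>) * (x a)\<^sup>2"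
    and \<delta>: "\<delta> \<ge> 0" and xo: "\<forall>a<n. x' a \<noteq> 0 \<and> (xo a)\<^sup>2 \<le> \<kappa> * (x' a)\<^sup>2"
  shows "ln (det (mat_of m (gram n (fst \<omega>) x'))) \<le> ln (det (mat_of m (gram n (fst \<omega>) x))) + real m * \<delta>"
    and "quad_misfit m n L xo x' \<omega> \<le> quad_misfit m n L xo x \<omega> + \<delta> * \<kappa> * (\<Sum>q<L. \<Sum>a<n. (snd \<omega> (q, a))\<^sup>2)"
proof -
  let ?S = "gram n (fst \<omega>) x" and ?S' = "gram n (fst \<omega>) x'"
  obtain t where t: "whitening m ?S t" using pos_def_on_whitening[OF pd(1)] by blast
  obtain t' where t': "whitening m ?S' t'" using pos_def_on_whitening[OF pd(2)] by blast
  interpret W: whitening m ?S t by (rule t)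
  interpret W': whitening m ?S' t' by (rule t')
  have "ln (det (mat_of m ?S')) - ln (det (mat_of m ?S)) \<le> (\<Sum>i<m. qform {..<m} ?S' (t i) - 1)
      - (\<Sum>i<m. \<Sum>j<m. (bform {..<m} ?S' (t i) (t j) - kron i j)\<^sup>2) / (4 * (1 + \<delta>))"
    using \<delta> by (intro gram_log_det_le[OF t pd(2)] r) auto
  moreover have "(\<Sum>i<m. qform {..<m} ?S' (t i) - 1) \<le> (\<Sum>i<m. \<delta>)"
  proof (rule sum_mono)
    fix i assume i: "i \<in> {..<m}"
    have "qform {..<m} ?S' (t i) \<le> (1 + \<delta>) * qform {..<m} ?S (t i)" by (rule qform_gram_mono[OF r(2)])
    then show "qform {..<m} ?S' (t i) - 1 \<le> \<delta>" using i by (simp add: W.white kron_def)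
  qed
  moreover have "0 \<le> (\<Sum>i<m. \<Sum>j<m. (bform {..<m} ?S' (t i) (t j) - kron i j)\<^sup>2) / (4 * (1 + \<delta>))"
    using \<delta> by (intro divide_nonneg_nonneg sum_nonneg) auto
  moreover have "(\<Sum>i<m. \<delta>) = real m * \<delta>" by simp
  ultimately show "ln (det (mat_of m ?S')) \<le> ln (det (mat_of m ?S)) + real m * \<delta>" by linarith
  define Q where "Q = (\<Sum>q<L. \<Sum>l<m. (\<Sum>i<m. t l i * obs_entry n xo \<omega> q i)\<^sup>2)"
  define Q' where "Q' = (\<Sum>q<L. \<Sum>l<m. (\<Sum>i<m. t' l i * obs_entry n xo \<omega> q i)\<^sup>2)"
  have Q: "quad_misfit m n L xo x \<omega> = Q"
    unfolding quad_misfit_def Q_def using W.qform_inv_entry W.det_pos by simp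
  have Q': "quad_misfit m n L xo x' \<omega> = Q'"
    unfolding Q'_def by (rule quad_misfit_bounds(1)[OF t' xo])
  have Q0: "Q' \<ge> 0" unfolding Q'_def by (intro sum_nonneg) auto
  have "Q' \<le> (\<Sum>q<L. (1 + \<delta>) * (\<Sum>l<m. (\<Sum>i<m. t l i * obs_entry n xo \<omega> q i)\<^sup>2))"
    unfolding Q'_def
    using \<delta> by (intro sum_mono inverse_qform_antimono[OF t t'] qform_gram_nonneg qform_gram_mono r(1)) auto
  also have "\<dots> = (1 + \<delta>) * Q" unfolding Q_def by (simp only: sum_distrib_left[of "1 + \<delta>"])
  finally have QQ: "Q' \<le> (1 + \<delta>) * Q" .
  \<comment> \<open>The relative error is moved from \<open>Q\<close> to \<open>Q'\<close>, because
    the bound by the speckle energy is available for \<open>x'\<close>.\<close>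
  have "Q' \<le> Q + \<delta> * Q'"
  proof (cases "Q \<le> Q'")
    case True
    then have "\<delta> * Q \<le> \<delta> * Q'" using \<delta> by (intro mult_left_mono)
    then show ?thesis using QQ by (simp add: algebra_simps)
  next
    case False
    moreover have "0 \<le> \<delta> * Q'" using \<delta> Q0 by simp
    ultimately show ?thesis by linarith
  qed
  also have "\<delta> * Q' \<le> \<delta> * (\<kappa> * (\<Sum>q<L. \<Sum>a<n. (snd \<omega> (q, a))\<^sup>2))"
    unfolding Q'[symmetric] using \<delta> by (intro mult_left_mono quad_misfit_bounds(2)[OF t' xo])
  finally show "quad_misfit m n L xo x' \<omega> \<le> quad_misfit m n L xo x \<omega> + \<delta> * \<kappa> * (\<Sum>q<L. \<Sum>a<n. (snd \<omega> (q, a))\<^sup>2)"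
    unfolding Q Q' by (simp add: mult.assoc)
qed

section \<open>The net of parameters\<close>

lemma l2_norm_sq: "(l2_norm v)\<^sup>2 = (\<Sum>i<dim_vec v. (v $ i)\<^sup>2)"
  by (simp add: l2_norm_def scalar_prod_def lessThan_atLeast0 power2_eq_square sum_nonneg)

lemma l2_norm_nonneg: "l2_norm v \<ge> 0"
  by (simp add: l2_norm_def scalar_prod_def sum_nonneg)

text \<open>The grid of spacing 1 / N, with rounding downwards. The net lies inside the cube, so
  that the Lipschitz condition applies to its points and their images belong to the signal
  class.\<close>

lemma param_cube_net:
  assumes N: "N > (0::nat)"
  shows "\<exists>G\<subseteq>param_cube k. finite G \<and> card G \<le> (2 * N + 1) ^ k \<and>
    (\<forall>\<theta>\<in>param_cube k. \<exists>\<theta>'\<in>G. l2_norm (\<theta> - \<theta>') \<le> sqrt (real k) / real N)"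
proof -
  let ?box = "PiE {..<k} (\<lambda>_. {- int N..int N})"
  define f where "f p = Matrix.vec k (\<lambda>i. real_of_int (p i) / real N)" for p :: "nat \<Rightarrow> int"
  have fin: "finite ?box" by (intro finite_PiE) auto
  have "card (f ` ?box) \<le> card ?box" by (rule card_image_le[OF fin])
  also have "card ?box = (2 * N + 1) ^ k" by (simp add: card_PiE nat_add_distrib nat_mult_distrib)
  finally have card: "card (f ` ?box) \<le> (2 * N + 1) ^ k" .
  have sub: "f ` ?box \<subseteq> param_cube k"
  proof
    fix \<theta> assume "\<theta> \<in> f ` ?box"
    then obtain p where p: "p \<in> ?box" "\<theta> = f p" by blast
    have "real_of_int (p i) / real N \<in> {- 1..1}" if "i < k" for i
    proof -
      have "p i \<in> {- int N..int N}" using p(1) that by blast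
      then have "- real N \<le> real_of_int (p i)" "real_of_int (p i) \<le> real N" by auto
      then show ?thesis using N by (simp add: field_simps)
    qed
    then show "\<theta> \<in> param_cube k" by (auto simp: p(2) f_def param_cube_def)
  qed
  have "\<exists>\<theta>'\<in>f ` ?box. l2_norm (\<theta> - \<theta>') \<le> sqrt (real k) / real N" if \<theta>: "\<theta> \<in> param_cube k" for \<theta>
  proof
    define p where "p = (\<lambda>i\<in>{..<k}. \<lfloor>\<theta> $ i * real N\<rfloor>)"
    have \<theta>i: "- 1 \<le> \<theta> $ i" "\<theta> $ i \<le> 1" if "i < k" for i using \<theta> that by (auto simp: param_cube_def)
    have "\<lfloor>\<theta> $ i * real N\<rfloor> \<in> {- int N..int N}" if "i < k" for i
    proof -
      have "- 1 * real N \<le> \<theta> $ i * real N" "\<theta> $ i * real N \<le> 1 * real N"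
        using \<theta>i[OF that] by (intro mult_right_mono; simp)+
      then have "of_int (- int N) \<le> \<theta> $ i * real N" "\<theta> $ i * real N \<le> of_int (int N)" by simp_all
      then show ?thesis by (auto simp: le_floor_iff floor_le_iff)
    qed
    then have pbox: "p \<in> ?box" by (auto simp: p_def)
    then show "f p \<in> f ` ?box" by blast
    have dim: "dim_vec (\<theta> - f p) = k" by (simp add: f_def)
    have "(l2_norm (\<theta> - f p))\<^sup>2 \<le> (\<Sum>i<k. (1 / real N)\<^sup>2)"
      unfolding l2_norm_sq dim
    proof (rule sum_mono)
      fix i assume "i \<in> {..<k}"
      then have i: "i < k" by simp
      have "\<bar>\<theta> $ i * real N - of_int \<lfloor>\<theta> $ i * real N\<rfloor>\<bar> \<le> 1" by linarith
      then have "\<bar>\<theta> $ i - of_int \<lfloor>\<theta> $ i * real N\<rfloor> / real N\<bar> \<le> \<bar>1 / real N\<bar>"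
      proof -
        have "\<theta> $ i - of_int \<lfloor>\<theta> $ i * real N\<rfloor> / real N = (\<theta> $ i * real N - of_int \<lfloor>\<theta> $ i * real N\<rfloor>) / real N"
          using N by (simp add: diff_divide_distrib)
        then show ?thesis using \<open>\<bar>\<theta> $ i * real N - of_int \<lfloor>\<theta> $ i * real N\<rfloor>\<bar> \<le> 1\<close> N
          by (simp only: abs_divide) (simp add: divide_right_mono)
      qed
      then have "(\<theta> $ i - of_int \<lfloor>\<theta> $ i * real N\<rfloor> / real N)\<^sup>2 \<le> (1 / real N)\<^sup>2"
        by (rule abs_le_square_iff[THEN iffD1])
      then show "((\<theta> - f p) $ i)\<^sup>2 \<le> (1 / real N)\<^sup>2" using i by (simp add: f_def p_def)
    qed
    also have "\<dots> = (sqrt (real k) / real N)\<^sup>2" by (simp add: power_divide)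
    finally show "l2_norm (\<theta> - f p) \<le> sqrt (real k) / real N"
      by (rule power2_le_imp_le) simp
  qed
  then show ?thesis using sub fin card by (intro exI[of _ "f ` ?box"]) auto
qed

section \<open>The good event\<close>

lemma prob_space_speckle: "\<sigma> > 0 \<Longrightarrow> prob_space (speckle_space m n L \<sigma>)"
  unfolding speckle_space_def
  by (intro prob_space_pair prob_space_PiM_gauss) auto

section \<open>Events that depend on one factor\<close>

lemma speckle_space_fst:
  assumes "\<sigma> > 0" and B: "B \<in> sets (PiM ({..<m} \<times> {..<n}) (\<lambda>_. gauss 1))"
  shows "{\<omega> \<in> space (speckle_space m n L \<sigma>). fst \<omega> \<in> B} \<in> sets (speckle_space m n L \<sigma>)"
    and "emeasure (speckle_space m n L \<sigma>) {\<omega> \<in> space (speckle_space m n L \<sigma>). fst \<omega> \<in> B}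
      = emeasure (PiM ({..<m} \<times> {..<n}) (\<lambda>_. gauss 1)) B"
proof -
  let ?PW = "PiM ({..<L} \<times> {..<n}) (\<lambda>_. gauss \<sigma>)"
  interpret PW: prob_space ?PW by (rule prob_space_PiM_gauss[OF assms(1)])
  have eq: "{\<omega> \<in> space (speckle_space m n L \<sigma>). fst \<omega> \<in> B} = B \<times> space ?PW"
    using sets.sets_into_space[OF B] unfolding space_speckle by auto
  show "{\<omega> \<in> space (speckle_space m n L \<sigma>). fst \<omega> \<in> B} \<in> sets (speckle_space m n L \<sigma>)"
    unfolding eq unfolding speckle_space_def using B by (intro pair_measureI) auto
  show "emeasure (speckle_space m n L \<sigma>) {\<omega> \<in> space (speckle_space m n L \<sigma>). fst \<omega> \<in> B}
      = emeasure (PiM ({..<m} \<times> {..<n}) (\<lambda>_. gauss 1)) B"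
    unfolding eq unfolding speckle_space_def using B
    by (subst PW.emeasure_pair_measure_Times) (auto simp: PW.emeasure_space_1)
qed

lemma speckle_space_snd:
  assumes "\<sigma> > 0" and B: "B \<in> sets (PiM ({..<L} \<times> {..<n}) (\<lambda>_. gauss \<sigma>))"
  shows "{\<omega> \<in> space (speckle_space m n L \<sigma>). snd \<omega> \<in> B} \<in> sets (speckle_space m n L \<sigma>)"
    and "emeasure (speckle_space m n L \<sigma>) {\<omega> \<in> space (speckle_space m n L \<sigma>). snd \<omega> \<in> B}
      = emeasure (PiM ({..<L} \<times> {..<n}) (\<lambda>_. gauss \<sigma>)) B"
proof -
  let ?PA = "PiM ({..<m} \<times> {..<n}) (\<lambda>_. gauss 1)"
  interpret PA: prob_space ?PA by (rule prob_space_PiM_gauss) simp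
  interpret PW: prob_space "PiM ({..<L} \<times> {..<n}) (\<lambda>_. gauss \<sigma>)" by (rule prob_space_PiM_gauss[OF assms(1)])
  have eq: "{\<omega> \<in> space (speckle_space m n L \<sigma>). snd \<omega> \<in> B} = space ?PA \<times> B"
    using sets.sets_into_space[OF B] unfolding space_speckle by auto
  show "{\<omega> \<in> space (speckle_space m n L \<sigma>). snd \<omega> \<in> B} \<in> sets (speckle_space m n L \<sigma>)"
    unfolding eq unfolding speckle_space_def using B by (intro pair_measureI) auto
  show "emeasure (speckle_space m n L \<sigma>) {\<omega> \<in> space (speckle_space m n L \<sigma>). snd \<omega> \<in> B}
      = emeasure (PiM ({..<L} \<times> {..<n}) (\<lambda>_. gauss \<sigma>)) B"
    unfolding eq unfolding speckle_space_def using B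
    by (subst PW.emeasure_pair_measure_Times) (auto simp: PA.emeasure_space_1)
qed

text \<open>The distance \<open>D\<close> of the error analysis; \<open>gram_dist\<close> is its
  counterpart for Gram matrices, the squared Frobenius norm of their difference.\<close>

definition sq_dist :: "nat \<Rightarrow> (nat \<Rightarrow> real) \<Rightarrow> (nat \<Rightarrow> real) \<Rightarrow> real" where
  "sq_dist n xo x = (\<Sum>a<n. ((xo a)\<^sup>2 - (x a)\<^sup>2)\<^sup>2)"

definition gram_dist :: "nat \<Rightarrow> nat \<Rightarrow> (nat \<Rightarrow> real) \<Rightarrow> (nat \<Rightarrow> real) \<Rightarrow> (nat \<times> nat \<Rightarrow> real) \<Rightarrow> real" where
  "gram_dist m n xo x A = (\<Sum>i<m. \<Sum>j<m. (\<Sum>a<n. ((xo a)\<^sup>2 - (x a)\<^sup>2) * A (i, a) * A (j, a))\<^sup>2)"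

text \<open>A union bound. Each signal in \<open>X\<close> costs \<open>2 * \<beta>\<close> for the
  Frobenius lower bound and \<open>\<beta>\<close> for the deviation; operator norm and speckle
  energy cost one event each, singularity none. The condition on \<open>thr\<close> covers all
  larger \<open>D\<close> because the distance varies over \<open>X\<close>.\<close>

lemma good_event:
  fixes X :: "(nat \<Rightarrow> real) set"
  assumes X: "finite X" and xm: "0 < x_min" and xM: "x_min \<le> x_max"
    and x: "\<forall>x\<in>X. \<forall>a<n. x_min \<le> x a \<and> x a \<le> x_max"
    and xo: "\<forall>a<n. x_min \<le> xo a \<and> xo a \<le> x_max"
    and mn: "m \<le> n" "n > 0" and \<sigma>: "\<sigma> > 0" and L: "L > 0" and m1: "m1 \<le> m"
    and s: "0 < s" "16 * s * (x_max / x_min)\<^sup>2 \<le> 1"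
    and \<beta>: "exp (real L * (16 * s\<^sup>2 * ((x_max / x_min)\<^sup>2)\<^sup>2 * real m - s * dev)) \<le> \<beta>"
    and thr: "\<forall>D\<ge>thr. exp (- real m1 * D / (64 * (x_max\<^sup>2)\<^sup>2))
          + exp (- real m1 * real (m - m1) * D / (245760 * real n * (x_max\<^sup>2)\<^sup>2)) \<le> 2 * \<beta>"
  defines "P \<equiv> speckle_space m n L \<sigma>"
  shows "\<exists>E\<in>sets P. measure P E \<ge> 1 - (exp (- real n / 2) + exp (- (real L * real n / 8)) + 3 * real (card X) * \<beta>) \<and>
    (\<forall>\<omega>\<in>E. det (mat_of m (\<lambda>i k. fst \<omega> (i, k))) \<noteq> 0 \<and> net_bounded m n (fst \<omega>) \<and>
      (\<Sum>q<L. \<Sum>a<n. (snd \<omega> (q, a))\<^sup>2) \<le> 4 * real L * real n * \<sigma>\<^sup>2 \<and>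
      (\<forall>x\<in>X. gap_deviation m n L \<sigma> xo x \<omega> \<le> dev \<and>
        (thr \<le> sq_dist n xo x \<longrightarrow>
          real m1 * real (m - m1) * sq_dist n xo x / 4 \<le> gram_dist m n xo x (fst \<omega>))))"
proof -
  let ?PA = "PiM ({..<m} \<times> {..<n}) (\<lambda>_. gauss 1)"
  let ?PW = "PiM ({..<L} \<times> {..<n}) (\<lambda>_. gauss \<sigma>)"
  let ?det = "\<lambda>A :: nat \<times> nat \<Rightarrow> real. det (mat_of m (\<lambda>i k. A (i, k)))"
  interpret P: prob_space P unfolding P_def by (rule prob_space_speckle[OF \<sigma>])
  have \<beta>0: "\<beta> \<ge> 0" using \<beta> by (meson exp_ge_zero order_trans)
  have xM0: "x_max > 0" using xm xM by linarith
  define S0 where "S0 = {A \<in> space ?PA. ?det A = 0}"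
  define S1 where "S1 = {A \<in> space ?PA. \<not> net_bounded m n A}"
  define S2 where "S2 = {w \<in> space ?PW. 4 * real L * real n * \<sigma>\<^sup>2 \<le> (\<Sum>q<L. \<Sum>a<n. (w (q, a))\<^sup>2)}"
  define S3 where "S3 x = {A \<in> space ?PA. thr \<le> sq_dist n xo x \<and> net_bounded m n A \<and>
      gram_dist m n xo x A \<le> real m1 * real (m - m1) * sq_dist n xo x / 4}" for x
  have compA: "(\<lambda>A. A (i, a)) \<in> borel_measurable ?PA" if "i < m" "a < n" for i a
    using measurable_component_singleton[of "(i, a)" "{..<m} \<times> {..<n}" "\<lambda>_. gauss 1"] that by simp
  have m0: "S0 \<in> sets ?PA"
  proof -
    have [measurable]: "?det \<in> borel_measurable ?PA"
      using mn by (intro borel_measurable_det_mat_of compA) auto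
    show ?thesis unfolding S0_def by measurable
  qed
  have m1': "S1 \<in> sets ?PA"
  proof -
    have "S1 = space ?PA - {A \<in> space ?PA. net_bounded m n A}" by (auto simp: S1_def)
    then show ?thesis using sets_net_bounded[of m n] by auto
  qed
  have m2: "S2 \<in> sets ?PW" unfolding S2_def by measurable
  have m3: "S3 x \<in> sets ?PA" for x
  proof -
    have "(gram_dist m n xo x) \<in> borel_measurable ?PA"
      unfolding gram_dist_def[abs_def]
      by (intro borel_measurable_sum borel_measurable_times borel_measurable_power borel_measurable_const compA) auto
    then have 1: "{A \<in> space ?PA. gram_dist m n xo x A \<le> real m1 * real (m - m1) * sq_dist n xo x / 4} \<in> sets ?PA"
      by measurable
    show ?thesis
    proof (cases "thr \<le> sq_dist n xo x")
      case True
      then have "S3 x = {A \<in> space ?PA. net_bounded m n A}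
          \<inter> {A \<in> space ?PA. gram_dist m n xo x A \<le> real m1 * real (m - m1) * sq_dist n xo x / 4}"
        by (auto simp: S3_def)
      then show ?thesis using 1 sets_net_bounded[of m n] by auto
    next
      case False
      then show ?thesis by (simp add: S3_def)
    qed
  qed
  define N0 where "N0 = {\<omega> \<in> space P. fst \<omega> \<in> S0}"
  define N1 where "N1 = {\<omega> \<in> space P. fst \<omega> \<in> S1}"
  define N2 where "N2 = {\<omega> \<in> space P. snd \<omega> \<in> S2}"
  define N3 where "N3 x = {\<omega> \<in> space P. fst \<omega> \<in> S3 x}" for x
  define N4 where "N4 x = {\<omega> \<in> space P. ?det (fst \<omega>) \<noteq> 0 \<and> dev \<le> gap_deviation m n L \<sigma> xo x \<omega>}" for x
  have e0: "N0 \<in> sets P" "emeasure P N0 \<le> 0"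
    unfolding N0_def P_def using speckle_space_fst[OF \<sigma> m0] gaussian_leading_minor_singular[of m m n] mn
    by (auto simp: S0_def)
  have e1: "N1 \<in> sets P" "emeasure P N1 \<le> ennreal (exp (- real n / 2))"
    unfolding N1_def P_def using speckle_space_fst[OF \<sigma> m1'] gaussian_net_bounded[OF mn(2,1)]
    by (auto simp: S1_def)
  have e2: "N2 \<in> sets P" "emeasure P N2 \<le> ennreal (exp (- (real L * real n / 8)))"
    unfolding N2_def P_def using speckle_space_snd[OF \<sigma> m2] gaussian_norm_tail[OF \<sigma>, of L n]
    by (auto simp: S2_def)
  have e3: "N3 x \<in> sets P" "emeasure P (N3 x) \<le> ennreal (2 * \<beta>)" if "x \<in> X" for x
  proof -
    show "N3 x \<in> sets P" unfolding N3_def P_def by (rule speckle_space_fst(1)[OF \<sigma> m3])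
    have "emeasure P (N3 x) = emeasure ?PA (S3 x)"
      unfolding N3_def P_def by (rule speckle_space_fst(2)[OF \<sigma> m3])
    also have "\<dots> \<le> ennreal (2 * \<beta>)"
    proof (cases "thr \<le> sq_dist n xo x")
      case True
      define d where "d a = (xo a)\<^sup>2 - (x a)\<^sup>2" for a
      have d: "\<bar>d a\<bar> \<le> x_max\<^sup>2" if a: "a < n" for a
      proof -
        have "(xo a)\<^sup>2 \<le> x_max\<^sup>2" "(x a)\<^sup>2 \<le> x_max\<^sup>2"
          using xo[rule_format, OF a] x[rule_format, OF \<open>x \<in> X\<close> a] xm by (auto intro!: power_mono)
        moreover have "0 \<le> (xo a)\<^sup>2" "0 \<le> (x a)\<^sup>2" by auto
        ultimately show ?thesis unfolding d_def by linarith
      qed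
      have B0: "0 < x_max\<^sup>2" using xM0 by simp
      have "emeasure ?PA (S3 x) \<le> ennreal (exp (- real m1 * sq_dist n xo x / (64 * (x_max\<^sup>2)\<^sup>2))
          + exp (- real m1 * real (m - m1) * sq_dist n xo x / (245760 * real n * (x_max\<^sup>2)\<^sup>2)))"
        using frobenius_lower_tail[OF B0 d mn(2) m1] True
        unfolding S3_def gram_dist_def sq_dist_def d_def by simp
      also have "\<dots> \<le> ennreal (2 * \<beta>)" using thr[rule_format, OF True] by (rule ennreal_leI)
      finally show ?thesis .
    next
      case False
      then show ?thesis by (simp add: S3_def)
    qed
    finally show "emeasure P (N3 x) \<le> ennreal (2 * \<beta>)" .
  qed
  have e4: "N4 x \<in> sets P" "emeasure P (N4 x) \<le> ennreal \<beta>" if "x \<in> X" for x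
  proof -
    have [measurable]: "(\<lambda>\<omega>. ?det (fst \<omega>)) \<in> borel_measurable P" "gap_deviation m n L \<sigma> xo x \<in> borel_measurable P"
      unfolding P_def using mn measurable_sensing_det measurable_gap_deviation by auto
    show "N4 x \<in> sets P" unfolding N4_def by measurable
    show "emeasure P (N4 x) \<le> ennreal \<beta>"
      unfolding N4_def P_def
      by (rule order_trans[OF gap_deviation_tail[OF xm x[rule_format, OF that] xo[rule_format] mn \<sigma> L s]]) (use \<beta> in \<open>auto intro: ennreal_leI\<close>)
  qed
  define N where "N = N0 \<union> N1 \<union> N2 \<union> (\<Union>x\<in>X. N3 x \<union> N4 x)"
  have U: "(\<Union>x\<in>X. N3 x \<union> N4 x) \<in> sets P" using X e3 e4 by (intro sets.finite_UN) auto
  have Nm: "N \<in> sets P" unfolding N_def using e0 e1 e2 U by auto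
  have "emeasure P (\<Union>x\<in>X. N3 x \<union> N4 x) \<le> (\<Sum>x\<in>X. emeasure P (N3 x \<union> N4 x))"
    using X e3 e4 by (intro emeasure_subadditive_finite) auto
  also have "\<dots> \<le> (\<Sum>x\<in>X. ennreal (3 * \<beta>))"
  proof (rule sum_mono)
    fix x assume x: "x \<in> X"
    have "emeasure P (N3 x \<union> N4 x) \<le> emeasure P (N3 x) + emeasure P (N4 x)"
      using e3(1)[OF x] e4(1)[OF x] by (rule emeasure_subadditive)
    also have "\<dots> \<le> ennreal (2 * \<beta>) + ennreal \<beta>" using e3(2)[OF x] e4(2)[OF x] by (rule add_mono)
    also have "\<dots> = ennreal (3 * \<beta>)" using \<beta>0 by (simp add: ennreal_plus[symmetric] del: ennreal_plus)
    finally show "emeasure P (N3 x \<union> N4 x) \<le> ennreal (3 * \<beta>)" .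
  qed
  also have "\<dots> = ennreal (3 * real (card X) * \<beta>)"
    using \<beta>0 by (simp add: ennreal_of_nat_eq_real_of_nat ennreal_mult[symmetric] mult_ac)
  finally have eU: "emeasure P (\<Union>x\<in>X. N3 x \<union> N4 x) \<le> ennreal (3 * real (card X) * \<beta>)" .
  define tot where "tot = exp (- real n / 2) + exp (- (real L * real n / 8)) + 3 * real (card X) * \<beta>"
  have "emeasure P N \<le> emeasure P N0 + emeasure P N1 + emeasure P N2 + emeasure P (\<Union>x\<in>X. N3 x \<union> N4 x)"
    unfolding N_def using e0(1) e1(1) e2(1) U
    by (intro order_trans[OF emeasure_subadditive] add_mono order_refl) auto
  also have "\<dots> \<le> 0 + ennreal (exp (- real n / 2)) + ennreal (exp (- (real L * real n / 8)))
      + ennreal (3 * real (card X) * \<beta>)"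
    by (intro add_mono e0 e1 e2 eU)
  also have "\<dots> = ennreal tot"
    unfolding tot_def using \<beta>0 by (simp add: ennreal_plus[symmetric] del: ennreal_plus)
  finally have "ennreal (measure P N) \<le> ennreal tot" by (simp add: P.emeasure_eq_measure)
  moreover have "tot \<ge> 0" unfolding tot_def using \<beta>0 by (intro add_nonneg_nonneg) auto
  ultimately have "measure P N \<le> tot" by simp
  then have "measure P (space P - N) \<ge> 1 - tot" using P.prob_compl[OF Nm] by simp
  moreover have "det (mat_of m (\<lambda>i k. fst \<omega> (i, k))) \<noteq> 0 \<and> net_bounded m n (fst \<omega>) \<and>
      (\<Sum>q<L. \<Sum>a<n. (snd \<omega> (q, a))\<^sup>2) \<le> 4 * real L * real n * \<sigma>\<^sup>2 \<and>
      (\<forall>x\<in>X. gap_deviation m n L \<sigma> xo x \<omega> \<le> dev \<and>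
        (thr \<le> sq_dist n xo x \<longrightarrow>
          real m1 * real (m - m1) * sq_dist n xo x / 4 \<le> gram_dist m n xo x (fst \<omega>)))"
    if \<omega>: "\<omega> \<in> space P - N" for \<omega>
  proof -
    have sp: "\<omega> \<in> space P" "fst \<omega> \<in> space ?PA" "snd \<omega> \<in> space ?PW"
      using \<omega> unfolding P_def space_speckle by auto
    have 0: "?det (fst \<omega>) \<noteq> 0" using \<omega> sp by (auto simp: N_def N0_def S0_def)
    have 1: "net_bounded m n (fst \<omega>)" using \<omega> sp by (auto simp: N_def N1_def S1_def)
    have 2: "(\<Sum>q<L. \<Sum>a<n. (snd \<omega> (q, a))\<^sup>2) \<le> 4 * real L * real n * \<sigma>\<^sup>2"
      using \<omega> sp by (auto simp: N_def N2_def S2_def not_le intro: less_imp_le)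
    have 3: "gap_deviation m n L \<sigma> xo x \<omega> \<le> dev" if "x \<in> X" for x
    proof -
      have "\<omega> \<notin> N4 x" using \<omega> that by (auto simp: N_def)
      then show ?thesis using 0 sp by (auto simp: N4_def)
    qed
    have 4: "real m1 * real (m - m1) * sq_dist n xo x / 4 \<le> gram_dist m n xo x (fst \<omega>)"
      if "x \<in> X" "thr \<le> sq_dist n xo x" for x
    proof -
      have "\<omega> \<notin> N3 x" using \<omega> that by (auto simp: N_def)
      then show ?thesis using 1 sp that by (auto simp: N3_def S3_def)
    qed
    show ?thesis using 0 1 2 3 4 by blast
  qed
  ultimately show ?thesis unfolding tot_def using Nm by (intro bexI[of _ "space P - N"]) auto
qed

text \<open>Deterministic on the good event: the likelihood at the net point \<open>x\<close>
  exceeds that at \<open>xh\<close> by at most the discretisation error, and \<open>xh\<close> is no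
  worse than \<open>xo\<close>. In the factor 5 \<kappa> n, one part bounds m from the log
  determinant and four come from the speckle energy.\<close>

lemma minimiser_comparison:
  fixes x xo xh :: "real vec"
  assumes xm: "0 < x_min" and xM: "x_min \<le> x_max"
    and car: "x \<in> carrier_vec n" "xo \<in> carrier_vec n" "xh \<in> carrier_vec n"
    and bx: "\<And>a. a < n \<Longrightarrow> x_min \<le> x $ a \<and> x $ a \<le> x_max"
    and bo: "\<And>a. a < n \<Longrightarrow> x_min \<le> xo $ a \<and> xo $ a \<le> x_max"
    and bh: "\<And>a. a < n \<Longrightarrow> x_min \<le> xh $ a \<and> xh $ a \<le> x_max"
    and mn: "m \<le> n" "n > 0" and \<sigma>: "\<sigma> > 0" and L: "L > 0"
    and close: "\<And>a. a < n \<Longrightarrow> \<bar>xh $ a - x $ a\<bar> \<le> \<epsilon>" and \<epsilon>: "\<epsilon> \<ge> 0"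
    and min: "neg_log_lik \<sigma> L (sensing_mat m n \<omega>) (observation m n xo \<omega>) xh
        \<le> neg_log_lik \<sigma> L (sensing_mat m n \<omega>) (observation m n xo \<omega>) xo"
    and A: "det (mat_of m (\<lambda>i k. fst \<omega> (i, k))) \<noteq> 0" "net_bounded m n (fst \<omega>)"
    and w: "(\<Sum>q<L. \<Sum>a<n. (snd \<omega> (q, a))\<^sup>2) \<le> 4 * real L * real n * \<sigma>\<^sup>2"
    and dev: "gap_deviation m n L \<sigma> (\<lambda>a. xo $ a) (\<lambda>a. x $ a) \<omega> \<le> dev"
  shows "gram_dist m n (\<lambda>a. xo $ a) (\<lambda>a. x $ a) (fst \<omega>)
      / (4 * (x_max / x_min)\<^sup>2 * (x_max\<^sup>2 * (1920 * real n))\<^sup>2)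
    \<le> dev + ((1 + \<epsilon> / x_min)\<^sup>2 - 1) * (5 * (x_max / x_min)\<^sup>2 * real n)"
proof -
  define \<kappa> where "\<kappa> = (x_max / x_min)\<^sup>2"
  have \<kappa>: "\<kappa> \<ge> 1" using xm xM by (simp add: \<kappa>_def)
  define \<delta> where "\<delta> = (1 + \<epsilon> / x_min)\<^sup>2 - 1"
  have \<delta>: "\<delta> \<ge> 0"
  proof -
    have "1\<^sup>2 \<le> (1 + \<epsilon> / x_min)\<^sup>2" using \<epsilon> xm by (intro power_mono) auto
    then show ?thesis by (simp add: \<delta>_def)
  qed
  \<comment> \<open>An additive error becomes a relative one because every coordinate is at least
    \<open>x_min\<close>.\<close>
  have ratio: "u\<^sup>2 \<le> (1 + \<delta>) * v\<^sup>2" if "x_min \<le> u" "x_min \<le> v" "\<bar>u - v\<bar> \<le> \<epsilon>" for u v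
  proof -
    have "\<epsilon> * x_min \<le> \<epsilon> * v" using that \<epsilon> by (intro mult_left_mono)
    then have "\<epsilon> \<le> \<epsilon> / x_min * v" using xm by (simp add: field_simps)
    then have "u \<le> (1 + \<epsilon> / x_min) * v" using that by (simp add: distrib_right)
    then have "u\<^sup>2 \<le> ((1 + \<epsilon> / x_min) * v)\<^sup>2" using that xm by (intro power_mono) auto
    then show ?thesis by (simp only: \<delta>_def power_mult_distrib) simp
  qed
  let ?g = "\<lambda>x. gram n (fst \<omega>) (\<lambda>a. x $ a)"
  let ?d = "\<lambda>x. ln (det (mat_of m (?g x)))"
  let ?Q = "\<lambda>x. quad_misfit m n L (\<lambda>a. xo $ a) (\<lambda>a. x $ a) \<omega>"
  let ?s = "real L * \<sigma>\<^sup>2"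
  have s: "?s > 0" using L \<sigma> by simp
  have nz: "x $ a \<noteq> 0" "xo $ a \<noteq> 0" "xh $ a \<noteq> 0" if "a < n" for a
    using bx[OF that] bo[OF that] bh[OF that] xm by auto
  have pd: "pos_def_on {..<m} (?g x)" "pos_def_on {..<m} (?g xo)" "pos_def_on {..<m} (?g xh)"
    using nz mn A(1) by (auto intro!: pos_def_on_gram)
  note nll = neg_log_lik_eq[OF _ car(2) \<sigma>]
  have 1: "?d xh + ?Q xh / ?s \<le> ?d xo + ?Q xo / ?s"
    using min unfolding nll[OF car(3) pd(3)] nll[OF car(2) pd(2)] by linarith
  have xox: "\<forall>a<n. x $ a \<noteq> 0 \<and> (xo $ a)\<^sup>2 \<le> \<kappa> * (x $ a)\<^sup>2"
    unfolding \<kappa>_def using nz bx bo xm by (auto intro!: pointwise_ratio)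
  have r1: "(xh $ a)\<^sup>2 \<le> (1 + \<delta>) * (x $ a)\<^sup>2" and r2: "(x $ a)\<^sup>2 \<le> (1 + \<delta>) * (xh $ a)\<^sup>2" if "a < n" for a
    using bx[OF that] bh[OF that] close[OF that] by (auto intro!: ratio simp: abs_minus_commute)
  have 2: "?d x \<le> ?d xh + real m * \<delta>"
    by (rule discretisation_error(1)[OF pd(3) pd(1) r1 r2 \<delta> xox])
  have 3: "?Q x \<le> ?Q xh + \<delta> * \<kappa> * (\<Sum>q<L. \<Sum>a<n. (snd \<omega> (q, a))\<^sup>2)"
    by (rule discretisation_error(2)[OF pd(3) pd(1) r1 r2 \<delta> xox])
  have "\<delta> * \<kappa> * (\<Sum>q<L. \<Sum>a<n. (snd \<omega> (q, a))\<^sup>2) \<le> \<delta> * \<kappa> * (4 * real L * real n * \<sigma>\<^sup>2)"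
    using w \<delta> \<kappa> by (intro mult_left_mono) auto
  then have "?Q x \<le> ?Q xh + \<delta> * \<kappa> * (4 * real L * real n * \<sigma>\<^sup>2)" using 3 by linarith
  then have "?Q x / ?s \<le> (?Q xh + \<delta> * \<kappa> * (4 * real L * real n * \<sigma>\<^sup>2)) / ?s"
    using s by (intro divide_right_mono) auto
  also have "\<dots> = ?Q xh / ?s + \<delta> * (4 * \<kappa> * real n)" using s \<sigma> L by (simp add: add_divide_distrib)
  finally have 4: "?Q x / ?s \<le> ?Q xh / ?s + \<delta> * (4 * \<kappa> * real n)" .
  have "real m * \<delta> \<le> \<delta> * (\<kappa> * real n)"
  proof -
    have "1 * real m \<le> \<kappa> * real n" using \<kappa> mn by (intro mult_mono) auto
    then have "\<delta> * (1 * real m) \<le> \<delta> * (\<kappa> * real n)" using \<delta> by (intro mult_left_mono)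
    then show ?thesis by (simp add: mult.commute)
  qed
  then have 5: "?d x - ?d xo + (?Q x - ?Q xo) / ?s \<le> \<delta> * (5 * \<kappa> * real n)"
    using 1 2 4 by (simp add: diff_divide_distrib algebra_simps)
  have op: "(\<Sum>i<m. (\<Sum>a<n. fst \<omega> (i, a) * v a)\<^sup>2) \<le> 1920 * real n * (\<Sum>a<n. (v a)\<^sup>2)" for v
    by (rule net_bounded_opnorm[OF mn(2) A(2)])
  have R: "1920 * real n > 0" using mn by simp
  have "gram_dist m n (\<lambda>a. xo $ a) (\<lambda>a. x $ a) (fst \<omega>) / (4 * \<kappa> * (x_max\<^sup>2 * (1920 * real n))\<^sup>2)
      \<le> ?d x - ?d xo + (\<Sum>i<m. \<Sum>j<m. inv_entry m (?g x) i j * ?g xo i j) - real m"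
    unfolding gram_dist_def \<kappa>_def
    by (rule likelihood_gap_lower(2)[OF xm bx bo mn A(1) op R])
  also have "\<dots> = ?d x - ?d xo + (?Q x - ?Q xo) / ?s + gap_deviation m n L \<sigma> (\<lambda>a. xo $ a) (\<lambda>a. x $ a) \<omega>"
    unfolding gap_deviation_def quad_misfit_def by (simp add: sum_subtractf)
  also have "\<dots> \<le> dev + \<delta> * (5 * \<kappa> * real n)" using 5 dev by linarith
  finally show ?thesis unfolding \<delta>_def \<kappa>_def .
qed

section \<open>The error bound\<close>

text \<open>The two groups of rows are halves. The first bound is sharp at \<open>m = 3\<close>, and
  \<open>m = 1\<close> would leave the first group empty.\<close>

lemma half_split_bounds:
  assumes "m \<ge> (2::nat)"
  shows "real m / 3 \<le> real (m div 2)" and "(real m)\<^sup>2 / 6 \<le> real (m div 2) * real (m - m div 2)"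
proof -
  have "m \<le> 3 * (m div 2)" using assms by linarith
  then have "real m \<le> real (3 * (m div 2))" by (simp only: of_nat_le_iff)
  then show 1: "real m / 3 \<le> real (m div 2)" by simp
  have "m \<le> 2 * (m - m div 2)" by linarith
  then have "real m \<le> real (2 * (m - m div 2))" by (simp only: of_nat_le_iff)
  then have 2: "real m / 2 \<le> real (m - m div 2)" by simp
  have "(real m / 3) * (real m / 2) \<le> real (m div 2) * real (m - m div 2)"
    using 1 2 by (intro mult_mono) auto
  then show "(real m)\<^sup>2 / 6 \<le> real (m div 2) * real (m - m div 2)" by (simp add: power2_eq_square)
qed

text \<open>The constant is 6 * 7 * 245760: the 6 comes from the product of the two halves, and the
  second exponent becomes at least 7 m \<rho>, which dominates 7 \<rho>^2 since
  \<open>\<rho> \<le> m\<close>. The first exponent has ample room.\<close>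

lemma tail_exponents:
  fixes \<rho> B D :: real
  assumes m: "2 \<le> m" "m \<le> n" and \<rho>: "0 < \<rho>" "\<rho> \<le> real m" and B: "B > 0"
    and D: "10321920 * B\<^sup>2 * (real n * \<rho> / real m) \<le> D"
  shows "exp (- real (m div 2) * D / (64 * B\<^sup>2))
      + exp (- real (m div 2) * real (m - m div 2) * D / (245760 * real n * B\<^sup>2)) \<le> 2 * exp (- 7 * \<rho>\<^sup>2)"
proof -
  have m0: "real m > 0" and n0: "real n > 0" and mn: "real m \<le> real n" using m by auto
  have D0: "0 \<le> 10321920 * B\<^sup>2 * (real n * \<rho> / real m)" using \<rho> by simp
  have \<rho>n: "\<rho> * \<rho> \<le> real n * \<rho>" using \<rho> mn by (intro mult_right_mono) auto
  have 1: "7 * \<rho>\<^sup>2 \<le> real (m div 2) * D / (64 * B\<^sup>2)"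
  proof -
    have "real m / 3 * (10321920 * B\<^sup>2 * (real n * \<rho> / real m)) \<le> real (m div 2) * D"
      using half_split_bounds(1)[OF m(1)] D D0 by (intro mult_mono) auto
    then have "real m / 3 * (10321920 * B\<^sup>2 * (real n * \<rho> / real m)) / (64 * B\<^sup>2) \<le> real (m div 2) * D / (64 * B\<^sup>2)"
      by (intro divide_right_mono) auto
    also have "real m / 3 * (10321920 * B\<^sup>2 * (real n * \<rho> / real m)) / (64 * B\<^sup>2) = 53760 * (real n * \<rho>)"
      using m0 B by (simp add: field_simps)
    finally have "53760 * (real n * \<rho>) \<le> real (m div 2) * D / (64 * B\<^sup>2)" .
    moreover have "7 * \<rho>\<^sup>2 \<le> 53760 * (real n * \<rho>)"
      unfolding power2_eq_square using \<rho>n \<rho> by (intro mult_mono) auto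
    ultimately show ?thesis by (rule order_trans[rotated])
  qed
  have 2: "7 * \<rho>\<^sup>2 \<le> real (m div 2) * real (m - m div 2) * D / (245760 * real n * B\<^sup>2)"
  proof -
    have "(real m)\<^sup>2 / 6 * (10321920 * B\<^sup>2 * (real n * \<rho> / real m)) \<le> real (m div 2) * real (m - m div 2) * D"
      using half_split_bounds(2)[OF m(1)] D D0 by (intro mult_mono) auto
    then have "(real m)\<^sup>2 / 6 * (10321920 * B\<^sup>2 * (real n * \<rho> / real m)) / (245760 * real n * B\<^sup>2)
        \<le> real (m div 2) * real (m - m div 2) * D / (245760 * real n * B\<^sup>2)"
      by (intro divide_right_mono) auto
    also have "(real m)\<^sup>2 / 6 * (10321920 * B\<^sup>2 * (real n * \<rho> / real m)) / (245760 * real n * B\<^sup>2) = 7 * (real m * \<rho>)"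
      using m0 n0 B by (simp add: field_simps power2_eq_square)
    finally have "7 * (real m * \<rho>) \<le> real (m div 2) * real (m - m div 2) * D / (245760 * real n * B\<^sup>2)" .
    moreover have "7 * \<rho>\<^sup>2 \<le> 7 * (real m * \<rho>)"
      unfolding power2_eq_square using \<rho> by (intro mult_left_mono mult_right_mono) auto
    ultimately show ?thesis by (rule order_trans[rotated])
  qed
  have "exp (- real (m div 2) * D / (64 * B\<^sup>2)) \<le> exp (- 7 * \<rho>\<^sup>2)" using 1 by simp
  moreover have "exp (- real (m div 2) * real (m - m div 2) * D / (245760 * real n * B\<^sup>2)) \<le> exp (- 7 * \<rho>\<^sup>2)"
    using 2 by simp
  ultimately show ?thesis by linarith
qed

text \<open>Solving the gap inequality for \<open>D / n\<close>. The fluctuation turns into the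
  second term of the rate; the discretisation error, being at most of order 1 / m, is absorbed in
  the first term because \<rho> is bounded below.\<close>

lemma gap_to_rate:
  fixes \<rho> \<kappa> H c D :: real
  assumes m: "0 < m" "m \<le> n" and L: "0 < L" and \<rho>: "1 / 2 \<le> \<rho>" and \<kappa>: "\<kappa> > 0" and H: "H > 0" and c: "c \<ge> 0"
    and gap: "(real m)\<^sup>2 * D / 24 / (4 * \<kappa> * (H * real n)\<^sup>2)
      \<le> 128 * \<kappa> * \<rho> * sqrt (real m / real L) + c / (real n)\<^sup>2"
  shows "D / real n \<le> 96 * \<kappa> * H\<^sup>2 * (128 * \<kappa> + 2 * c)
      * (\<rho> / real m + real n * \<rho> / (real m * sqrt (real L * real m)))"
proof -
  have m0: "real m > 0" and n0: "real n > 0" and L0: "real L > 0" and n1: "real n \<ge> 1" using m L by auto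
  let ?\<tau> = "real n * \<rho> / (real m * sqrt (real L * real m))"
  have \<tau>0: "?\<tau> \<ge> 0" and \<rho>m: "\<rho> / real m \<ge> 0" using \<rho> by auto
  have sq: "sqrt (real m / real L) = real m / sqrt (real L * real m)"
  proof -
    have "sqrt (real m / real L) * sqrt (real L * real m) = sqrt (real m * real m)"
      unfolding real_sqrt_mult[symmetric] using L0 by simp
    then show ?thesis using m0 L0 by (simp add: nonzero_eq_divide_eq)
  qed
  \<comment> \<open>The factor that turns the left side of \<open>gap\<close> into
    \<open>D / n\<close>; 96 is 24 times 4.\<close>
  define f where "f = 96 * \<kappa> * H\<^sup>2 * real n / (real m)\<^sup>2"
  have f0: "f \<ge> 0" using \<kappa> by (simp add: f_def)
  have "D / real n = f * ((real m)\<^sup>2 * D / 24 / (4 * \<kappa> * (H * real n)\<^sup>2))"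
    using m0 n0 \<kappa> H by (simp add: f_def field_simps power2_eq_square)
  also have "\<dots> \<le> f * (128 * \<kappa> * \<rho> * sqrt (real m / real L) + c / (real n)\<^sup>2)"
    using gap f0 by (rule mult_left_mono)
  also have "\<dots> = 96 * \<kappa> * H\<^sup>2 * (128 * \<kappa> * ?\<tau> + c * (1 / (real n * (real m)\<^sup>2)))"
    unfolding f_def sq using m0 n0 L0 by (simp add: field_simps power2_eq_square)
  also have "\<dots> \<le> 96 * \<kappa> * H\<^sup>2 * ((128 * \<kappa> + 2 * c) * (\<rho> / real m + ?\<tau>))"
  proof (intro mult_left_mono)
    have "1 / (real n * (real m)\<^sup>2) \<le> 1 / real m"
    proof (rule divide_left_mono)
      have "real m * 1 \<le> real m * (real n * real m)" using m n1 by (intro mult_left_mono) (auto simp: mult_ge1_I)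
      then show "real m \<le> real n * (real m)\<^sup>2" by (simp add: power2_eq_square mult_ac)
    qed (use m0 n0 in auto)
    also have "\<dots> \<le> 2 * (\<rho> / real m)" using \<rho> m0 by (simp add: field_simps)
    finally have q: "1 / (real n * (real m)\<^sup>2) \<le> 2 * (\<rho> / real m)" .
    have "128 * \<kappa> * t + c * q \<le> (128 * \<kappa> + 2 * c) * (a + t)" if "q \<le> 2 * a" "0 \<le> a" "0 \<le> t" for a t q :: real
    proof -
      have "c * q \<le> c * (2 * a)" using that c by (intro mult_left_mono)
      moreover have "0 \<le> \<kappa> * a" "0 \<le> c * t" using that \<kappa> c by simp_all
      ultimately show ?thesis by (simp add: algebra_simps)
    qed
    from this[OF q \<rho>m \<tau>0] show "128 * \<kappa> * ?\<tau> + c * (1 / (real n * (real m)\<^sup>2)) \<le> (128 * \<kappa> + 2 * c) * (\<rho> / real m + ?\<tau>)" .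
  qed (use \<kappa> in simp)
  finally show ?thesis by (simp only: mult.assoc)
qed

text \<open>The first bound serves the regime in which the rate is not small. The second factors a
  difference of squares, where the sum of two coordinates is at least 2 x_min.\<close>

lemma sq_norm_diff_le:
  fixes x y :: "real vec"
  assumes "x \<in> carrier_vec n" "y \<in> carrier_vec n" "0 < x_min"
    and "\<And>a. a < n \<Longrightarrow> x_min \<le> x $ a \<and> x $ a \<le> x_max" "\<And>a. a < n \<Longrightarrow> x_min \<le> y $ a \<and> y $ a \<le> x_max"
  shows "(l2_norm (x - y))\<^sup>2 \<le> real n * x_max\<^sup>2"
    and "(l2_norm (x - y))\<^sup>2 \<le> sq_dist n (\<lambda>a. y $ a) (\<lambda>a. x $ a) / (4 * x_min\<^sup>2)"
proof -
  have eq: "(l2_norm (x - y))\<^sup>2 = (\<Sum>a<n. (x $ a - y $ a)\<^sup>2)"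
    unfolding l2_norm_sq using assms(1,2) by (intro sum.cong) auto
  have "(\<Sum>a<n. (x $ a - y $ a)\<^sup>2) \<le> (\<Sum>a<n. x_max\<^sup>2)"
  proof (rule sum_mono)
    fix a assume "a \<in> {..<n}"
    then have "\<bar>x $ a - y $ a\<bar> \<le> \<bar>x_max\<bar>" using assms(3) assms(4)[of a] assms(5)[of a] by auto
    then show "(x $ a - y $ a)\<^sup>2 \<le> x_max\<^sup>2" by (rule abs_le_square_iff[THEN iffD1])
  qed
  then show "(l2_norm (x - y))\<^sup>2 \<le> real n * x_max\<^sup>2" unfolding eq by simp
  have "(\<Sum>a<n. (x $ a - y $ a)\<^sup>2) \<le> (\<Sum>a<n. ((y $ a)\<^sup>2 - (x $ a)\<^sup>2)\<^sup>2 / (4 * x_min\<^sup>2))"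
  proof (rule sum_mono)
    fix a assume "a \<in> {..<n}"
    then have "2 * x_min \<le> x $ a + y $ a" using assms(4)[of a] assms(5)[of a] by auto
    then have "(2 * x_min)\<^sup>2 \<le> (x $ a + y $ a)\<^sup>2" using assms(3) by (intro power_mono) auto
    then have "(x $ a - y $ a)\<^sup>2 * (2 * x_min)\<^sup>2 \<le> (x $ a - y $ a)\<^sup>2 * (x $ a + y $ a)\<^sup>2"
      by (intro mult_left_mono) auto
    also have "\<dots> = ((y $ a)\<^sup>2 - (x $ a)\<^sup>2)\<^sup>2"
      by (simp add: power2_eq_square algebra_simps)
    finally show "(x $ a - y $ a)\<^sup>2 \<le> ((y $ a)\<^sup>2 - (x $ a)\<^sup>2)\<^sup>2 / (4 * x_min\<^sup>2)"
      using assms(3) by (simp add: pos_le_divide_eq power_mult_distrib)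
  qed
  then show "(l2_norm (x - y))\<^sup>2 \<le> sq_dist n (\<lambda>a. y $ a) (\<lambda>a. x $ a) / (4 * x_min\<^sup>2)"
    unfolding eq sq_dist_def by (simp only: sum_divide_distrib)
qed

lemma sq_norm_triangle:
  fixes x y z :: "real vec"
  assumes "x \<in> carrier_vec n" "y \<in> carrier_vec n" "z \<in> carrier_vec n"
  shows "(l2_norm (x - z))\<^sup>2 \<le> 2 * (l2_norm (x - y))\<^sup>2 + 2 * (l2_norm (y - z))\<^sup>2"
proof -
  have eq: "(l2_norm (u - v))\<^sup>2 = (\<Sum>a<n. (u $ a - v $ a)\<^sup>2)" if "u \<in> carrier_vec n" "v \<in> carrier_vec n" for u v
    unfolding l2_norm_sq using that by (intro sum.cong) auto
  have "(s - t)\<^sup>2 \<le> 2 * (s - r)\<^sup>2 + 2 * (r - t)\<^sup>2" for s t r :: real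
  proof -
    have "2 * (s - r)\<^sup>2 + 2 * (r - t)\<^sup>2 - (s - t)\<^sup>2 = (s - 2 * r + t)\<^sup>2"
      by (simp add: power2_eq_square algebra_simps)
    moreover have "(s - 2 * r + t)\<^sup>2 \<ge> 0" by simp
    ultimately show ?thesis by linarith
  qed
  then have "(\<Sum>a<n. (x $ a - z $ a)\<^sup>2) \<le> (\<Sum>a<n. 2 * (x $ a - y $ a)\<^sup>2 + 2 * (y $ a - z $ a)\<^sup>2)"
    by (intro sum_mono)
  then show ?thesis by (simp only: eq assms sum.distrib sum_distrib_left)
qed

lemma entry_le_l2_norm:
  assumes "x \<in> carrier_vec n" "y \<in> carrier_vec n" "a < n"
  shows "\<bar>x $ a - y $ a\<bar> \<le> l2_norm (x - y)"
proof -
  have "(x $ a - y $ a)\<^sup>2 \<le> (\<Sum>a<n. (x $ a - y $ a)\<^sup>2)"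
    using assms(3) by (intro member_le_sum) auto
  also have "\<dots> = (l2_norm (x - y))\<^sup>2"
    unfolding l2_norm_sq using assms by (intro sum.cong) auto
  finally show ?thesis using l2_norm_nonneg by (metis abs_le_square_iff abs_of_nonneg)
qed

text \<open>Both constants precede all dimensions and depend on the signal bounds at most. The event
  precedes \<open>xhat\<close>, so the estimate holds for every minimiser at once and no measurable
  selection is involved. The bounds on the whole signal class are what makes all competitors
  comparable to \<open>xo\<close> in the Loewner order.\<close>

theorem theorem3p1:
  fixes x_min x_max :: real
  assumes "0 < x_min"
  shows "\<exists>K1>0. \<exists>K2>0. \<forall>(m::nat) (n::nat) (k::nat) (L::nat) (\<sigma>::real)
      (g :: real vec \<Rightarrow> real vec \<Rightarrow> real vec) (u :: real vec) (xo :: real vec).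
    0 < m \<longrightarrow> m < n \<longrightarrow> 0 < k \<longrightarrow> 0 < L \<longrightarrow> 0 < \<sigma> \<longrightarrow>
    (\<forall>\<theta>\<in>param_cube k. g \<theta> u \<in> carrier_vec n) \<longrightarrow>
    lipschitz_on_cube 1 k (\<lambda>\<theta>. g \<theta> u) \<longrightarrow>
    (\<forall>x\<in>signal_class k g u. \<forall>i<n. x_min \<le> x $ i \<and> x $ i \<le> x_max) \<longrightarrow>
    xo \<in> signal_class k g u \<longrightarrow>
    (\<forall>i<n. x_min \<le> xo $ i \<and> xo $ i \<le> x_max) \<longrightarrow>
    (\<exists>E\<in>sets (speckle_space m n L \<sigma>).
       measure (speckle_space m n L \<sigma>) E
         \<ge> 1 - K2 * (exp (- (real m / 2)) + exp (- (real L * real n / 8))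
                     + exp (- (real k * ln (real n))) + exp (real k * ln (real n) - real n / 2)) \<and>
       (\<forall>\<omega>\<in>E. \<forall>xhat.
          is_arg_min (neg_log_lik \<sigma> L (sensing_mat m n \<omega>) (observation m n xo \<omega>))
            (\<lambda>x. x \<in> signal_class k g u) xhat \<longrightarrow>
          (1 / real n) * (l2_norm (xhat - xo))\<^sup>2
            \<le> K1 * (sqrt (real k * ln (real n)) / real m
                    + real n * sqrt (real k * ln (real n)) / (real m * sqrt (real L * real m)))))"
proof -
  define \<kappa> where "\<kappa> = (x_max / x_min)\<^sup>2"
  define H where "H = 1920 * x_max\<^sup>2"
  define c where "c = 5 * \<kappa> * (2 / x_min + 1 / x_min\<^sup>2)"
  define K where "K = 10321920 * (x_max\<^sup>2)\<^sup>2"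
  define W where "W = 96 * \<kappa> * H\<^sup>2 * (128 * \<kappa> + 2 * c)"
  \<comment> \<open>One summand for each source: the regime of large rate, the distance from the
    minimiser to the net, and the error of the net point, with \<open>K\<close> for points below the
    distance threshold and \<open>W\<close> for those above. The last denominator combines 4 x_min^2
    with the factor 2 of the triangle inequality for squares.\<close>
  define K1 where "K1 = 2 * x_max\<^sup>2 + 4 + (K + W) / (2 * x_min\<^sup>2)"
  note xm = assms
  have \<kappa>0: "\<kappa> \<ge> 0" by (simp add: \<kappa>_def)
  have c0: "c \<ge> 0" using \<kappa>0 xm by (simp add: c_def)
  have KW: "K \<ge> 0" "W \<ge> 0" using \<kappa>0 c0 by (simp_all add: K_def W_def)
  have K1: "K1 \<ge> 2 * x_max\<^sup>2" "K1 > 0" "K1 \<ge> 4 + (K + W) / (2 * x_min\<^sup>2)"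
  proof -
    have "0 \<le> (K + W) / (2 * x_min\<^sup>2)" "0 \<le> 2 * x_max\<^sup>2" using KW by simp_all
    then show "K1 \<ge> 2 * x_max\<^sup>2" "K1 > 0" "K1 \<ge> 4 + (K + W) / (2 * x_min\<^sup>2)"
      unfolding K1_def by linarith+
  qed
  show ?thesis
  proof (rule exI[of _ K1], rule conjI[OF K1(2)], rule exI[of _ "3::real"], rule conjI, simp, intro allI impI)
    fix m n k L :: nat and \<sigma> :: real and g :: "real vec \<Rightarrow> real vec \<Rightarrow> real vec" and u xo :: "real vec"
    assume m: "0 < m" and mn: "m < n" and k: "0 < k" and L: "0 < L" and \<sigma>: "0 < \<sigma>"
      and car: "\<forall>\<theta>\<in>param_cube k. g \<theta> u \<in> carrier_vec n"
      and lip: "lipschitz_on_cube 1 k (\<lambda>\<theta>. g \<theta> u)"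
      and bd: "\<forall>x\<in>signal_class k g u. \<forall>i<n. x_min \<le> x $ i \<and> x $ i \<le> x_max"
      and xoC: "xo \<in> signal_class k g u" and bo': "\<forall>i<n. x_min \<le> xo $ i \<and> xo $ i \<le> x_max"
    let ?P = "speckle_space m n L \<sigma>"
    let ?f = "\<lambda>\<omega>. neg_log_lik \<sigma> L (sensing_mat m n \<omega>) (observation m n xo \<omega>)"
    define \<rho> where "\<rho> = sqrt (real k * ln (real n))"
    define rate where "rate = \<rho> / real m + real n * \<rho> / (real m * sqrt (real L * real m))"
    define prb where "prb = exp (- (real m / 2)) + exp (- (real L * real n / 8))
                     + exp (- (real k * ln (real n))) + exp (real k * ln (real n) - real n / 2)"
    interpret P: prob_space ?P by (rule prob_space_speckle[OF \<sigma>])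
    have n2: "n \<ge> 2" and n0: "n > 0" using m mn by auto
    have Cn: "x \<in> carrier_vec n" if "x \<in> signal_class k g u" for x
      using that car by (auto simp: signal_class_def)
    have bC: "x_min \<le> x $ a \<and> x $ a \<le> x_max" if "x \<in> signal_class k g u" "a < n" for x a
      using that bd by blast
    have xM: "x_min \<le> x_max" using bo' n0 by force
    have ln_n: "ln (real n) \<ge> 2 / 3"
    proof -
      have "ln 2 \<le> ln (real n)" using n2 by simp
      then show ?thesis using ln2_ge_two_thirds by linarith
    qed
    have kln: "real k * (2 / 3) \<le> real k * ln (real n)" using ln_n by (intro mult_left_mono) auto
    have \<rho>sq: "\<rho>\<^sup>2 = real k * ln (real n)" using ln_n by (simp add: \<rho>_def)
    \<comment> \<open>From n \<ge> 2 and k \<ge> 1. This bound lets the rate absorb terms of order 1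
      / m, and with \<rho> < m / 2 it excludes m = 1.\<close>
    have \<rho>0: "\<rho> \<ge> 4 / 5"
    proof (rule power2_le_imp_le)
      have "(4 / 5)\<^sup>2 \<le> real k * (2 / 3)" using k by (simp add: power2_eq_square)
      then show "(4 / 5)\<^sup>2 \<le> \<rho>\<^sup>2" using kln \<rho>sq by linarith
    qed (use ln_n in \<open>simp add: \<rho>_def\<close>)
    have rate0: "\<rho> / real m \<ge> 0" "real n * \<rho> / (real m * sqrt (real L * real m)) \<ge> 0" using \<rho>0 by auto
    have prb0: "prb \<ge> 0" unfolding prb_def by (intro add_nonneg_nonneg) auto
    show "\<exists>E\<in>sets ?P. measure ?P E \<ge> 1 - 3 * (exp (- (real m / 2)) + exp (- (real L * real n / 8))
                     + exp (- (real k * ln (real n))) + exp (real k * ln (real n) - real n / 2)) \<and>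
       (\<forall>\<omega>\<in>E. \<forall>xhat. is_arg_min (?f \<omega>) (\<lambda>x. x \<in> signal_class k g u) xhat \<longrightarrow>
          (1 / real n) * (l2_norm (xhat - xo))\<^sup>2
            \<le> K1 * (sqrt (real k * ln (real n)) / real m
                    + real n * sqrt (real k * ln (real n)) / (real m * sqrt (real L * real m))))"
      unfolding \<rho>_def[symmetric] rate_def[symmetric] prb_def[symmetric]
    \<comment> \<open>With a rate of at least 1/2 the whole space serves as the event, since the
      mean squared error within the signal class never exceeds x_max^2.\<close>
    proof (cases "rate \<ge> 1 / 2")
      case True
      have "(1 / real n) * (l2_norm (xhat - xo))\<^sup>2 \<le> K1 * rate"
        if "is_arg_min (?f \<omega>) (\<lambda>x. x \<in> signal_class k g u) xhat" for \<omega> xhat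
      proof -
        have xh: "xhat \<in> signal_class k g u" using that by (simp add: is_arg_min_def)
        have "(l2_norm (xhat - xo))\<^sup>2 \<le> real n * x_max\<^sup>2"
          by (rule sq_norm_diff_le(1)[OF Cn[OF xh] Cn[OF xoC] xm bC[OF xh] bC[OF xoC]])
        then have "(1 / real n) * (l2_norm (xhat - xo))\<^sup>2 \<le> x_max\<^sup>2" using n0 by (simp add: field_simps)
        also have "\<dots> = 2 * x_max\<^sup>2 * (1 / 2)" by simp
        also have "\<dots> \<le> K1 * rate" using K1 True by (intro mult_mono) auto
        finally show ?thesis .
      qed
      then show "\<exists>E\<in>sets ?P. 1 - 3 * prb \<le> measure ?P E \<and> (\<forall>\<omega>\<in>E. \<forall>xhat.
          is_arg_min (?f \<omega>) (\<lambda>x. x \<in> signal_class k g u) xhat \<longrightarrow> (1 / real n) * (l2_norm (xhat - xo))\<^sup>2 \<le> K1 * rate)"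
        using prb0 by (intro bexI[of _ "space ?P"]) (auto simp: P.prob_space)
    next
      case False
      have m0: "real m > 0" and L0: "real L > 0" and mn': "real m \<le> real n" using m L mn by auto
      have "\<rho> / real m < 1 / 2" using False rate0 unfolding rate_def not_le by linarith
      then have \<rho>m: "\<rho> < real m / 2" using m0 by (simp add: field_simps)
      have m2: "2 \<le> m" using \<rho>m \<rho>0 by linarith
      \<comment> \<open>From the second term of the rate, using m < n. It is what makes the
        parameter \<open>s\<close> chosen below admissible.\<close>
      have \<rho>Lm: "\<rho> \<le> sqrt (real L * real m)"
      proof -
        have s0: "sqrt (real L * real m) > 0" using L0 m0 by simp
        have "1 * (\<rho> / sqrt (real L * real m)) \<le> real n / real m * (\<rho> / sqrt (real L * real m))"
          using m0 mn' \<rho>0 by (intro mult_right_mono) (auto simp: field_simps)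
        also have "\<dots> = real n * \<rho> / (real m * sqrt (real L * real m))" by simp
        also have "\<dots> \<le> 1" using False rate0 unfolding rate_def not_le by linarith
        finally show ?thesis using s0 by (simp add: field_simps)
      qed
      have sk: "sqrt (real k) \<le> real n"
      proof (rule real_le_lsqrt)
        have "\<rho>\<^sup>2 \<le> (real m / 2)\<^sup>2" using \<rho>m \<rho>0 by (intro power_mono) auto
        then have "real k * (2 / 3) \<le> (real m)\<^sup>2 / 4" using kln \<rho>sq by (simp add: power_divide)
        moreover have "(real m)\<^sup>2 \<le> (real n)\<^sup>2" using mn' by (intro power_mono) auto
        moreover have "(real m)\<^sup>2 \<ge> 0" by simp
        ultimately show "real k \<le> (real n)\<^sup>2" by linarith
      qed simp
      \<comment> \<open>With sqrt k \<le> n, the mesh 1 / n^4 places every parameter within n^-3 of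
        the net, while the size stays below (n^6)^k = exp (6 \<rho>^2).\<close>
      define N where "N = n ^ 4"
      have N0: "N > 0" using n0 by (simp add: N_def)
      obtain G where G: "G \<subseteq> param_cube k" "finite G" "card G \<le> (2 * N + 1) ^ k"
        "\<And>\<theta>. \<theta> \<in> param_cube k \<Longrightarrow> \<exists>\<theta>'\<in>G. l2_norm (\<theta> - \<theta>') \<le> sqrt (real k) / real N"
        using param_cube_net[OF N0, of k] by blast
      define X where "X = (\<lambda>\<theta> a. g \<theta> u $ a) ` G"
      have Xfin: "finite X" using G by (simp add: X_def)
      have cardX: "real (card X) \<le> exp (6 * \<rho>\<^sup>2)"
      proof -
        have "card X \<le> (2 * N + 1) ^ k"
          using G(3) card_image_le[OF G(2), of "\<lambda>\<theta> a. g \<theta> u $ a"] unfolding X_def by linarith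
        also have "\<dots> \<le> (n ^ 6) ^ k"
        proof (rule power_mono)
          have "4 \<le> n * n" using mult_le_mono[OF n2 n2] by simp
          then have "4 * N \<le> n * n * N" by (rule mult_le_mono1)
          moreover have "n * n * N = n ^ 6" by (simp add: N_def power_numeral_reduce)
          ultimately show "2 * N + 1 \<le> n ^ 6" using N0 by linarith
        qed simp
        finally have "real (card X) \<le> real ((n ^ 6) ^ k)" by (simp only: of_nat_le_iff)
        also have "\<dots> = real n ^ (6 * k)" by (simp add: power_mult)
        also have "\<dots> = exp (real (6 * k) * ln (real n))" using n0 by (subst exp_of_nat_mult) simp
        finally show ?thesis by (simp add: \<rho>sq mult.assoc)
      qed
      have xX: "\<forall>x\<in>X. \<forall>a<n. x_min \<le> x a \<and> x a \<le> x_max"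
        using bC G(1) unfolding X_def signal_class_def by blast
      \<comment> \<open>With these choices of \<open>s\<close> and \<open>dev\<close> the exponent
        is \<rho>^2 / 16 - 8 \<rho>^2, below the required - 7 \<rho>^2.\<close>
      define s where "s = \<rho> / (16 * \<kappa> * sqrt (real m * real L))"
      define dev where "dev = 128 * \<kappa> * \<rho> * sqrt (real m / real L)"
      define \<beta> where "\<beta> = exp (- 7 * \<rho>\<^sup>2)"
      have \<kappa>1: "\<kappa> \<ge> 1" using xm xM by (simp add: \<kappa>_def)
      have xM0: "x_max > 0" using xm xM by linarith
      have sq0: "sqrt (real m * real L) > 0" using m0 L0 by simp
      have s0: "s > 0" using \<rho>0 \<kappa>1 sq0 by (simp add: s_def)
      have s1: "16 * s * (x_max / x_min)\<^sup>2 \<le> 1"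
        unfolding \<kappa>_def[symmetric] using \<rho>Lm \<kappa>1 sq0 by (simp add: s_def mult.commute)
      have \<beta>: "exp (real L * (16 * s\<^sup>2 * ((x_max / x_min)\<^sup>2)\<^sup>2 * real m - s * dev)) \<le> \<beta>"
      proof -
        have "real L * (16 * s\<^sup>2 * \<kappa>\<^sup>2 * real m) = \<rho>\<^sup>2 / 16"
          using \<kappa>1 m0 L0 by (simp add: s_def power_divide power_mult_distrib field_simps)
        moreover have "real L * (s * dev) = 8 * \<rho>\<^sup>2"
        proof -
          have "sqrt (real m / real L) = sqrt (real m * real L) / real L"
            using L0 by (simp add: real_sqrt_divide real_sqrt_mult field_simps)
          then show ?thesis using \<kappa>1 sq0 L0 m0 by (simp add: s_def dev_def power2_eq_square)
        qed
        ultimately have "real L * (16 * s\<^sup>2 * \<kappa>\<^sup>2 * real m - s * dev) = \<rho>\<^sup>2 / 16 - 8 * \<rho>\<^sup>2"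
          by (simp only: right_diff_distrib)
        moreover have "\<rho>\<^sup>2 \<ge> 0" by simp
        ultimately have "real L * (16 * s\<^sup>2 * \<kappa>\<^sup>2 * real m - s * dev) \<le> - 7 * \<rho>\<^sup>2" by linarith
        then show ?thesis unfolding \<kappa>_def[symmetric] \<beta>_def by simp
      qed
      define thr where "thr = K * (real n * \<rho> / real m)"
      have thr: "\<forall>D\<ge>thr. exp (- real (m div 2) * D / (64 * (x_max\<^sup>2)\<^sup>2))
          + exp (- real (m div 2) * real (m - m div 2) * D / (245760 * real n * (x_max\<^sup>2)\<^sup>2)) \<le> 2 * \<beta>"
        unfolding \<beta>_def
      proof (intro allI impI, rule tail_exponents)
        show "10321920 * (x_max\<^sup>2)\<^sup>2 * (real n * \<rho> / real m) \<le> D" if "thr \<le> D" for D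
          using that unfolding thr_def K_def .
      qed (use m2 mn \<rho>0 \<rho>m xM0 in auto)
      have md: "m div 2 \<le> m" by simp
      obtain E where E: "E \<in> sets ?P"
        "measure ?P E \<ge> 1 - (exp (- real n / 2) + exp (- (real L * real n / 8)) + 3 * real (card X) * \<beta>)"
        "\<And>\<omega>. \<omega> \<in> E \<Longrightarrow> det (mat_of m (\<lambda>i k. fst \<omega> (i, k))) \<noteq> 0"
        "\<And>\<omega>. \<omega> \<in> E \<Longrightarrow> net_bounded m n (fst \<omega>)"
        "\<And>\<omega>. \<omega> \<in> E \<Longrightarrow> (\<Sum>q<L. \<Sum>a<n. (snd \<omega> (q, a))\<^sup>2) \<le> 4 * real L * real n * \<sigma>\<^sup>2"
        "\<And>\<omega> x. \<omega> \<in> E \<Longrightarrow> x \<in> X \<Longrightarrow> gap_deviation m n L \<sigma> (\<lambda>a. xo $ a) x \<omega> \<le> dev"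
        "\<And>\<omega> x. \<omega> \<in> E \<Longrightarrow> x \<in> X \<Longrightarrow> thr \<le> sq_dist n (\<lambda>a. xo $ a) x \<Longrightarrow>
          real (m div 2) * real (m - m div 2) * sq_dist n (\<lambda>a. xo $ a) x / 4 \<le> gram_dist m n (\<lambda>a. xo $ a) x (fst \<omega>)"
        using good_event[OF Xfin xm xM xX bo' less_imp_le[OF mn] n0 \<sigma> L md s0 s1 \<beta> thr] by blast
      \<comment> \<open>Net size times tail is exp (6 \<rho>^2 - 7 \<rho>^2) = exp (- k ln n); the
        factor 3 counts the tail terms per net point.\<close>
      have "1 - 3 * prb \<le> measure ?P E"
      proof -
        have "real (card X) * \<beta> \<le> exp (6 * \<rho>\<^sup>2) * \<beta>"
          using cardX by (intro mult_right_mono) (auto simp: \<beta>_def)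
        also have "\<dots> = exp (- (real k * ln (real n)))" by (simp add: \<beta>_def exp_add[symmetric] \<rho>sq[symmetric])
        finally have "3 * real (card X) * \<beta> \<le> 3 * exp (- (real k * ln (real n)))" by simp
        moreover have "exp (- real n / 2) \<le> exp (- (real m / 2))" using mn' by simp
        moreover have "0 \<le> exp (- (real m / 2))" "0 \<le> exp (- (real L * real n / 8))"
          "0 \<le> exp (real k * ln (real n) - real n / 2)" by simp_all
        moreover have "1 - 3 * (a + b + c + d) \<le> p"
          if "1 - (a' + b + z) \<le> p" "z \<le> 3 * c" "a' \<le> a" "0 \<le> a" "0 \<le> b" "0 \<le> d"
          for a a' b c d p z :: real
        proof -
          have "3 * (a + b + c + d) = 3 * a + 3 * b + 3 * c + 3 * d" by simp
          then show ?thesis using that by linarith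
        qed
        ultimately show ?thesis using E(2) unfolding prb_def by blast
      qed
      moreover have "(1 / real n) * (l2_norm (xhat - xo))\<^sup>2 \<le> K1 * rate"
        if \<omega>: "\<omega> \<in> E" and mini: "is_arg_min (?f \<omega>) (\<lambda>x. x \<in> signal_class k g u) xhat" for \<omega> xhat
      proof -
        have xh: "xhat \<in> signal_class k g u" and mini': "?f \<omega> xhat \<le> ?f \<omega> xo"
          using mini xoC unfolding is_arg_min_def by (auto simp: not_less)
        obtain \<theta> where \<theta>: "\<theta> \<in> param_cube k" "xhat = g \<theta> u" using xh by (auto simp: signal_class_def)
        obtain \<theta>' where \<theta>': "\<theta>' \<in> G" "l2_norm (\<theta> - \<theta>') \<le> sqrt (real k) / real N" using G(4)[OF \<theta>(1)] by blast
        define x where "x = g \<theta>' u"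
        have \<theta>'c: "\<theta>' \<in> param_cube k" using \<theta>' G(1) by blast
        have xC: "x \<in> signal_class k g u" using \<theta>'c by (auto simp: x_def signal_class_def)
        have xX': "(\<lambda>a. x $ a) \<in> X" using \<theta>'(1) by (auto simp: x_def X_def)
        define \<epsilon> where "\<epsilon> = 1 / real n ^ 3"
        have \<epsilon>: "0 \<le> \<epsilon>" "\<epsilon> \<le> 1" using n0 by (auto simp: \<epsilon>_def)
        have "l2_norm (xhat - x) \<le> 1 * l2_norm (\<theta> - \<theta>')"
          using lip \<theta>(1) \<theta>'c unfolding lipschitz_on_cube_def \<theta>(2) x_def by blast
        also have "\<dots> \<le> real n / real N" using \<theta>'(2) sk by (simp add: order_trans[OF _ divide_right_mono])
        also have "\<dots> = \<epsilon>" using n0 by (simp add: N_def \<epsilon>_def power_numeral_reduce)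
        finally have cl: "l2_norm (xhat - x) \<le> \<epsilon>" .
        have close: "\<bar>xhat $ a - x $ a\<bar> \<le> \<epsilon>" if "a < n" for a
          using entry_le_l2_norm[OF Cn[OF xh] Cn[OF xC] that] cl by linarith
        let ?D = "sq_dist n (\<lambda>a. xo $ a) (\<lambda>a. x $ a)"
        have cmp: "gram_dist m n (\<lambda>a. xo $ a) (\<lambda>a. x $ a) (fst \<omega>) / (4 * \<kappa> * (x_max\<^sup>2 * (1920 * real n))\<^sup>2)
            \<le> dev + ((1 + \<epsilon> / x_min)\<^sup>2 - 1) * (5 * \<kappa> * real n)"
          unfolding \<kappa>_def
          by (rule minimiser_comparison[OF xm xM Cn[OF xC] Cn[OF xoC] Cn[OF xh] bC[OF xC] bC[OF xoC] bC[OF xh]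
                less_imp_le[OF mn] n0 \<sigma> L close \<epsilon>(1) mini' E(3)[OF \<omega>] E(4)[OF \<omega>] E(5)[OF \<omega>] E(6)[OF \<omega> xX']])
        have disc: "((1 + \<epsilon> / x_min)\<^sup>2 - 1) * (5 * \<kappa> * real n) \<le> c / (real n)\<^sup>2"
        proof -
          have "(1 + \<epsilon> / x_min)\<^sup>2 - 1 = 2 / x_min * \<epsilon> + 1 / x_min\<^sup>2 * (\<epsilon> * \<epsilon>)"
            by (simp add: power2_eq_square algebra_simps)
          also have "\<dots> \<le> 2 / x_min * \<epsilon> + 1 / x_min\<^sup>2 * (\<epsilon> * 1)"
            using \<epsilon> by (intro add_left_mono mult_left_mono) auto
          also have "\<dots> = (2 / x_min + 1 / x_min\<^sup>2) * \<epsilon>" by (simp add: distrib_right)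
          finally have "((1 + \<epsilon> / x_min)\<^sup>2 - 1) * (5 * \<kappa> * real n) \<le> (2 / x_min + 1 / x_min\<^sup>2) * \<epsilon> * (5 * \<kappa> * real n)"
            using \<kappa>1 by (intro mult_right_mono) auto
          also have "\<dots> = c * (\<epsilon> * real n)" by (simp add: c_def mult_ac)
          also have "\<epsilon> * real n = 1 / (real n)\<^sup>2" using n0 by (simp add: \<epsilon>_def power_numeral_reduce)
          finally show ?thesis by simp
        qed
        \<comment> \<open>Below the threshold the distance itself is within the first term of the
          rate; only above it is the likelihood comparison needed.\<close>
        have Dn: "?D / real n \<le> (K + W) * rate"
        proof (cases "thr \<le> ?D")
          case True
          have D0: "?D \<ge> 0" unfolding sq_dist_def by (intro sum_nonneg) auto
          have "(real m)\<^sup>2 * ?D / 24 = ((real m)\<^sup>2 / 6) * (?D / 4)" by simp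
          also have "\<dots> \<le> (real (m div 2) * real (m - m div 2)) * (?D / 4)"
            using half_split_bounds(2)[OF m2] D0 by (intro mult_right_mono) auto
          also have "\<dots> \<le> gram_dist m n (\<lambda>a. xo $ a) (\<lambda>a. x $ a) (fst \<omega>)" using E(7)[OF \<omega> xX' True] by simp
          finally have "(real m)\<^sup>2 * ?D / 24 / (4 * \<kappa> * (H * real n)\<^sup>2)
              \<le> gram_dist m n (\<lambda>a. xo $ a) (\<lambda>a. x $ a) (fst \<omega>) / (4 * \<kappa> * (H * real n)\<^sup>2)"
            using \<kappa>1 by (intro divide_right_mono) auto
          also have "\<dots> \<le> dev + c / (real n)\<^sup>2"
          proof -
            have Hn: "H * real n = x_max\<^sup>2 * (1920 * real n)" by (simp add: H_def)
            show ?thesis unfolding Hn using cmp disc by linarith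
          qed
          finally have "?D / real n \<le> W * rate"
            unfolding W_def rate_def dev_def
            using m mn L \<rho>0 \<kappa>1 xM0 c0 by (intro gap_to_rate) (auto simp: H_def)
          moreover have "0 \<le> K * rate" using KW rate0 by (simp add: rate_def)
          ultimately show ?thesis by (simp add: distrib_right)
        next
          case False
          then have "?D / real n \<le> thr / real n" using n0 by (intro divide_right_mono) auto
          also have "\<dots> = K * (\<rho> / real m)" using n0 by (simp add: thr_def)
          also have "\<dots> \<le> (K + W) * rate"
            using KW rate0 by (intro mult_mono) (auto simp: rate_def)
          finally show ?thesis .
        qed
        have "(l2_norm (xhat - xo))\<^sup>2 \<le> 2 * (l2_norm (xhat - x))\<^sup>2 + 2 * (l2_norm (x - xo))\<^sup>2"
          by (rule sq_norm_triangle[OF Cn[OF xh] Cn[OF xC] Cn[OF xoC]])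
        also have "\<dots> \<le> 2 * 1 + 2 * (?D / (4 * x_min\<^sup>2))"
        proof (intro add_mono mult_left_mono)
          have "(l2_norm (xhat - x))\<^sup>2 \<le> 1\<^sup>2" using cl \<epsilon> l2_norm_nonneg by (intro power_mono) (auto intro: order_trans)
          then show "(l2_norm (xhat - x))\<^sup>2 \<le> 1" by simp
          show "(l2_norm (x - xo))\<^sup>2 \<le> ?D / (4 * x_min\<^sup>2)"
            by (rule sq_norm_diff_le(2)[OF Cn[OF xC] Cn[OF xoC] xm bC[OF xC] bC[OF xoC]])
        qed simp_all
        finally have "(1 / real n) * (l2_norm (xhat - xo))\<^sup>2 \<le> (1 / real n) * (2 * 1 + 2 * (?D / (4 * x_min\<^sup>2)))"
          by (intro mult_left_mono) auto
        also have "\<dots> = 2 / real n + (?D / real n) / (2 * x_min\<^sup>2)"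
          by (simp add: distrib_left)
        also have "\<dots> \<le> 4 * rate + ((K + W) * rate) / (2 * x_min\<^sup>2)"
        proof (intro add_mono divide_right_mono Dn)
          have "2 / real n \<le> 2 / real m" using m0 mn' by (intro divide_left_mono) auto
          also have "\<dots> \<le> 4 * (\<rho> / real m)" using \<rho>0 m0 by (simp add: field_simps)
          also have "\<dots> \<le> 4 * rate" using rate0 by (simp add: rate_def)
          finally show "2 / real n \<le> 4 * rate" .
        qed simp
        also have "\<dots> = (4 + (K + W) / (2 * x_min\<^sup>2)) * rate" by (simp add: distrib_right)
        also have "\<dots> \<le> K1 * rate" using K1(3) rate0 by (intro mult_right_mono) (auto simp: rate_def)
        finally show ?thesis .
      qed
      ultimately show "\<exists>E\<in>sets ?P. 1 - 3 * prb \<le> measure ?P E \<and> (\<forall>\<omega>\<in>E. \<forall>xhat.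
          is_arg_min (?f \<omega>) (\<lambda>x. x \<in> signal_class k g u) xhat \<longrightarrow> (1 / real n) * (l2_norm (xhat - xo))\<^sup>2 \<le> K1 * rate)"
        using E(1) by blast
    qed
  qed
qed

end
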